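(* Let $c\in\mathbb{C}$ and let $P(w)$ be a polynomial in $w$ with constant complex coefficients, of degree $k$. Then the classical conjecture holds for the second order differential equation $$w''+cw'+P(w)=0,$$ i.e. for every meromorphic solution $w$ of this equation there exist $a,b,\gamma\in\mathbb{R}^{+}$ such that $$T(r,w)<a\exp(br^{\gamma}),\qquad 0\le r<\infty.$$
   Context: "Meromorphic" means meromorphic on the whole complex plane $\mathbb{C}$. $T(r,w)$ is the Nevanlinna characteristic of $w$. Hayman's classical conjecture for an algebraic ODE $Q(z,w,w',\dots,w^{(n)})=0$ ($Q$ a polynomial in all its arguments) asserts that each meromorphic solution $w$ satisfies $T(r,w)<a\exp_{n-1}(br^{\gamma})$, $0\le r<\infty$, for some $a,b,\gamma\in\mathbb{R}^{+}$, where $\exp_0(x)=x$ and $\exp_l(x)=\exp(\exp_{l-1}(x))$; here $n=2$. *)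

theory Defs
  imports "HOL-Complex_Analysis.Complex_Analysis"
begin

definition log_plus :: "real \<Rightarrow> real" where
  "log_plus x = max 0 (ln x)"

definition proximity :: "real \<Rightarrow> (complex \<Rightarrow> complex) \<Rightarrow> real" where
  "proximity r w =
     1 / (2 * pi) * integral {0..2 * pi} (\<lambda>\<theta>. log_plus (cmod (w (of_real r * cis \<theta>))))"

text \<open>Poles in the closed disc of radius \<open>t\<close>, counted with multiplicity; at a pole,
  \<^const>\<open>zorder\<close> is minus the multiplicity.\<close>

definition pole_count :: "real \<Rightarrow> (complex \<Rightarrow> complex) \<Rightarrow> nat" where
  "pole_count t w = (\<Sum>z | cmod z \<le> t \<and> is_pole w z. nat (- zorder w z))"

lemma finite_poles_cball:
  assumes "w meromorphic_on UNIV"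
  shows "finite {z. cmod z \<le> t \<and> is_pole w z}"
proof -
  have "{z. is_pole w z} sparse_in UNIV"
    using meromorphic_on_imp_not_pole_cosparse[OF assms] by (simp add: eventually_cosparse)
  then have "{z. is_pole w z} sparse_in cball 0 t"
    by (rule sparse_in_subset) simp
  then have "finite (cball 0 t \<inter> {z. is_pole w z})"
    by (intro sparse_in_compact_finite) (auto intro: sparse_in_subset2)
  then show ?thesis
    by (simp add: Int_def)
qed

definition integrated_count :: "real \<Rightarrow> (complex \<Rightarrow> complex) \<Rightarrow> real" where
  "integrated_count r w =
     integral {0..r} (\<lambda>t. (real (pole_count t w) - real (pole_count 0 w)) / t)
     + real (pole_count 0 w) * ln r"

text \<open>If \<open>w\<close> is analytic at 0, then \<open>nevanlinna_T 0 w\<close> is the usual \<open>log_plus (cmod (w 0))\<close>. If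
  \<open>w\<close> has a pole at 0, the classical expression is not defined at \<open>r = 0\<close>; the convention
  \<^prop>\<open>ln (0::real) = 0\<close> then makes the value a finite number, which depends on the
  value that \<open>w\<close> happens to take at the pole.\<close>

definition nevanlinna_T :: "real \<Rightarrow> (complex \<Rightarrow> complex) \<Rightarrow> real" where
  "nevanlinna_T r w = proximity r w + integrated_count r w"

text \<open>The predicate \<^const>\<open>meromorphic_on\<close> leaves the values of \<open>w\<close> unconstrained on a
  sparse set (poles and removable singularities), so the equation is imposed exactly where
  \<open>w\<close> is analytic; the complement of that set is sparse.\<close>

definition meromorphic_solution :: "complex \<Rightarrow> complex poly \<Rightarrow> (complex \<Rightarrow> complex) \<Rightarrow> bool" where
  "meromorphic_solution c P w \<longleftrightarrow>
     w meromorphic_on UNIV \<and>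
     (\<forall>z. w analytic_on {z} \<longrightarrow> deriv (deriv w) z + c * deriv w z + poly P (w z) = 0)"

end

theory Submission
  imports Defs
begin

text \<open>The proof bounds \<open>T(r, w)\<close> by showing that the poles of a solution are not too dense and that
the solution is large only close to its poles, both at a scale that shrinks at most
exponentially in \<open>|z|\<close>. So \<open>\<gamma> = 1\<close> always works.

Comparing the orders of \<open>w''\<close> and \<open>P(w)\<close> at a pole of order \<open>m\<close> gives \<open>m * deg P = m + 2\<close>
(\<open>pole_order_balance\<close>). Hence a solution with a pole has \<open>deg P = 2\<close> and double poles or
\<open>deg P = 3\<close> and simple poles; every other solution is entire. An entire solution is bounded if
\<open>deg P \<ge> 2\<close>: at a point of maximum modulus, the equation and the Cauchy estimates give
\<open>M(r)^2 \<le> const * M(r + \<delta>) / \<delta>^2\<close>, and such a superlinear inequality forces \<open>M\<close> to blow up at a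
finite radius as soon as \<open>M\<close> exceeds a constant (\<open>superlinear_growth_bounded\<close>). If
\<open>deg P \<le> 1\<close>, the equation is linear and its solutions have exponential type.

For \<open>deg P = 2\<close> and \<open>deg P = 3\<close> an affine change of \<open>w\<close> gives the normal forms
\<open>P(w) = -6 w^2 + p0\<close> and \<open>P(w) = -2 w^3 + p1 w + p0\<close>. The energy \<open>w'^2 / 2 + \<integral> P(w)\<close> is conserved only
for \<open>c = 0\<close>, but for each \<open>c\<close> it has a modification \<open>V\<close> by terms of lower weight with
\<open>V' = - \<kappa> V + q\<close>, where \<open>q\<close> has only poles of low order. Single-valuedness of \<open>exp(\<kappa> z) V\<close> at a
pole (\<open>no_logarithmic_term\<close>) gives a relation between \<open>c\<close> and the coefficients of \<open>P\<close>. For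
\<open>deg P = 2\<close> this makes \<open>q\<close> constant, so \<open>V\<close> extends to an entire function of exponential growth.
For \<open>deg P = 3\<close> either \<open>q = 0\<close>, or all poles have the same residue \<open>\<epsilon>\<close>. In the latter case
\<open>h = w' + \<epsilon> w^2 + (c/3) w\<close> is entire, \<open>q\<close> can be replaced by a multiple of \<open>h\<close>, and eliminating \<open>w\<close>
gives an algebraic relation between \<open>h\<close>, \<open>h'\<close> and the new \<open>V\<close>, to which the
maximum modulus argument for entire solutions applies again (\<open>entire_pair_growth\<close>).

So in all cases \<open>w'^2 = m^2 w^(2 + 2/m)\<close> up to lower order terms and an error of size
\<open>exp(O(|z|))\<close>. Where \<open>w\<close> is large compared with that error, the function \<open>G = - m w / w'\<close> has
derivative close to 1 and vanishes exactly at the poles. The contraction principle then produces a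
pole near each point at which \<open>w\<close> is large, and injectivity of \<open>G\<close> separates the poles
(\<open>exponentially_tame_if_dominant_balance\<close>). These two facts bound the counting function by a
packing argument and the proximity function by integrals of \<open>ln (1 / |z - a|)\<close> over circles
(\<open>nevanlinna_T_exponential_bound\<close>).\<close>

section \<open>Growth of the characteristic from data on poles\<close>

text \<open>A function that is not integrable has integral 0, and \<open>I\<close> is nonnegative; so a dominating function off a finite
set suffices. In this way the proximity function can be estimated from above on every circle,
including those that pass through poles.\<close>

lemma integral_le_off_finite:
  fixes f H :: "real \<Rightarrow> real"
  assumes H: "(H has_integral I) {a..b}" and "0 \<le> I" and "finite N"
    and le: "\<And>x. x \<in> {a..b} - N \<Longrightarrow> f x \<le> H x"
  shows "integral {a..b} f \<le> I"
proof (cases "f integrable_on {a..b}")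
  case True
  have N: "negligible N" using \<open>finite N\<close> by (rule negligible_finite)
  define g where "g x = (if x \<in> N then H x else f x)" for x
  have g: "(g has_integral integral {a..b} f) {a..b}"
    by (rule has_integral_spike[OF N _ integrable_integral[OF True]]) (simp add: g_def)
  show ?thesis
    by (rule has_integral_le[OF g H]) (use le in \<open>auto simp: g_def\<close>)
qed (use \<open>0 \<le> I\<close> in \<open>simp add: not_integrable_integral\<close>)

lemma has_integral_inverse_sqrt_abs:
  fixes \<beta> :: real
  shows "((\<lambda>t. 1 / sqrt \<bar>t - \<beta>\<bar>) has_integral
          (sgn (2*pi - \<beta>) * (2 * sqrt \<bar>2*pi - \<beta>\<bar>) - sgn (0 - \<beta>) * (2 * sqrt \<bar>0 - \<beta>\<bar>))) {0..2*pi}"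
proof (rule fundamental_theorem_of_calculus_interior_strong[of "{\<beta>}"])
  show "continuous_on {0..2*pi} (\<lambda>t. sgn (t - \<beta>) * (2 * sqrt \<bar>t - \<beta>\<bar>))"
  proof -
    have eq: "sgn (t - \<beta>) * (2 * sqrt \<bar>t - \<beta>\<bar>) = 2 * root 2 (max 0 (t - \<beta>)) - 2 * root 2 (max 0 (\<beta> - t))" for t
      by (cases "t < \<beta>"; cases "t = \<beta>") (auto simp: sqrt_def)
    show ?thesis unfolding eq by (intro continuous_intros)
  qed
  fix t assume t: "t \<in> {0<..<2*pi} - {\<beta>}"
  consider "t < \<beta>" | "\<beta> < t" using t by force
  then have "((\<lambda>t. sgn (t - \<beta>) * (2 * sqrt \<bar>t - \<beta>\<bar>)) has_real_derivative 1 / sqrt \<bar>t - \<beta>\<bar>) (at t)"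
  proof cases
    case 1
    have "((\<lambda>t. - 2 * sqrt (\<beta> - t)) has_real_derivative 1 / sqrt \<bar>t - \<beta>\<bar>) (at t)"
      using 1 by (auto intro!: derivative_eq_intros simp: field_simps)
    moreover have "eventually (\<lambda>t. - 2 * sqrt (\<beta> - t) = sgn (t - \<beta>) * (2 * sqrt \<bar>t - \<beta>\<bar>)) (nhds t)"
      by (rule eventually_mono[OF eventually_nhds_in_open[of "{..<\<beta>}" t]]) (use 1 in auto)
    ultimately show ?thesis by (subst (asm) DERIV_cong_ev[OF refl _ refl])
  next
    case 2
    have "((\<lambda>t. 2 * sqrt (t - \<beta>)) has_real_derivative 1 / sqrt \<bar>t - \<beta>\<bar>) (at t)"
      using 2 by (auto intro!: derivative_eq_intros simp: field_simps)
    moreover have "eventually (\<lambda>t. 2 * sqrt (t - \<beta>) = sgn (t - \<beta>) * (2 * sqrt \<bar>t - \<beta>\<bar>)) (nhds t)"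
      by (rule eventually_mono[OF eventually_nhds_in_open[of "{\<beta><..}" t]]) (use 2 in auto)
    ultimately show ?thesis by (subst (asm) DERIV_cong_ev[OF refl _ refl])
  qed
  then show "((\<lambda>t. sgn (t - \<beta>) * (2 * sqrt \<bar>t - \<beta>\<bar>)) has_vector_derivative 1 / sqrt \<bar>t - \<beta>\<bar>) (at t)"
    by (simp only: has_real_derivative_iff_has_vector_derivative)
qed simp_all

lemma abs_sin_ge_half:
  fixes y :: real
  assumes "\<bar>y\<bar> \<le> pi/2"
  shows "\<bar>y\<bar> / 2 \<le> \<bar>sin y\<bar>"
proof -
  have *: "y / 2 \<le> sin y" if "0 \<le> y" "y \<le> pi/2" for y :: real
  proof (cases "y \<le> pi/3")
    case True
    have "(\<lambda>y. sin y - y/2) 0 \<le> (\<lambda>y. sin y - y/2) y"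
    proof (rule DERIV_nonneg_imp_nondecreasing[OF \<open>0 \<le> y\<close>])
      fix x assume x: "0 \<le> x" "x \<le> y"
      have "cos (pi/3) \<le> cos x" using x True by (intro cos_monotone_0_pi_le) auto
      then show "\<exists>d. DERIV (\<lambda>y. sin y - y/2) x :> d \<and> 0 \<le> d"
        by (intro exI[of _ "cos x - 1/2"]) (auto intro!: derivative_eq_intros simp: cos_60)
    qed
    then show ?thesis by simp
  next
    case False
    have "sin (pi/3) \<le> sin y" using False that by (intro sin_monotone_2pi_le) auto
    moreover have "(4/5::real) \<le> sin (pi/3)"
      unfolding sin_60 using real_le_rsqrt[of "8/5" 3] by (simp add: power2_eq_square)
    moreover have "y / 2 \<le> 4/5" using that pi_less_4 pi_approx by simp
    ultimately show ?thesis by simp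
  qed
  show ?thesis
  proof (cases "0 \<le> y")
    case True then show ?thesis using *[of y] assms by auto
  next
    case False then show ?thesis using *[of "-y"] assms by auto
  qed
qed

lemma ln_le_two_sqrt:
  fixes t :: real
  assumes "t > 0" shows "ln t \<le> 2 * sqrt t"
  using ln_le_minus_one[of "sqrt t"] assms by (simp add: ln_sqrt)

text \<open>Since \<open>ln t \<le> 2 sqrt t\<close>, the logarithmic singularity of \<open>- ln |sin x|\<close> at a zero \<open>j \<pi>\<close> of the sine is
dominated by the singularity of \<open>|x - j \<pi>|^(-1/2)\<close>, whose integral is elementary. The range of \<open>x\<close>
is that of \<open>\<theta> - Arg a\<close> for \<open>0 \<le> \<theta> \<le> 2 \<pi>\<close>; the multiples of \<open>\<pi>\<close> nearest to such points have
\<open>-1 \<le> j \<le> 3\<close>.\<close>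

lemma neg_ln_abs_sin_le:
  fixes x :: real
  assumes x: "- pi \<le> x" "x \<le> 3*pi" and nz: "sin x \<noteq> 0"
  shows "- ln \<bar>sin x\<bar> \<le> (\<Sum>j\<in>{-1..3::int}. 3 / sqrt \<bar>x - of_int j * pi\<bar>)"
proof -
  define j where "j = round (x / pi)"
  have "\<bar>of_int j - x / pi\<bar> \<le> 1/2" unfolding j_def by (rule of_int_round_abs_le)
  then have "\<bar>of_int j - x / pi\<bar> * pi \<le> 1/2 * pi" by (intro mult_right_mono) auto
  moreover have "\<bar>of_int j - x / pi\<bar> * pi = \<bar>x - of_int j * pi\<bar>"
  proof -
    have "\<bar>of_int j - x / pi\<bar> * pi = \<bar>(of_int j - x / pi) * pi\<bar>" by (simp add: abs_mult)
    also have "(of_int j - x / pi) * pi = of_int j * pi - x" by (simp add: field_simps)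
    finally show ?thesis by (simp add: abs_minus_commute)
  qed
  ultimately have y: "\<bar>x - of_int j * pi\<bar> \<le> pi/2" by simp
  define y where "y = x - of_int j * pi"
  have "\<bar>sin y\<bar> = \<bar>sin x\<bar>"
    unfolding y_def sin_diff by (simp add: abs_mult mult.commute[of _ pi] cos_npi_int sin_npi_int)
  then have s: "\<bar>y\<bar>/2 \<le> \<bar>sin x\<bar>" using abs_sin_ge_half[of y] y by (simp add: y_def)
  have y0: "y \<noteq> 0" using nz \<open>\<bar>sin y\<bar> = \<bar>sin x\<bar>\<close> by auto
  have jr: "j \<in> {-1..3}"
  proof -
    have "of_int j * pi \<le> 3.5*pi" "-1.5*pi \<le> of_int j * pi" using y x by linarith+
    then have "of_int j \<le> (3.5::real)" "(-1.5::real) \<le> of_int j"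
      using mult_right_le_imp_le[OF _ pi_gt_zero] by blast+
    then show ?thesis by (auto; linarith)
  qed
  have "- ln \<bar>sin x\<bar> \<le> - ln (\<bar>y\<bar>/2)" using s y0 nz by simp
  also have "\<dots> = ln (2/\<bar>y\<bar>)" using y0 by (simp add: ln_div)
  also have "\<dots> \<le> 2 * sqrt (2/\<bar>y\<bar>)" using y0 by (intro ln_le_two_sqrt) auto
  also have "\<dots> = 2 * sqrt 2 / sqrt \<bar>y\<bar>" by (simp add: real_sqrt_divide)
  also have "\<dots> \<le> 3 / sqrt \<bar>y\<bar>"
    using real_le_lsqrt[of "3/2" 2] by (intro divide_right_mono) (auto simp: power2_eq_square)
  also have "\<dots> \<le> (\<Sum>j\<in>{-1..3::int}. 3 / sqrt \<bar>x - of_int j * pi\<bar>)"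
    unfolding y_def using jr by (intro member_le_sum[of j "{-1..3}" "\<lambda>j. 3 / sqrt \<bar>x - of_int j * pi\<bar>"]) auto
  finally show ?thesis .
qed

text \<open>The singularities lie at the angles at which \<open>r cis \<theta>\<close> is on the line through 0 and \<open>a\<close>.\<close>

definition log_distance_majorant :: "complex \<Rightarrow> real \<Rightarrow> real" where
  "log_distance_majorant a \<theta> = (\<Sum>j\<in>{-1..3::int}. 3 / sqrt \<bar>\<theta> - (Arg a + of_int j * pi)\<bar>)"

text \<open>The distance between \<open>r cis \<theta>\<close> and \<open>a\<close> is at least the distance between \<open>r cis \<theta>\<close> and the line through 0
and \<open>a\<close>, which is \<open>r |sin (\<theta> - Arg a)|\<close>. This works uniformly in \<open>|a|\<close>, in particular for
poles on the circle.\<close>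

lemma log_distance_majorant:
  assumes \<delta>: "0 < \<delta>" "\<delta> \<le> 1" "\<delta> \<le> r" and \<theta>: "0 \<le> \<theta>" "\<theta> \<le> 2*pi" and nz: "sin (\<theta> - Arg a) \<noteq> 0"
  shows "- ln (cmod (of_real r * cis \<theta> - a)) \<le> - ln \<delta> + log_distance_majorant a \<theta>"
proof -
  let ?s = "sin (\<theta> - Arg a)"
  have a: "a = of_real (cmod a) * cis (Arg a)" using rcis_cmod_Arg[of a] by (simp add: rcis_def)
  have "cmod (of_real r * cis \<theta> - a) = cmod (cis (- Arg a) * (of_real r * cis \<theta> - a))"
    by (simp add: norm_mult)
  also have "cis (- Arg a) * (of_real r * cis \<theta> - a)
      = of_real r * cis (\<theta> - Arg a) - of_real (cmod a)"
  proof -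
    have "cis (- Arg a) * (of_real r * cis \<theta>) = of_real r * cis (\<theta> - Arg a)"
      by (simp add: cis_mult mult.left_commute)
    moreover have "cis (- Arg a) * a = of_real (cmod a)"
      by (subst (2) a) (simp add: cis_mult mult.left_commute)
    ultimately show ?thesis by (simp only: right_diff_distrib)
  qed
  also have "cmod \<dots> \<ge> \<bar>Im (of_real r * cis (\<theta> - Arg a) - of_real (cmod a))\<bar>" by (rule abs_Im_le_cmod)
  finally have "r * \<bar>?s\<bar> \<le> cmod (of_real r * cis \<theta> - a)" using \<delta> by (simp add: abs_mult)
  moreover have "\<delta> * \<bar>?s\<bar> \<le> r * \<bar>?s\<bar>" using \<delta> by (intro mult_right_mono) auto
  moreover have "0 < \<delta> * \<bar>?s\<bar>" using \<delta> nz by simp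
  ultimately have "ln (\<delta> * \<bar>?s\<bar>) \<le> ln (cmod (of_real r * cis \<theta> - a))"
    by (intro ln_mono) linarith+
  moreover have "ln (\<delta> * \<bar>?s\<bar>) = ln \<delta> + ln \<bar>?s\<bar>" using \<delta> nz by (simp add: ln_mult)
  moreover have "- ln \<bar>?s\<bar> \<le> log_distance_majorant a \<theta>"
    using neg_ln_abs_sin_le[of "\<theta> - Arg a"] \<theta> Arg_bounded[of a] nz
    unfolding log_distance_majorant_def by (simp add: algebra_simps)
  ultimately show ?thesis by simp
qed

lemma log_distance_majorant_nonneg: "0 \<le> log_distance_majorant a \<theta>"
  unfolding log_distance_majorant_def by (intro sum_nonneg) auto

lemma has_integral_log_distance_majorant:
  "\<exists>I. (log_distance_majorant a has_integral I) {0..2*pi} \<and> 0 \<le> I \<and> I \<le> 300"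
proof -
  define F where "F \<beta> = sgn (2*pi - \<beta>) * (2 * sqrt \<bar>2*pi - \<beta>\<bar>) - sgn (0 - \<beta>) * (2 * sqrt \<bar>0 - \<beta>\<bar>)" for \<beta> :: real
  define I where "I = (\<Sum>j\<in>{-1..3::int}. 3 * F (Arg a + of_int j * pi))"
  have I: "(log_distance_majorant a has_integral I) {0..2*pi}"
  proof -
    have "((\<lambda>t. 3 * (1 / sqrt \<bar>t - \<beta>\<bar>)) has_integral 3 * F \<beta>) {0..2*pi}" for \<beta>
      unfolding F_def by (intro has_integral_mult_right has_integral_inverse_sqrt_abs)
    then have "((\<lambda>t. 3 / sqrt \<bar>t - \<beta>\<bar>) has_integral 3 * F \<beta>) {0..2*pi}" for \<beta>
      by simp
    then show ?thesis
      unfolding log_distance_majorant_def[abs_def] I_def by (rule has_integral_sum[OF finite_atLeastAtMost_int])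
  qed
  have F: "F \<beta> \<le> 20" if "\<bar>\<beta>\<bar> \<le> 4*pi" for \<beta>
  proof -
    have *: "sgn x * (2 * sqrt \<bar>x\<bar>) \<le> 10 \<and> - (sgn x * (2 * sqrt \<bar>x\<bar>)) \<le> 10" if "\<bar>x\<bar> \<le> 25" for x :: real
    proof -
      have "sqrt \<bar>x\<bar> \<le> sqrt 25" using that by (intro real_sqrt_le_mono) auto
      then have "sqrt \<bar>x\<bar> \<le> 5" by (simp add: real_sqrt_eq_iff flip: power2_eq_square)
      then have "\<bar>sgn x * (2 * sqrt \<bar>x\<bar>)\<bar> \<le> 1 * 10"
        unfolding abs_mult by (intro mult_mono) (auto simp: sgn_if)
      then show ?thesis by linarith
    qed
    have "\<bar>2*pi - \<beta>\<bar> \<le> 25" "\<bar>0 - \<beta>\<bar> \<le> 25" using that pi_less_4 pi_approx by linarith+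
    from this[THEN *] show ?thesis unfolding F_def by linarith
  qed
  have "I \<le> (\<Sum>j\<in>{-1..3::int}. 60)" unfolding I_def
  proof (rule sum_mono)
    fix j :: int assume "j \<in> {-1..3}"
    then have j: "-1 \<le> real_of_int j" "real_of_int j \<le> 3" by auto
    have "-1*pi \<le> of_int j * pi" "of_int j * pi \<le> 3*pi" using j by (simp_all only: mult_right_mono pi_ge_zero)
    then have "\<bar>Arg a + of_int j * pi\<bar> \<le> 4*pi" using Arg_bounded[of a] by linarith
    from F[OF this] show "3 * F (Arg a + of_int j * pi) \<le> 60" by linarith
  qed
  moreover have "0 \<le> I" using has_integral_nonneg[OF I] log_distance_majorant_nonneg by blast
  ultimately show ?thesis using I by auto
qed

text \<open>The information about \<open>w\<close> from which its characteristic is estimated: the poles in the disc of radius \<open>R\<close> are at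
most exponentially many, and \<open>w\<close> exceeds an exponential bound only near a pole, where it is no larger than a
double pole allows. This form survives affine changes of \<open>w\<close>, and it does not mention circles or integrals.\<close>

definition exponentially_tame :: "(complex \<Rightarrow> complex) \<Rightarrow> bool" where
  "exponentially_tame w \<longleftrightarrow>
     (\<forall>a. is_pole w a \<longrightarrow> -2 \<le> zorder w a) \<and>
     (\<exists>C\<ge>0. \<forall>R\<ge>1.
        real (card {a. cmod a \<le> R \<and> is_pole w a}) \<le> exp (C * R) \<and>
        (\<forall>z. cmod z \<le> R \<longrightarrow> w analytic_on {z} \<longrightarrow>
           cmod (w z) \<le> exp (C * R) \<or>
           (\<exists>a. is_pole w a \<and> cmod (z - a) \<le> 1 \<and> cmod (w z) * cmod (z - a) ^ 2 \<le> exp (C * R))))"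

lemma le_exp_ln_mult:
  fixes Q R :: real
  assumes "1 \<le> Q" "1 \<le> R" shows "Q \<le> exp (ln Q * R)"
proof -
  have "ln Q * 1 \<le> ln Q * R" using assms by (intro mult_left_mono) auto
  then have "exp (ln Q) \<le> exp (ln Q * R)" by simp
  then show ?thesis using assms by simp
qed

lemma pole_count_0: "pole_count 0 w = (if is_pole w 0 then nat (- zorder w 0) else 0)"
proof -
  have "{z. cmod z \<le> 0 \<and> is_pole w z} = (if is_pole w 0 then {0} else {})" by auto
  then show ?thesis unfolding pole_count_def by simp
qed

lemma meromorphic_power_bound_at_0:
  assumes "w meromorphic_on UNIV"
  obtains \<delta> B where "0 < \<delta>" "\<delta> \<le> 1" "1 \<le> B"
    "\<And>z. 0 < cmod z \<Longrightarrow> cmod z \<le> \<delta> \<Longrightarrow> \<not> is_pole w z"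
    "\<And>z. 0 < cmod z \<Longrightarrow> cmod z \<le> \<delta> \<Longrightarrow> cmod (w z) * cmod z ^ pole_count 0 w \<le> B"
proof -
  have iso: "isolated_singularity_at w 0" and ness: "not_essential w 0"
    using assms by (auto intro: meromorphic_on_isolated_singularity meromorphic_on_not_essential
        meromorphic_on_subset)
  have "\<exists>l. ((\<lambda>z. w z * z ^ pole_count 0 w) \<longlongrightarrow> l) (at 0)"
  proof (cases "is_pole w 0")
    case True
    obtain e where e: "e > 0" "w holomorphic_on ball 0 e - {0}"
      using iso by (auto simp: isolated_singularity_at_def dest: analytic_imp_holomorphic)
    from zorder_exist_pole[OF e(2) open_ball _ True] e(1)
    obtain r where r: "r > 0" "zor_poly w 0 holomorphic_on cball 0 r" and z: "zorder w 0 < 0"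
      and eq: "\<And>z. z \<in> cball 0 r - {0} \<Longrightarrow> w z = zor_poly w 0 z / (z - 0) ^ nat (- zorder w 0)"
      by auto
    have "isCont (zor_poly w 0) 0"
      using holomorphic_on_imp_continuous_on[OF r(2)] r(1) by (simp add: continuous_on_interior)
    then have "(zor_poly w 0 \<longlongrightarrow> zor_poly w 0 0) (at 0)" by (simp add: isCont_def)
    moreover have "eventually (\<lambda>z. z \<in> ball 0 r - {0}) (at 0)"
      using r(1) by (intro eventually_at_in_open) auto
    then have "eventually (\<lambda>z. zor_poly w 0 z = w z * z ^ pole_count 0 w) (at 0)"
      by (rule eventually_mono) (use eq True in \<open>auto simp: pole_count_0\<close>)
    ultimately have "((\<lambda>z. w z * z ^ pole_count 0 w) \<longlongrightarrow> zor_poly w 0 0) (at 0)"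
      by (rule Lim_transform_eventually)
    then show ?thesis by (rule exI)
  next
    case False
    then obtain l where "(w \<longlongrightarrow> l) (at 0)" using ness by (auto simp: not_essential_def)
    with False show ?thesis by (auto simp: pole_count_0)
  qed
  then obtain l where l: "((\<lambda>z. w z * z ^ pole_count 0 w) \<longlongrightarrow> l) (at 0)" by blast
  have "eventually (\<lambda>z. dist (w z * z ^ pole_count 0 w) l < 1) (at 0)"
    using l by (rule tendstoD) simp
  moreover have "eventually (\<lambda>z. \<not> is_pole w z) (at 0)"
    using meromorphic_on_imp_not_pole_cosparse[OF assms] by (simp add: eventually_cosparse_open_eq)
  ultimately have "eventually (\<lambda>z. dist (w z * z ^ pole_count 0 w) l < 1 \<and> \<not> is_pole w z) (at 0)"
    by (rule eventually_conj)
  then obtain d where d: "d > 0" "\<And>z. z \<noteq> 0 \<Longrightarrow> dist z 0 \<le> d \<Longrightarrow>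
      dist (w z * z ^ pole_count 0 w) l < 1 \<and> \<not> is_pole w z"
    unfolding eventually_at_le by auto
  show ?thesis
  proof (rule that[of "min d 1" "cmod l + 1"])
    fix z :: complex assume z: "0 < cmod z" "cmod z \<le> min d 1"
    then have "dist (w z * z ^ pole_count 0 w) l < 1" using d(2)[of z] by auto
    then have "cmod (w z * z ^ pole_count 0 w) < cmod l + 1"
      using norm_triangle_ineq2[of "w z * z ^ pole_count 0 w" l] unfolding dist_norm by linarith
    then show "cmod (w z) * cmod z ^ pole_count 0 w \<le> cmod l + 1"
      by (simp add: norm_mult norm_power)
    show "\<not> is_pole w z" using d(2)[of z] z by auto
  qed (use d in auto)
qed

lemma finite_sin_zeros: "finite {\<theta>. 0 \<le> \<theta> \<and> \<theta> \<le> 2*pi \<and> sin (\<theta> - Arg x) = 0}"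
proof (rule finite_subset)
  show "{\<theta>. 0 \<le> \<theta> \<and> \<theta> \<le> 2*pi \<and> sin (\<theta> - Arg x) = 0} \<subseteq> (\<lambda>j::int. Arg x + of_int j * pi) ` {-2..4}"
  proof safe
    fix \<theta> assume \<theta>: "0 \<le> \<theta>" "\<theta> \<le> 2*pi" "sin (\<theta> - Arg x) = 0"
    then obtain j :: int where j: "\<theta> - Arg x = of_int j * pi" using sin_zero_iff_int2 by blast
    have "-2 * pi \<le> of_int j * pi" "of_int j * pi \<le> 4 * pi" using j \<theta> Arg_bounded[of x] by linarith+
    then have "-2 \<le> real_of_int j" "real_of_int j \<le> 4"
      using mult_right_le_imp_le[OF _ pi_gt_zero] by blast+
    then show "\<theta> \<in> (\<lambda>j::int. Arg x + of_int j * pi) ` {-2..4}"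
      using j by (intro image_eqI[of _ _ j]) auto
  qed
qed simp

lemma integral_of_zero_majorant:
  fixes f :: "real \<Rightarrow> real"
  assumes "\<And>t. t \<in> {0..r} \<Longrightarrow> f t \<le> c" "0 \<le> c" "0 \<le> r"
  shows "integral {0..r} f \<le> c * r"
proof (rule integral_le_off_finite[where N = "{}" and H = "\<lambda>_. c"])
  show "((\<lambda>_. c) has_integral c * r) {0..r}"
    using has_integral_const_real[of c 0 r] assms(3) by (simp add: mult.commute)
qed (use assms in auto)

lemma log_plus_le: "x \<le> y \<Longrightarrow> 0 \<le> x \<Longrightarrow> 1 \<le> y \<Longrightarrow> log_plus x \<le> ln y"
  unfolding log_plus_def by (cases "x = 0") (auto intro: ln_mono)

lemma pole_count_mono:
  assumes "w meromorphic_on UNIV" "s \<le> t" shows "pole_count s w \<le> pole_count t w"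
  unfolding pole_count_def using assms by (intro sum_mono2 finite_poles_cball) auto

lemma pole_count_eq_0:
  assumes "\<And>z. 0 < cmod z \<Longrightarrow> cmod z \<le> \<delta> \<Longrightarrow> \<not> is_pole w z" "0 \<le> t" "t \<le> \<delta>"
  shows "pole_count t w = pole_count 0 w"
proof -
  have "{z. cmod z \<le> t \<and> is_pole w z} = {z. cmod z \<le> 0 \<and> is_pole w z}"
  proof safe
    fix z assume "cmod z \<le> t" "is_pole w z"
    then show "cmod z \<le> 0" using assms(1)[of z] assms(3) by force
  qed (use assms(2) in auto)
  then show ?thesis by (simp add: pole_count_def)
qed

text \<open>If \<open>w\<close> has a pole of order \<open>m\<close> at 0, then \<open>m(r, w)\<close> and \<open>N(r, w)\<close> are unbounded as \<open>r\<close> tends to 0. The terms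
\<open>- m ln r\<close> in the bound for the first and \<open>m ln r\<close> in the second cancel, so small radii have to be treated apart.\<close>

lemma nevanlinna_T_bound_near_0:
  assumes \<delta>: "\<delta> \<le> 1" "1 \<le> B"
    and nopole: "\<And>z. 0 < cmod z \<Longrightarrow> cmod z \<le> \<delta> \<Longrightarrow> \<not> is_pole w z"
    and bound: "\<And>z. 0 < cmod z \<Longrightarrow> cmod z \<le> \<delta> \<Longrightarrow> cmod (w z) * cmod z ^ pole_count 0 w \<le> B"
    and r: "0 < r" "r \<le> \<delta>"
  shows "nevanlinna_T r w \<le> ln B"
proof -
  define m where "m = pole_count 0 w"
  have lnr: "ln r \<le> 0" using r \<delta> by simp
  have le: "log_plus (cmod (w (of_real r * cis \<theta>))) \<le> ln B - real m * ln r" for \<theta>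
  proof -
    have "cmod (of_real r * cis \<theta>) = r" using r by (simp add: norm_mult)
    then have "cmod (w (of_real r * cis \<theta>)) \<le> B / r ^ m"
      using bound[of "of_real r * cis \<theta>"] r by (simp add: field_simps m_def)
    moreover have "1 \<le> B / r ^ m"
    proof -
      have "r ^ m \<le> 1" using \<delta> r by (intro power_le_one) auto
      then have "r ^ m \<le> B" using \<delta> by linarith
      then show ?thesis using r by (simp add: pos_le_divide_eq)
    qed
    ultimately have "log_plus (cmod (w (of_real r * cis \<theta>))) \<le> ln (B / r ^ m)"
      by (intro log_plus_le) auto
    also have "\<dots> = ln B - real m * ln r" using \<delta> r by (simp add: ln_div ln_realpow)
    finally show ?thesis .
  qed
  have "real m * ln r \<le> 0" using lnr by (simp add: mult_nonneg_nonpos)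
  moreover have "0 \<le> ln B" using \<delta> by simp
  ultimately have "0 \<le> ln B - real m * ln r" by linarith
  then have "integral {0..2*pi} (\<lambda>\<theta>. log_plus (cmod (w (of_real r * cis \<theta>)))) \<le> (ln B - real m * ln r) * (2*pi)"
    using le by (intro integral_of_zero_majorant) auto
  then have "proximity r w \<le> ln B - real m * ln r"
    unfolding proximity_def by (simp add: field_simps)
  moreover have "integral {0..r} (\<lambda>t. (real (pole_count t w) - real (pole_count 0 w)) / t) \<le> 0 * r"
  proof (rule integral_of_zero_majorant)
    fix t assume t: "t \<in> {0..r}"
    show "(real (pole_count t w) - real (pole_count 0 w)) / t \<le> 0"
    proof -
      have "pole_count t w = pole_count 0 w" by (rule pole_count_eq_0[OF nopole]) (use t r in auto)
      then show ?thesis by simp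
    qed
  qed (use r in auto)
  ultimately show ?thesis
    unfolding nevanlinna_T_def integrated_count_def m_def by simp
qed

lemma pole_count_le_card:
  assumes "w meromorphic_on UNIV" "\<And>a. is_pole w a \<Longrightarrow> -2 \<le> zorder w a"
  shows "pole_count t w \<le> 2 * card {a. cmod a \<le> t \<and> is_pole w a}"
proof -
  have "pole_count t w \<le> of_nat (card {a. cmod a \<le> t \<and> is_pole w a}) * 2"
    unfolding pole_count_def
  proof (rule sum_bounded_above)
    fix a assume "a \<in> {a. cmod a \<le> t \<and> is_pole w a}"
    then have "-2 \<le> zorder w a" using assms(2) by auto
    then show "nat (- zorder w a) \<le> 2" by linarith
  qed
  then show ?thesis by simp
qed

text \<open>The integrand vanishes for \<open>t \<le> \<delta>\<close> and is at most \<open>n(r) / \<delta>\<close> for \<open>t \<ge> \<delta>\<close>. Losing a factor \<open>r\<close> compared with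
the usual logarithmic bound is harmless at exponential growth.\<close>

lemma integrated_count_le:
  assumes mero: "w meromorphic_on UNIV" and ord: "\<And>a. is_pole w a \<Longrightarrow> -2 \<le> zorder w a"
    and \<delta>: "0 < \<delta>" "\<delta> \<le> r" and nopole: "\<And>z. 0 < cmod z \<Longrightarrow> cmod z \<le> \<delta> \<Longrightarrow> \<not> is_pole w z"
  shows "integrated_count r w \<le> (2 / \<delta>) * real (card {a. cmod a \<le> r \<and> is_pole w a}) * r + real (pole_count 0 w) * r"
proof -
  let ?K = "real (card {a. cmod a \<le> r \<and> is_pole w a})"
  have "integral {0..r} (\<lambda>t. (real (pole_count t w) - real (pole_count 0 w)) / t) \<le> (2 / \<delta>) * ?K * r"
  proof (rule integral_of_zero_majorant)
    fix t assume t: "t \<in> {0..r}"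
    show "(real (pole_count t w) - real (pole_count 0 w)) / t \<le> 2 / \<delta> * ?K"
    proof (cases "t \<le> \<delta>")
      case True
      have "pole_count t w = pole_count 0 w" by (rule pole_count_eq_0[OF nopole]) (use t True in auto)
      then show ?thesis using \<delta> by simp
    next
      case False
      have "real (pole_count t w) - real (pole_count 0 w) \<le> real (pole_count r w)"
        using pole_count_mono[OF mero, of t r] t by simp
      also have "\<dots> \<le> 2 * ?K" using pole_count_le_card[OF mero ord, of r] by linarith
      finally have "(real (pole_count t w) - real (pole_count 0 w)) / t \<le> 2 * ?K / t"
        using False \<delta> by (intro divide_right_mono) auto
      also have "\<dots> \<le> 2 * ?K / \<delta>" using False \<delta> by (intro divide_left_mono) auto
      finally show ?thesis by simp
    qed
  qed (use \<delta> in auto)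
  moreover have "real (pole_count 0 w) * ln r \<le> real (pole_count 0 w) * r"
    using ln_le_minus_one[of r] \<delta> by (intro mult_left_mono) auto
  ultimately show ?thesis unfolding integrated_count_def by linarith
qed

text \<open>Off finitely many angles, the positive part of \<open>ln |w|\<close> is at most \<open>M\<close> plus twice the sum of the majorants of \<open>ln (1 / |z - a|)\<close> over
the poles \<open>a\<close> in question.\<close>

lemma proximity_le:
  assumes mero: "w meromorphic_on UNIV"
    and \<delta>: "0 < \<delta>" "\<delta> \<le> 1" "\<delta> \<le> r" and M: "0 \<le> M"
    and fin: "finite Z"
    and bound: "\<And>z. cmod z \<le> r \<Longrightarrow> w analytic_on {z} \<Longrightarrow>
       cmod (w z) \<le> exp M \<or> (\<exists>a\<in>Z. is_pole w a \<and> cmod (w z) * cmod (z - a) ^ 2 \<le> exp M)"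
  shows "proximity r w \<le> M + real (card Z) * (2 * (- ln \<delta>) + 100)"
proof -
  define X where "X = {z. cmod z \<le> r \<and> \<not> w analytic_on {z}}"
  have "{z. \<not> w analytic_on {z}} sparse_in UNIV"
    using meromorphic_on_imp_analytic_cosparse[OF mero] by (simp add: eventually_cosparse)
  then have "finite (cball 0 r \<inter> {z. \<not> w analytic_on {z}})"
    by (intro sparse_in_compact_finite) (auto intro: sparse_in_subset)
  then have X: "finite X" by (rule rev_finite_subset) (auto simp: X_def)
  \<comment> \<open>The exceptional angles: those of the singularities of the majorants, and those of the points where the function is not analytic.\<close>
  define N where "N = (\<Union>x\<in>Z \<union> X. {\<theta>. 0 \<le> \<theta> \<and> \<theta> \<le> 2*pi \<and> sin (\<theta> - Arg x) = 0})"
  have N: "finite N" unfolding N_def using fin X by (intro finite_UN_I finite_sin_zeros) auto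
  define H where "H \<theta> = M + (\<Sum>a\<in>Z. 2 * (- ln \<delta> + log_distance_majorant a \<theta>))" for \<theta>
  have ln\<delta>: "0 \<le> - ln \<delta>" using \<delta> by simp
  obtain I where I: "\<And>a. (log_distance_majorant a has_integral I a) {0..2*pi}" "\<And>a. 0 \<le> I a" "\<And>a. I a \<le> 300"
    using has_integral_log_distance_majorant by metis
  let ?J = "M * (2*pi) + (\<Sum>a\<in>Z. 2 * (- ln \<delta> * (2*pi) + I a))"
  have const: "((\<lambda>_. c) has_integral c * (2*pi)) {0..2*pi}" for c :: real
    using has_integral_const_real[of c 0 "2*pi"] by (simp add: mult.commute)
  have H: "(H has_integral ?J) {0..2*pi}"
    unfolding H_def[abs_def]
    by (intro has_integral_add has_integral_sum has_integral_mult_right const I fin)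
  have "0 \<le> (\<Sum>a\<in>Z. 2 * (- ln \<delta> * (2*pi) + I a))"
    using ln\<delta> I(2) by (intro sum_nonneg mult_nonneg_nonneg add_nonneg_nonneg) auto
  then have J0: "0 \<le> ?J" using M by (intro add_nonneg_nonneg mult_nonneg_nonneg) auto
  have "integral {0..2*pi} (\<lambda>\<theta>. log_plus (cmod (w (of_real r * cis \<theta>)))) \<le> ?J"
  proof (rule integral_le_off_finite[OF H J0 N])
    fix \<theta> assume \<theta>: "\<theta> \<in> {0..2*pi} - N"
    define z where "z = of_real r * cis \<theta>"
    have cz: "cmod z = r" using \<delta> by (simp add: z_def norm_mult)
    have nX: "z \<notin> X"
    proof
      assume "z \<in> X"
      have "cis \<theta> = cis (Arg z)" unfolding z_def using \<delta> by (simp add: cis_Arg sgn_mult)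
      then have "cis (\<theta> - Arg z) = 1" by (simp flip: cis_divide)
      then have "sin (\<theta> - Arg z) = 0" by (metis cis.sel(2) one_complex.sel(2))
      then show False using \<open>z \<in> X\<close> \<theta> by (auto simp: N_def)
    qed
    have pos: "0 \<le> 2 * (- ln \<delta> + log_distance_majorant a \<theta>)" for a
      using ln\<delta> log_distance_majorant_nonneg[of a \<theta>] by (intro mult_nonneg_nonneg add_nonneg_nonneg) auto
    then have H0: "M \<le> H \<theta>" unfolding H_def by (simp add: sum_nonneg)
    have an: "w analytic_on {z}" using nX cz by (auto simp: X_def)
    show "log_plus (cmod (w (of_real r * cis \<theta>))) \<le> H \<theta>"
    proof (cases "cmod (w z) \<le> exp M")
      case True
      then have "log_plus (cmod (w z)) \<le> ln (exp M)" using M by (intro log_plus_le) auto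
      then show ?thesis using H0 unfolding z_def by simp
    next
      case False
      then obtain a where a: "a \<in> Z" "is_pole w a" "cmod (w z) * cmod (z - a) ^ 2 \<le> exp M"
        using bound[OF _ an] cz by auto
      have za: "z \<noteq> a" using an a(2) analytic_at_imp_no_pole by blast
      have w0: "cmod (w z) > 0" using False M exp_gt_zero[of M] by linarith
      have "ln (cmod (w z) * cmod (z - a) ^ 2) \<le> M"
        using a(3) w0 za by (subst ln_exp[of M, symmetric]) (intro ln_mono mult_pos_pos, auto)
      then have "ln (cmod (w z)) \<le> M + 2 * (- ln (cmod (z - a)))"
        using w0 za by (simp add: ln_mult ln_realpow)
      also have "- ln (cmod (z - a)) \<le> - ln \<delta> + log_distance_majorant a \<theta>"
        unfolding z_def using \<delta> \<theta> a(1) by (intro log_distance_majorant) (auto simp: N_def)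
      also have "2 * (- ln \<delta> + log_distance_majorant a \<theta>) \<le> (\<Sum>a\<in>Z. 2 * (- ln \<delta> + log_distance_majorant a \<theta>))"
        using pos fin a(1) by (intro member_le_sum) auto
      finally have "ln (cmod (w z)) \<le> H \<theta>" unfolding H_def by simp
      then show ?thesis using H0 M unfolding log_plus_def z_def by simp
    qed
  qed
  also have "?J \<le> M * (2*pi) + (\<Sum>a\<in>Z. (2 * (- ln \<delta>) + 100) * (2*pi))"
  proof (intro add_left_mono sum_mono)
    fix a
    have "2 * I a \<le> 100 * (2*pi)" using I(3)[of a] pi_gt3 by linarith
    then show "2 * (- ln \<delta> * (2*pi) + I a) \<le> (2 * (- ln \<delta>) + 100) * (2*pi)"
      by (simp add: algebra_simps)
  qed
  also have "\<dots> = (M + real (card Z) * (2 * (- ln \<delta>) + 100)) * (2*pi)"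
    by (simp add: algebra_simps)
  finally show ?thesis unfolding proximity_def by (simp add: field_simps)
qed

text \<open>For \<open>r \<ge> \<delta>\<close> both parts of the characteristic are controlled by the poles in the disc of radius \<open>r + 2\<close>: a pole that
makes \<open>w\<close> large on the circle of radius \<open>r\<close> has distance at most 1 from it.\<close>

lemma nevanlinna_T_exponential_bound:
  assumes mero: "w meromorphic_on UNIV" and tame: "exponentially_tame w"
  shows "\<exists>a b \<gamma> :: real. a > 0 \<and> b > 0 \<and> \<gamma> > 0 \<and>
           (\<forall>r\<ge>0. nevanlinna_T r w < a * exp (b * r powr \<gamma>))"
proof -
  obtain C where C: "0 \<le> C" and ord: "\<And>a. is_pole w a \<Longrightarrow> -2 \<le> zorder w a"
    and card: "\<And>R. 1 \<le> R \<Longrightarrow> real (card {a. cmod a \<le> R \<and> is_pole w a}) \<le> exp (C * R)"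
    and near: "\<And>R z. 1 \<le> R \<Longrightarrow> cmod z \<le> R \<Longrightarrow> w analytic_on {z} \<Longrightarrow>
           cmod (w z) \<le> exp (C * R) \<or>
           (\<exists>a. is_pole w a \<and> cmod (z - a) \<le> 1 \<and> cmod (w z) * cmod (z - a) ^ 2 \<le> exp (C * R))"
    using tame unfolding exponentially_tame_def by blast
  obtain \<delta> B where \<delta>: "0 < \<delta>" "\<delta> \<le> 1" "1 \<le> B"
    and nopole: "\<And>z. 0 < cmod z \<Longrightarrow> cmod z \<le> \<delta> \<Longrightarrow> \<not> is_pole w z"
    and B: "\<And>z. 0 < cmod z \<Longrightarrow> cmod z \<le> \<delta> \<Longrightarrow> cmod (w z) * cmod z ^ pole_count 0 w \<le> B"
    using meromorphic_power_bound_at_0[OF mero] by blast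
  define Q where "Q = C + (2 * (- ln \<delta>) + 100) + 2 / \<delta> + real (pole_count 0 w)"
  have ln\<delta>: "0 \<le> - ln \<delta>" using \<delta> by simp
  have Q: "0 \<le> Q" unfolding Q_def using \<delta> C ln\<delta> by (intro add_nonneg_nonneg mult_nonneg_nonneg) auto
  define E where "E r = exp ((C + 1) * (r + 2))" for r
  have far: "nevanlinna_T r w \<le> Q * E r" if r: "\<delta> \<le> r" for r
  proof -
    define Z where "Z = {a. cmod a \<le> r + 2 \<and> is_pole w a}"
    have Z: "finite Z" unfolding Z_def by (rule finite_poles_cball[OF mero])
    have r0: "0 < r" using r \<delta>(1) by linarith
    have "proximity r w \<le> C * (r + 1) + real (card Z) * (2 * (- ln \<delta>) + 100)"
    proof (rule proximity_le[OF mero \<delta>(1,2) r _ Z])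
      fix z assume z: "cmod z \<le> r" "w analytic_on {z}"
      show "cmod (w z) \<le> exp (C * (r + 1)) \<or>
         (\<exists>a\<in>Z. is_pole w a \<and> cmod (w z) * cmod (z - a) ^ 2 \<le> exp (C * (r + 1)))"
      proof (cases "cmod (w z) \<le> exp (C * (r + 1))")
        case False
        then obtain a where a: "is_pole w a" "cmod (z - a) \<le> 1" "cmod (w z) * cmod (z - a) ^ 2 \<le> exp (C * (r + 1))"
          using near[of "r + 1" z] z r0 False by auto
        have "cmod a \<le> cmod z + cmod (z - a)" using norm_triangle_ineq4[of z "z - a"] by simp
        then have "a \<in> Z" unfolding Z_def using a z by auto
        then show ?thesis using a by blast
      qed simp
    qed (use C r0 in auto)
    moreover have "integrated_count r w \<le> (2 / \<delta>) * real (card {a. cmod a \<le> r \<and> is_pole w a}) * r + real (pole_count 0 w) * r"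
      by (rule integrated_count_le[OF mero ord \<delta>(1) r nopole])
    moreover have cZ: "real (card Z) \<le> exp (C * (r + 2))" unfolding Z_def using r0 by (intro card) auto
    have re: "r + 2 \<le> exp (r + 2)" using exp_ge_add_one_self[of "r + 2"] by linarith
    have E1: "exp (C * (r + 2)) * exp (r + 2) = E r" unfolding E_def by (simp add: algebra_simps flip: exp_add)
    have ge1: "1 \<le> exp (C * (r + 2))" "1 \<le> exp (r + 2)" using C r0 by auto
    have cZE: "real (card Z) \<le> E r" 
      unfolding E1[symmetric] using cZ ge1 mult_mono[of "real (card Z)" "exp (C * (r + 2))" 1 "exp (r + 2)"] by simp
    have rE: "r + 1 \<le> E r"
      unfolding E1[symmetric] using re ge1 r0 mult_mono[of 1 "exp (C * (r + 2))" "r + 1" "exp (r + 2)"] by simp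
    have cr: "real (card {a. cmod a \<le> r \<and> is_pole w a}) * r \<le> E r"
      unfolding E1[symmetric]
    proof (rule mult_mono)
      have "card {a. cmod a \<le> r \<and> is_pole w a} \<le> card Z"
        using Z by (rule card_mono) (auto simp: Z_def)
      then show "real (card {a. cmod a \<le> r \<and> is_pole w a}) \<le> exp (C * (r + 2))" using cZ by linarith
    qed (use re r0 in auto)
    have "C * (r + 1) \<le> C * E r" using rE C by (rule mult_left_mono)
    moreover have "real (card Z) * (2 * (- ln \<delta>) + 100) \<le> E r * (2 * (- ln \<delta>) + 100)"
      using cZE ln\<delta> by (intro mult_right_mono) auto
    moreover have "(2 / \<delta>) * (real (card {a. cmod a \<le> r \<and> is_pole w a}) * r) \<le> (2 / \<delta>) * E r"
      using cr \<delta> by (intro mult_left_mono) auto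
    moreover have "real (pole_count 0 w) * r \<le> real (pole_count 0 w) * E r"
      using rE by (intro mult_left_mono) auto
    ultimately show ?thesis unfolding nevanlinna_T_def Q_def by (simp add: algebra_simps)
  qed
  define A where "A = Q * exp ((C + 1) * 2) + ln B + \<bar>nevanlinna_T 0 w\<bar> + 1"
  have lnB: "0 \<le> ln B" using \<delta> by simp
  have Qp: "0 \<le> Q * exp ((C + 1) * 2)" using Q by simp
  have A: "0 < A" unfolding A_def using Qp lnB by linarith
  have main: "nevanlinna_T r w < A * exp ((C + 1) * r powr 1)" if r: "0 \<le> r" for r
  proof -
    have e1: "1 \<le> exp ((C + 1) * r)" using C r by simp
    have A1: "A \<le> A * exp ((C + 1) * r)" using e1 A by simp
    consider "r = 0" | "0 < r" "r \<le> \<delta>" | "\<delta> \<le> r" using r by linarith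
    then have "nevanlinna_T r w < A * exp ((C + 1) * r)"
    proof cases
      case 1
      have "nevanlinna_T r w < A" unfolding A_def using 1 Qp lnB by simp
      then show ?thesis using A1 by linarith
    next
      case 2
      have "nevanlinna_T r w \<le> ln B" using nevanlinna_T_bound_near_0[OF \<delta>(2,3) nopole B 2] .
      then have "nevanlinna_T r w < A" unfolding A_def using Qp by linarith
      then show ?thesis using A1 by linarith
    next
      case 3
      have "nevanlinna_T r w \<le> Q * exp ((C + 1) * 2) * exp ((C + 1) * r)"
        using far[OF 3] unfolding E_def by (simp add: algebra_simps flip: exp_add)
      also have "\<dots> < A * exp ((C + 1) * r)"
        unfolding A_def using lnB by (intro mult_strict_right_mono) auto
      finally show ?thesis .
    qed
    then show ?thesis using r by simp
  qed
  show ?thesis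
    by (rule exI[of _ A], rule exI[of _ "C + 1"], rule exI[of _ 1]) (use A C main in auto)
qed

section \<open>Functions analytic off a discrete set of poles\<close>

locale analytic_off_poles =
  fixes W :: "complex \<Rightarrow> complex" and S :: "complex set"
  assumes sparse: "S sparse_in UNIV"
    and analytic: "z \<notin> S \<Longrightarrow> W analytic_on {z}"
    and poles: "a \<in> S \<Longrightarrow> is_pole W a"
begin

lemma open_compl: "open (- S)"
  using sparse_in_UNIV_imp_closed[OF sparse] by (simp add: open_Compl)

lemma connected_compl: "connected (- S)"
  using sparse_imp_connected[of "UNIV :: complex set" S] sparse connected_UNIV[where 'a = complex]
  by (simp add: Compl_eq_Diff_UNIV)

lemma finite_poles: "compact A \<Longrightarrow> finite (A \<inter> S)"
  using sparse by (intro sparse_in_compact_finite) (auto intro: sparse_in_subset)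

lemma is_pole_iff: "is_pole W a \<longleftrightarrow> a \<in> S"
  using poles analytic analytic_at_imp_no_pole by blast

lemma holo: "W holomorphic_on - S"
  using analytic analytic_imp_holomorphic analytic_on_analytic_at by blast

lemma holo_deriv: "deriv W holomorphic_on - S"
  by (intro holomorphic_deriv holo open_compl)

lemma has_deriv: "z \<notin> S \<Longrightarrow> (W has_field_derivative deriv W z) (at z)"
  by (rule holomorphic_derivI[OF holo open_compl]) auto

lemma has_deriv2: "z \<notin> S \<Longrightarrow> (deriv W has_field_derivative deriv (deriv W) z) (at z)"
  by (rule holomorphic_derivI[OF holo_deriv open_compl]) auto

lemma open_norm_preimage:
  assumes "open T" shows "open {x \<in> - S. cmod (W x) \<in> T}"
proof -
  have "continuous_on (- S) (\<lambda>x. cmod (W x))"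
    by (intro continuous_on_norm holomorphic_on_imp_continuous_on holo)
  from continuous_open_preimage[OF this open_compl assms] show ?thesis
    by (simp add: vimage_def Int_def)
qed

lemma eventually_not_pole: "eventually (\<lambda>z. z \<notin> S) (at a)"
  using sparse sparse_in_eventually_iff[of "UNIV :: complex set" S] by simp

lemma punctured_ball_avoiding_poles:
  obtains r where "r > 0" "r \<le> 1" "ball a r - {a} \<subseteq> - S"
proof -
  obtain r where "r > 0" "\<And>z. z \<noteq> a \<Longrightarrow> dist z a < r \<Longrightarrow> z \<notin> S"
    using eventually_not_pole[of a] unfolding eventually_at by blast
  then show ?thesis
    by (intro that[of "min r 1"]) (auto simp: dist_commute)
qed

text \<open>The local data are stated with an explicit quotient, since the expansions of solutions below are
obtained by differentiating the analytic numerator.\<close>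

lemma pole_form:
  assumes "a \<in> S"
  obtains r \<phi> m where "0 < r" "ball a r - {a} \<subseteq> - S" "\<phi> holomorphic_on ball a r" "\<phi> a \<noteq> 0" "0 < m"
    "zorder W a = - int m" "\<And>z. z \<in> ball a r - {a} \<Longrightarrow> W z = \<phi> z / (z - a) ^ m"
proof -
  obtain e where e: "e > 0" "e \<le> 1" "ball a e - {a} \<subseteq> - S" by (rule punctured_ball_avoiding_poles)
  have "W holomorphic_on ball a e - {a}" using holo e(3) by (rule holomorphic_on_subset)
  from zorder_exist_pole[OF this open_ball _ poles[OF assms]] e(1)
  obtain r where r: "r > 0" "cball a r \<subseteq> ball a e" "zor_poly W a holomorphic_on cball a r"
    "zorder W a < 0" "zor_poly W a a \<noteq> 0"
    and eq: "\<And>z. z \<in> cball a r - {a} \<Longrightarrow> W z = zor_poly W a z / (z - a) ^ nat (- zorder W a)"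
    by auto
  show ?thesis
  proof (rule that[of r "zor_poly W a" "nat (- zorder W a)"])
    have "ball a r \<subseteq> cball a r" by (rule ball_subset_cball)
    then show "ball a r - {a} \<subseteq> - S" using r(2) e(3) by blast
    show "zor_poly W a holomorphic_on ball a r" using r(3) ball_subset_cball by (rule holomorphic_on_subset)
    show "W z = zor_poly W a z / (z - a) ^ nat (- zorder W a)" if "z \<in> ball a r - {a}" for z
      using eq[of z] that by auto
  qed (use r in auto)
qed

end

locale autonomous_solution = analytic_off_poles +
  fixes c :: complex and P :: "complex poly"
  assumes ode: "z \<notin> S \<Longrightarrow> deriv (deriv W) z + c * deriv W z + poly P (W z) = 0"

section \<open>Entire solutions\<close>

text \<open>A variant of Borel's growth lemma. Along the radii \<open>r0 + 1 - 2^(-n)\<close> the hypothesis, used with \<open>\<delta> = 2^(-n-1)\<close>, loses a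
factor \<open>16^(n+1)\<close> but gains from the exponent \<open>3/2\<close>; once \<open>M\<close> starts above \<open>K\<close> and \<open>16^3 D\<close>, it grows at least like
\<open>16^n\<close> and exceeds \<open>M (r0 + 1)\<close>.\<close>

lemma superlinear_growth_bounded:
  fixes M :: "real \<Rightarrow> real"
  assumes mono: "\<And>r s. 0 \<le> r \<Longrightarrow> r \<le> s \<Longrightarrow> M r \<le> M s"
    and D: "1 \<le> D" and r0: "0 \<le> r0"
    and step: "\<And>r \<delta>. r0 \<le> r \<Longrightarrow> r \<le> r0 + 1 \<Longrightarrow> 0 < \<delta> \<Longrightarrow> \<delta> \<le> 1 \<Longrightarrow> K \<le> M r \<Longrightarrow>
       M r ^ 3 * \<delta> ^ 4 \<le> D * M (r + \<delta>) ^ 2"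
  shows "M r0 \<le> max K (16 ^ 3 * D)"
proof (rule ccontr)
  define X where "X = 16 ^ 3 * D"
  assume "\<not> M r0 \<le> max K (16 ^ 3 * D)"
  then have gt: "K < M r0" "X < M r0" by (auto simp: X_def)
  have X: "1 \<le> X" using D by (simp add: X_def)
  define \<rho> where "\<rho> n = r0 + 1 - (1/2) ^ n" for n :: nat
  have \<rho>: "r0 \<le> \<rho> n" "\<rho> n \<le> r0 + 1" for n
    by (simp_all add: \<rho>_def power_le_one)
  have grow: "X * 16 ^ n \<le> M (\<rho> n)" for n
  proof (induction n)
    case 0 show ?case using gt by (simp add: \<rho>_def)
  next
    case (Suc n)
    have K: "K \<le> M (\<rho> n)" using gt mono[OF r0 \<rho>(1)[of n]] by linarith
    have pos: "0 \<le> M (\<rho> (Suc n))" using gt X mono[OF r0 \<rho>(1)[of "Suc n"]] by linarith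
    have eq: "\<rho> n + (1/2) ^ Suc n = \<rho> (Suc n)" by (simp add: \<rho>_def field_simps)
    have "(1/2::real) ^ Suc n \<le> 1" by (rule power_le_one) auto
    from step[OF \<rho> _ this K] have "M (\<rho> n) ^ 3 * ((1/2) ^ Suc n) ^ 4 \<le> D * M (\<rho> (Suc n)) ^ 2"
      unfolding eq by simp
    moreover have "(X * 16 ^ n) ^ 3 * ((1/2) ^ Suc n) ^ 4 \<le> M (\<rho> n) ^ 3 * ((1/2) ^ Suc n) ^ 4"
      using Suc X by (intro mult_right_mono power_mono) auto
    moreover have "(X * 16 ^ n) ^ 3 * ((1/2) ^ Suc n) ^ 4 = D * (X * 16 ^ Suc n) ^ 2"
    proof -
      define q :: real where "q = 16 ^ n"
      have h: "((1/2::real) ^ Suc n) ^ 4 = 1 / (16 * q)"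
      proof -
        have "((1/2::real) ^ Suc n) ^ 4 = ((1/2) ^ 4) ^ Suc n" by (simp only: power_mult[symmetric] mult.commute)
        also have "\<dots> = 1 / (16 * q)" by (simp add: q_def power_divide)
        finally show ?thesis .
      qed
      have "q \<noteq> 0" by (simp add: q_def)
      then show ?thesis unfolding h X_def by (simp add: power_mult_distrib flip: q_def) (simp add: field_simps power2_eq_square power3_eq_cube)
    qed
    ultimately have "D * (X * 16 ^ Suc n) ^ 2 \<le> D * M (\<rho> (Suc n)) ^ 2" by linarith
    then have "(X * 16 ^ Suc n) ^ 2 \<le> M (\<rho> (Suc n)) ^ 2" using D by simp
    then show ?case using pos by (rule power2_le_imp_le)
  qed
  obtain n where "M (r0 + 1) < 16 ^ n" using real_arch_pow[of 16 "M (r0 + 1)"] by auto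
  also have "(16::real) ^ n \<le> X * 16 ^ n" using X by simp
  also have "\<dots> \<le> M (\<rho> n)" by (rule grow)
  also have "\<dots> \<le> M (r0 + 1)" using \<rho>[of n] r0 by (intro mono) auto
  finally show False by simp
qed

definition max_modulus :: "(complex \<Rightarrow> complex) \<Rightarrow> real \<Rightarrow> real" where
  "max_modulus f r = (SUP z\<in>cball 0 r. cmod (f z))"

context
  fixes f :: "complex \<Rightarrow> complex"
  assumes f: "f holomorphic_on UNIV"
begin

lemma continuous_on_norm_entire: "continuous_on A (\<lambda>z. cmod (f z))"
  using holomorphic_on_imp_continuous_on[OF f] by (intro continuous_on_norm) (rule continuous_on_subset, auto)

lemma bdd_above_max_modulus: "bdd_above ((\<lambda>z. cmod (f z)) ` cball 0 r)"
proof -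
  have "compact ((\<lambda>z. cmod (f z)) ` cball 0 r)"
    by (intro compact_continuous_image continuous_on_norm_entire compact_cball)
  then show ?thesis by (intro bounded_imp_bdd_above compact_imp_bounded)
qed

lemma norm_le_max_modulus: "cmod z \<le> r \<Longrightarrow> cmod (f z) \<le> max_modulus f r"
  unfolding max_modulus_def using bdd_above_max_modulus by (rule cSUP_upper2) auto

lemma max_modulus_mono: "0 \<le> r \<Longrightarrow> r \<le> s \<Longrightarrow> max_modulus f r \<le> max_modulus f s"
  unfolding max_modulus_def by (rule cSUP_subset_mono[OF _ bdd_above_max_modulus]) auto

lemma max_modulus_attained:
  assumes "0 \<le> r"
  obtains z where "cmod z \<le> r" "max_modulus f r = cmod (f z)"
proof -
  have "cball (0::complex) r \<noteq> {}" using assms by auto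
  then obtain z where z: "z \<in> cball 0 r" "\<And>y. y \<in> cball 0 r \<Longrightarrow> cmod (f y) \<le> cmod (f z)"
    using continuous_attains_sup[OF compact_cball _ continuous_on_norm_entire, of 0 r] by auto
  have "max_modulus f r = cmod (f z)"
    unfolding max_modulus_def using z by (intro cSup_eq_maximum) auto
  then show ?thesis using that z by auto
qed

lemma max_modulus_nonneg: "0 \<le> r \<Longrightarrow> 0 \<le> max_modulus f r"
  using norm_le_max_modulus[of 0 r] norm_ge_zero[of "f 0"] by (simp del: norm_ge_zero)

lemma norm_higher_deriv_le_max_modulus:
  assumes z: "cmod z \<le> r" and \<delta>: "0 < \<delta>"
  shows "cmod ((deriv ^^ n) f z) \<le> fact n * max_modulus f (r + \<delta>) / \<delta> ^ n"
proof (rule Cauchy_inequality)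
  fix x assume "cmod (z - x) = \<delta>"
  then have "cmod x \<le> r + \<delta>" using norm_triangle_ineq4[of z "z - x"] z by simp
  then show "cmod (f x) \<le> max_modulus f (r + \<delta>)" by (rule norm_le_max_modulus)
qed (use \<delta> f in \<open>auto intro: holomorphic_on_subset holomorphic_on_imp_continuous_on\<close>)

lemma norm_deriv_le_max_modulus:
  assumes "cmod z \<le> r" "0 < \<delta>"
  shows "cmod (deriv f z) \<le> max_modulus f (r + \<delta>) / \<delta>"
    and "cmod (deriv (deriv f) z) \<le> 2 * max_modulus f (r + \<delta>) / \<delta> ^ 2"
  using norm_higher_deriv_le_max_modulus[OF assms, of 1] norm_higher_deriv_le_max_modulus[OF assms, of 2]
  by (simp_all add: numeral_2_eq_2)

end

lemma poly_lower_bound: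
  fixes P :: "complex poly"
  assumes "2 \<le> degree P"
  obtains K where "1 \<le> K" "\<And>x. K \<le> cmod x \<Longrightarrow> cmod x ^ 2 \<le> K * cmod (poly P x)"
proof -
  define k where "k = degree P"
  define A where "A = (\<Sum>i<k. cmod (coeff P i))"
  have lc: "0 < cmod (lead_coeff P)" using assms by auto
  define K where "K = 1 + (2 * A + 2) / cmod (lead_coeff P)"
  have A: "0 \<le> A" unfolding A_def by (intro sum_nonneg) auto
  have K1: "1 \<le> K" unfolding K_def using lc A by simp
  have main: "cmod x ^ 2 \<le> K * cmod (poly P x)" if x: "K \<le> cmod x" for x
  proof -
    define y where "y = cmod x"
    have y: "1 \<le> y" using x K1 by (simp add: y_def)
    have k: "k = Suc (k - 1)" using assms by (simp add: k_def)
    have "poly P x = lead_coeff P * x ^ k + (\<Sum>i<k. coeff P i * x ^ i)"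
      unfolding poly_altdef k_def lessThan_Suc_atMost[symmetric] by simp
    then have "cmod (lead_coeff P * x ^ k) \<le> cmod (poly P x) + cmod (\<Sum>i<k. coeff P i * x ^ i)"
      using norm_triangle_ineq4[of "poly P x" "\<Sum>i<k. coeff P i * x ^ i"] by simp
    moreover have "cmod (\<Sum>i<k. coeff P i * x ^ i) \<le> A * y ^ (k - 1)"
      unfolding A_def sum_distrib_right
    proof (rule sum_norm_le)
      fix i assume "i \<in> {..<k}"
      then show "cmod (coeff P i * x ^ i) \<le> cmod (coeff P i) * y ^ (k - 1)"
        unfolding norm_mult norm_power y_def[symmetric] using y by (intro mult_left_mono power_increasing) auto
    qed
    moreover have "2 * A + 2 \<le> cmod (lead_coeff P) * y"
    proof -
      have "(2 * A + 2) / cmod (lead_coeff P) \<le> y" using x unfolding K_def y_def by simp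
      then show ?thesis using lc by (simp add: field_simps)
    qed
    then have "(2 * A + 2) * y ^ (k - 1) \<le> cmod (lead_coeff P) * y * y ^ (k - 1)"
      using y by (intro mult_right_mono) auto
    then have "(2 * A + 2) * y ^ (k - 1) \<le> cmod (lead_coeff P * x ^ k)"
      by (subst k) (simp add: norm_mult norm_power y_def)
    moreover have "A * y ^ (k - 1) \<le> (A + 1) * y ^ (k - 1)" using y by (intro mult_right_mono) auto
    ultimately have 1: "cmod (lead_coeff P * x ^ k) \<le> 2 * cmod (poly P x)"
      by (simp add: algebra_simps)
    have "cmod (lead_coeff P) * y ^ 2 \<le> cmod (lead_coeff P) * y ^ k"
      using y assms by (intro mult_left_mono power_increasing) (auto simp: k_def)
    also have "\<dots> = cmod (lead_coeff P * x ^ k)" by (simp add: norm_mult norm_power y_def)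
    also note 1
    finally have "y ^ 2 \<le> 2 / cmod (lead_coeff P) * cmod (poly P x)" using lc by (simp add: field_simps)
    also have "\<dots> \<le> K * cmod (poly P x)"
      unfolding K_def using lc A by (intro mult_right_mono) (auto simp: field_simps)
    finally show ?thesis by (simp add: y_def)
  qed
  show ?thesis using that[OF K1 main] .
qed

text \<open>At a point of maximum modulus on the disc of radius \<open>r\<close>, \<open>P(f)\<close> has size at least \<open>M(r)^2\<close> up to a constant, while the Cauchy
estimates bound \<open>f''\<close> and \<open>f'\<close> linearly in \<open>M(r + \<delta>)\<close>. This is the growth that
\<open>superlinear_growth_bounded\<close> excludes.\<close>

lemma entire_solution_bounded:
  assumes f: "f holomorphic_on UNIV" and deg: "2 \<le> degree P"
    and ode: "\<And>z. deriv (deriv f) z + c * deriv f z + poly P (f z) = 0"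
  obtains B where "1 \<le> B" "\<And>z. cmod (f z) \<le> B"
proof -
  obtain K where K: "1 \<le> K" "\<And>x. K \<le> cmod x \<Longrightarrow> cmod x ^ 2 \<le> K * cmod (poly P x)"
    using poly_lower_bound[OF deg] by blast
  define L where "L = K * (2 + cmod c)"
  have L: "1 \<le> L" unfolding L_def using K(1) mult_mono[of 1 K 1 "2 + cmod c"] by simp
  have "cmod (f z) \<le> max K (16 ^ 3 * L ^ 2)" for z
  proof -
    have "max_modulus f (cmod z) \<le> max K (16 ^ 3 * L ^ 2)"
    proof (rule superlinear_growth_bounded[OF max_modulus_mono[OF f]])
      fix r \<delta> :: real assume r: "cmod z \<le> r" and \<delta>: "0 < \<delta>" "\<delta> \<le> 1" and KM: "K \<le> max_modulus f r"
      have r0: "0 \<le> r" using r norm_ge_zero order_trans by blast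
      obtain x where x: "cmod x \<le> r" "max_modulus f r = cmod (f x)"
        using max_modulus_attained[OF f r0] by blast
      define M where "M = max_modulus f (r + \<delta>)"
      have M0: "0 \<le> M" unfolding M_def using r0 \<delta> by (intro max_modulus_nonneg[OF f]) auto
      have "poly P (f x) = - (deriv (deriv f) x + c * deriv f x)"
        using ode[of x] by (rule add_eq_0_iff[THEN iffD1])
      then have "cmod (poly P (f x)) \<le> cmod (deriv (deriv f) x) + cmod c * cmod (deriv f x)"
        using norm_triangle_ineq[of "deriv (deriv f) x" "c * deriv f x"]
        by (simp only: norm_minus_cancel norm_mult)
      also have "\<dots> \<le> 2 * M / \<delta> ^ 2 + cmod c * (M / \<delta> ^ 2)"
      proof (intro add_mono mult_left_mono)
        show "cmod (deriv (deriv f) x) \<le> 2 * M / \<delta>\<^sup>2"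
          unfolding M_def by (rule norm_deriv_le_max_modulus(2)[OF f x(1) \<delta>(1)])
        have "cmod (deriv f x) \<le> M / \<delta>"
          unfolding M_def by (rule norm_deriv_le_max_modulus(1)[OF f x(1) \<delta>(1)])
        also have "\<dots> \<le> M / \<delta> ^ 2"
          using \<delta> M0 power_le_one[of \<delta> 1] by (intro divide_left_mono) (auto simp: power2_eq_square mult_le_one)
        finally show "cmod (deriv f x) \<le> M / \<delta> ^ 2" .
      qed auto
      also have "\<dots> = (2 + cmod c) * M / \<delta> ^ 2" by (simp add: algebra_simps add_divide_distrib)
      finally have "K * cmod (poly P (f x)) \<le> K * ((2 + cmod c) * M / \<delta> ^ 2)"
        using K(1) by (intro mult_left_mono) auto
      moreover have "cmod (f x) ^ 2 \<le> K * cmod (poly P (f x))" using KM x(2) by (intro K(2)) simp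
      ultimately have "cmod (f x) ^ 2 \<le> K * ((2 + cmod c) * M / \<delta> ^ 2)" by linarith
      then have sq: "cmod (f x) ^ 2 * \<delta> ^ 2 \<le> L * M" unfolding L_def using \<delta> by (simp add: field_simps)
      have f1: "1 \<le> cmod (f x)" using KM K(1) x(2) by linarith
      have "cmod (f x) ^ 3 * \<delta> ^ 4 \<le> cmod (f x) ^ 4 * \<delta> ^ 4"
        using f1 by (intro mult_right_mono power_increasing) auto
      also have "\<dots> = (cmod (f x) ^ 2 * \<delta> ^ 2) ^ 2" by (simp add: power_mult_distrib flip: power_mult)
      also have "\<dots> \<le> (L * M) ^ 2" using sq by (intro power_mono) auto
      finally show "max_modulus f r ^ 3 * \<delta> ^ 4 \<le> L ^ 2 * max_modulus f (r + \<delta>) ^ 2"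
        unfolding x(2) M_def by (simp add: power_mult_distrib)
    qed (use L in auto)
    moreover have "cmod (f z) \<le> max_modulus f (cmod z)" by (rule norm_le_max_modulus[OF f]) simp
    ultimately show ?thesis by linarith
  qed
  then show ?thesis using K(1) by (intro that[of "max K (16 ^ 3 * L ^ 2)"]) auto
qed

lemma entire_power_series:
  assumes f: "f holomorphic_on UNIV"
  shows "((\<lambda>n. (deriv ^^ n) f 0 / fact n * z ^ n) sums f z)"
proof -
  have "f holomorphic_on ball 0 (cmod z + 1)" using f by (rule holomorphic_on_subset) auto
  from holomorphic_power_series[OF this, of z] show ?thesis by simp
qed

lemma entire_exponential_type:
  assumes f: "f holomorphic_on UNIV" and A: "0 \<le> A" "0 \<le> L"
    and bound: "\<And>n. cmod ((deriv ^^ n) f 0) \<le> A * L ^ n"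
  shows "cmod (f z) \<le> A * exp (L * cmod z)"
proof -
  have s: "(\<lambda>n. A * ((L * cmod z) ^ n / fact n)) sums (A * exp (L * cmod z))"
    using exp_converges[of "L * cmod z"] by (intro sums_mult) (simp add: divide_inverse mult.commute)
  have le: "cmod ((deriv ^^ n) f 0 / fact n * z ^ n) \<le> A * ((L * cmod z) ^ n / fact n)" for n
  proof -
    have "cmod ((deriv ^^ n) f 0 / fact n * z ^ n) = cmod ((deriv ^^ n) f 0) * (cmod z ^ n / fact n)"
      by (simp add: norm_mult norm_divide norm_power)
    also have "\<dots> \<le> (A * L ^ n) * (cmod z ^ n / fact n)" by (intro mult_right_mono bound) auto
    finally show ?thesis by (simp add: power_mult_distrib)
  qed
  have "cmod (\<Sum>n. (deriv ^^ n) f 0 / fact n * z ^ n) \<le> (\<Sum>n. A * ((L * cmod z) ^ n / fact n))"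
    by (rule norm_suminf_le[OF le sums_summable[OF s]])
  then show ?thesis using sums_unique[OF entire_power_series[OF f]] sums_unique[OF s] by metis
qed

text \<open>The Taylor coefficients at 0 satisfy a linear recursion of order 2 with constant coefficients, hence
grow at most geometrically after multiplication by \<open>n!\<close>. The constant term of \<open>P\<close> enters only the first step of the recursion.\<close>

lemma linear_entire_solution_growth:
  assumes f: "f holomorphic_on UNIV" and deg: "degree P \<le> 1"
    and ode: "\<And>z. deriv (deriv f) z + c * deriv f z + poly P (f z) = 0"
  obtains A L where "0 \<le> A" "0 \<le> L" "\<And>z. cmod (f z) \<le> A * exp (L * cmod z)"
proof -
  define q where "q = coeff P 1"
  define p where "p = coeff P 0"
  have P: "poly P x = p + q * x" for x
  proof -
    have "P = [:p, q:]"
      unfolding p_def q_def using deg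
      by (intro poly_eqI) (auto simp: coeff_pCons coeff_eq_0 split: nat.split)
    then show ?thesis by (metis mult.commute poly_0 poly_pCons add.right_neutral mult_zero_right)
  qed
  define a where "a n = (deriv ^^ n) f 0" for n
  have hol: "(deriv ^^ n) f holomorphic_on UNIV" for n by (rule holomorphic_higher_deriv[OF f open_UNIV])
  have eq: "(deriv ^^ Suc (Suc n)) f z = - c * (deriv ^^ Suc n) f z - q * (deriv ^^ n) f z - (if n = 0 then p else 0)" for n z
  proof (induction n arbitrary: z)
    case 0 show ?case using ode[of z] unfolding P by (simp add: algebra_simps eq_neg_iff_add_eq_0)
  next
    case (Suc n)
    have d: "((deriv ^^ k) f has_field_derivative (deriv ^^ Suc k) f z) (at z)" for k
      using holomorphic_derivI[OF hol[of k] open_UNIV] by simp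
    have "((\<lambda>z. - c * (deriv ^^ Suc n) f z - q * (deriv ^^ n) f z - (if n = 0 then p else 0)) has_field_derivative
       (- c * (deriv ^^ Suc (Suc n)) f z - q * (deriv ^^ Suc n) f z - 0)) (at z)"
      by (intro DERIV_diff DERIV_cmult d DERIV_const)
    moreover have "(\<lambda>z. - c * (deriv ^^ Suc n) f z - q * (deriv ^^ n) f z - (if n = 0 then p else 0)) = (deriv ^^ Suc (Suc n)) f"
      using Suc.IH by (intro ext) simp
    ultimately have "((deriv ^^ Suc (Suc n)) f has_field_derivative (- c * (deriv ^^ Suc (Suc n)) f z - q * (deriv ^^ Suc n) f z - 0)) (at z)"
      by simp
    then have "deriv ((deriv ^^ Suc (Suc n)) f) z = - c * (deriv ^^ Suc (Suc n)) f z - q * (deriv ^^ Suc n) f z - 0"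
      by (rule DERIV_imp_deriv)
    then show ?case by simp
  qed
  define L where "L = 1 + cmod c + cmod q"
  define A where "A = cmod (a 0) + cmod (a 1) + cmod p"
  have L: "1 \<le> L" "0 \<le> A" unfolding L_def A_def by auto
  have "cmod (a n) \<le> A * L ^ n \<and> cmod (a (Suc n)) \<le> A * L ^ Suc n \<and> (if n = 0 then cmod p else 0) \<le> A * L ^ n" for n
  proof (induction n)
    case 0
    have "A * 1 \<le> A * L" using L by (intro mult_left_mono) auto
    moreover have "cmod (a 1) \<le> A" unfolding A_def by simp
    ultimately have "cmod (a 1) \<le> A * L" by linarith
    then show ?case by (simp add: A_def)
  next
    case (Suc n)
    have mono: "A * L ^ n \<le> A * L ^ Suc n" using L by (intro mult_left_mono power_increasing) auto
    have "a (Suc (Suc n)) = - c * a (Suc n) - q * a n - (if n = 0 then p else 0)"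
      unfolding a_def by (rule eq)
    then have "cmod (a (Suc (Suc n))) \<le> cmod (c * a (Suc n)) + cmod (q * a n) + cmod (if n = 0 then p else 0)"
      using norm_triangle_ineq4[of "- c * a (Suc n) - q * a n" "if n = 0 then p else 0"]
        norm_triangle_ineq4[of "- c * a (Suc n)" "q * a n"] by (simp only: mult_minus_left norm_minus_cancel)
    also have "\<dots> = cmod c * cmod (a (Suc n)) + cmod q * cmod (a n) + (if n = 0 then cmod p else 0)"
      by (simp add: norm_mult)
    also have "\<dots> \<le> cmod c * (A * L ^ Suc n) + cmod q * (A * L ^ Suc n) + A * L ^ Suc n"
      using Suc.IH mono by (intro add_mono mult_left_mono) auto
    also have "\<dots> = A * L ^ Suc (Suc n)" by (simp add: L_def algebra_simps)
    finally have "cmod (a (Suc (Suc n))) \<le> A * L ^ Suc (Suc n)" .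
    then show ?case using Suc.IH L by simp
  qed
  then have "cmod ((deriv ^^ n) f 0) \<le> A * L ^ n" for n unfolding a_def by blast
  from entire_exponential_type[OF f _ _ this] L show ?thesis by (intro that[of A L]) auto
qed

section \<open>Laurent expansions of solutions at their poles\<close>

lemma eq_0_at_centre:
  fixes f :: "complex \<Rightarrow> complex"
  assumes f: "f holomorphic_on ball a r" and r: "0 < r" and z: "\<And>z. z \<in> ball a r - {a} \<Longrightarrow> f z = 0"
  shows "z \<in> ball a r \<Longrightarrow> f z = 0" "deriv f a = 0"
proof -
  have "isCont f a" 
    by (intro field_differentiable_imp_continuous_at holomorphic_on_imp_differentiable_at[OF f open_ball]) (use r in auto)
  then have "(f \<longlongrightarrow> f a) (at a)" by (simp add: isCont_def)
  moreover have "eventually (\<lambda>z. f z = 0) (at a)"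
    by (rule eventually_mono[OF eventually_at_in_open[of "ball a r" a]]) (use r z in auto)
  then have "(f \<longlongrightarrow> 0) (at a)" by (rule tendsto_eventually)
  ultimately have "f a = 0" by (rule tendsto_unique[OF trivial_limit_at])
  then show *: "f z = 0" if "z \<in> ball a r" for z using that z by (cases "z = a") auto
  have "((\<lambda>_. 0) has_field_derivative 0) (at a)" by simp
  then have "(f has_field_derivative 0) (at a)"
    by (rule has_field_derivative_transform_within_open[OF _ open_ball[of a r]]) (use r * in auto)
  then show "deriv f a = 0" by (rule DERIV_imp_deriv)
qed

text \<open>The numerator of the derivative of \<open>\<psi>(z) / (z - a)^m\<close> over the denominator \<open>(z - a)^(m + 1)\<close>.\<close>

definition polar_deriv :: "complex \<Rightarrow> nat \<Rightarrow> (complex \<Rightarrow> complex) \<Rightarrow> complex \<Rightarrow> complex" where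
  "polar_deriv a m \<psi> z = deriv \<psi> z * (z - a) - of_nat m * \<psi> z"

lemma holomorphic_polar_deriv: "\<psi> holomorphic_on ball a r \<Longrightarrow> polar_deriv a m \<psi> holomorphic_on ball a r"
  unfolding polar_deriv_def[abs_def] by (intro holomorphic_intros) auto

lemma deriv_polar:
  assumes \<psi>: "\<psi> holomorphic_on ball a r" and f: "\<And>z. z \<in> ball a r - {a} \<Longrightarrow> f z = \<psi> z / (z - a) ^ m"
    and z: "z \<in> ball a r - {a}"
  shows "deriv f z = polar_deriv a m \<psi> z / (z - a) ^ (m + 1)"
proof -
  have za: "z - a \<noteq> 0" using z by auto
  have "(\<psi> has_field_derivative deriv \<psi> z) (at z)" using holomorphic_derivI[OF \<psi> open_ball] z by auto
  then have "((\<lambda>z. \<psi> z / (z - a) ^ m) has_field_derivative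
     (deriv \<psi> z * (z - a) ^ m - \<psi> z * (of_nat m * (z - a) ^ (m - 1))) / ((z - a) ^ m * (z - a) ^ m)) (at z)"
    using za by (auto intro!: derivative_eq_intros)
  also have "(deriv \<psi> z * (z - a) ^ m - \<psi> z * (of_nat m * (z - a) ^ (m - 1))) / ((z - a) ^ m * (z - a) ^ m)
     = polar_deriv a m \<psi> z / (z - a) ^ (m + 1)"
  proof -
    have "(d * t ^ m - p * (of_nat m * t ^ (m - 1))) / (t ^ m * t ^ m) = (d * t - of_nat m * p) / t ^ (m + 1)"
      if "t \<noteq> 0" for d p t :: complex
      using that by (cases m) (simp_all add: frac_eq_eq algebra_simps)
    from this[OF za] show ?thesis unfolding polar_deriv_def .
  qed
  finally have "(f has_field_derivative polar_deriv a m \<psi> z / (z - a) ^ (m + 1)) (at z)"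
    by (rule has_field_derivative_transform_within_open[of _ _ _ "ball a r - {a}"]) (use z f in \<open>auto simp: open_delete\<close>)
  then show ?thesis by (rule DERIV_imp_deriv)
qed

text \<open>The function \<open>exp(\<kappa> z) V\<close> is a single-valued primitive of \<open>exp(\<kappa> z) \<psi>(z) / (z - a)^2\<close>, so the residue of the latter
vanishes. This is the compatibility condition of the Painleve test.\<close>

lemma no_logarithmic_term:
  assumes \<psi>: "\<psi> holomorphic_on ball a r" and r: "0 < r"
    and V: "\<And>z. z \<in> ball a r - {a} \<Longrightarrow> (V has_field_derivative - \<kappa> * V z + \<psi> z / (z - a) ^ 2) (at z)"
  shows "deriv \<psi> a + \<kappa> * \<psi> a = 0"
proof -
  define g where "g z = exp (\<kappa> * z) * \<psi> z" for z
  have g: "g holomorphic_on ball a r" unfolding g_def by (intro holomorphic_intros \<psi>)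
  have F: "((\<lambda>z. exp (\<kappa> * z) * V z) has_field_derivative g z / (z - a) ^ Suc 1) (at z)" if "z \<in> ball a r - {a}" for z
    using that by (auto intro!: derivative_eq_intros V simp: g_def field_simps power2_eq_square)
  have path: "path_image (circlepath a (r/2)) \<subseteq> ball a r - {a}" using r by auto
  have "((\<lambda>z. g z / (z - a) ^ Suc 1) has_contour_integral
     (exp (\<kappa> * pathfinish (circlepath a (r/2))) * V (pathfinish (circlepath a (r/2)))
      - exp (\<kappa> * pathstart (circlepath a (r/2))) * V (pathstart (circlepath a (r/2))))) (circlepath a (r/2))"
    by (rule contour_integral_primitive[OF has_field_derivative_at_within[OF F] valid_path_circlepath path])
  then have 0: "((\<lambda>z. g z / (z - a) ^ Suc 1) has_contour_integral 0) (circlepath a (r/2))" by simp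
  have "((\<lambda>z. g z / (z - a) ^ Suc 1) has_contour_integral 2 * pi * \<i> * residue (\<lambda>z. g z / (z - a) ^ Suc 1) a) (circlepath a (r/2))"
  proof (rule base_residue[of "ball a r"])
    show "(\<lambda>z. g z / (z - a) ^ Suc 1) holomorphic_on ball a r - {a}"
      by (intro holomorphic_intros holomorphic_on_subset[OF g]) auto
  qed (use r in auto)
  from has_contour_integral_unique[OF this 0] have "residue (\<lambda>z. g z / (z - a) ^ Suc 1) a = 0" by simp
  moreover have "residue (\<lambda>z. g z / (z - a) ^ Suc 1) a = deriv g a"
    using residue_holomorphic_over_power[of "ball a r" a g 1] r g by simp
  moreover have "deriv g a = exp (\<kappa> * a) * (deriv \<psi> a + \<kappa> * \<psi> a)"
  proof (rule DERIV_imp_deriv)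
    have "(\<psi> has_field_derivative deriv \<psi> a) (at a)" using holomorphic_derivI[OF \<psi> open_ball] r by auto
    then show "(g has_field_derivative exp (\<kappa> * a) * (deriv \<psi> a + \<kappa> * \<psi> a)) (at a)"
      unfolding g_def[abs_def] by (auto intro!: derivative_eq_intros simp: algebra_simps)
  qed
  ultimately show ?thesis by simp
qed

context autonomous_solution
begin

text \<open>Multiplying the equation by \<open>(z - a)^(m + 2)\<close> removes the poles of the derivatives.\<close>

lemma polar_equation:
  assumes a: "a \<in> S" and \<phi>: "0 < r" "ball a r - {a} \<subseteq> - S" "\<phi> holomorphic_on ball a r"
    and W: "\<And>z. z \<in> ball a r - {a} \<Longrightarrow> W z = \<phi> z / (z - a) ^ m" and z: "z \<in> ball a r - {a}"
  shows "polar_deriv a (m + 1) (polar_deriv a m \<phi>) z + c * polar_deriv a m \<phi> z * (z - a)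
       + (z - a) ^ (m + 2) * poly P (\<phi> z / (z - a) ^ m) = 0"
proof -
  have 1: "deriv W z = polar_deriv a m \<phi> z / (z - a) ^ (m + 1)" if "z \<in> ball a r - {a}" for z
    by (rule deriv_polar[OF \<phi>(3) W that])
  have 2: "deriv (deriv W) z = polar_deriv a (m + 1) (polar_deriv a m \<phi>) z / (z - a) ^ (m + 1 + 1)"
    by (rule deriv_polar[OF holomorphic_polar_deriv[OF \<phi>(3)] 1 z])
  have za: "z - a \<noteq> 0" using z by auto
  have nS: "z \<notin> S" using \<phi>(2) z by blast
  have "(z - a) ^ (m + 2) * (deriv (deriv W) z + c * deriv W z + poly P (W z)) = 0" using ode[OF nS] by simp
  moreover have "(z - a) ^ (m + 2) * deriv (deriv W) z = polar_deriv a (m + 1) (polar_deriv a m \<phi>) z"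
    unfolding 2 using za by simp
  moreover have "(z - a) ^ (m + 2) * (c * deriv W z) = c * polar_deriv a m \<phi> z * (z - a)"
    unfolding 1[OF z] using za by (simp add: field_simps)
  ultimately show "polar_deriv a (m + 1) (polar_deriv a m \<phi>) z + c * polar_deriv a m \<phi> z * (z - a)
       + (z - a) ^ (m + 2) * poly P (\<phi> z / (z - a) ^ m) = 0"
    using W[OF z] by (simp only: distrib_left)
qed

text \<open>The poles of \<open>W''\<close> and \<open>P(W)\<close> have orders \<open>m + 2\<close> and \<open>m deg P\<close>, and no other term can cancel the one of
higher order.\<close>

lemma pole_order_balance:
  assumes a: "a \<in> S" and \<phi>: "0 < r" "ball a r - {a} \<subseteq> - S" "\<phi> holomorphic_on ball a r" "\<phi> a \<noteq> 0" and m: "0 < m"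
    and W: "\<And>z. z \<in> ball a r - {a} \<Longrightarrow> W z = \<phi> z / (z - a) ^ m"
  shows "m * degree P = m + 2"
proof -
  define k where "k = degree P"
  \<comment> \<open>The numerators of the differential part and of \<open>P(W)\<close> over \<open>(z - a)^(m + 2)\<close> and \<open>(z - a)^(m k)\<close>.\<close>
  define E where "E z = polar_deriv a (m + 1) (polar_deriv a m \<phi>) z + c * polar_deriv a m \<phi> z * (z - a)" for z
  define Q where "Q z = (\<Sum>i\<le>k. coeff P i * \<phi> z ^ i * (z - a) ^ (m * (k - i)))" for z
  have E: "E holomorphic_on ball a r"
    unfolding E_def[abs_def] by (intro holomorphic_intros holomorphic_polar_deriv \<phi>)
  have Q: "Q holomorphic_on ball a r"
    unfolding Q_def[abs_def] by (intro holomorphic_intros \<phi>)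
  have QP: "(z - a) ^ (m * k) * poly P (\<phi> z / (z - a) ^ m) = Q z" if "z \<in> ball a r - {a}" for z
  proof -
    have za: "z - a \<noteq> 0" using that by auto
    have "(z - a) ^ (m * k) * (coeff P i * (\<phi> z / (z - a) ^ m) ^ i) = coeff P i * \<phi> z ^ i * (z - a) ^ (m * (k - i))"
      if "i \<le> k" for i
    proof -
      have "m * k = m * (k - i) + m * i" using that by (simp flip: add_mult_distrib2)
      then show ?thesis using za by (simp add: power_add power_mult power_divide)
    qed
    then show ?thesis unfolding poly_altdef Q_def k_def[symmetric] sum_distrib_left by (intro sum.cong) auto
  qed
  have eq: "E z + (z - a) ^ (m + 2) * poly P (\<phi> z / (z - a) ^ m) = 0" if "z \<in> ball a r - {a}" for z
    unfolding E_def by (rule polar_equation[OF a \<phi>(1-3) W that])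
  have Ea: "E a = of_nat (m * (m + 1)) * \<phi> a" by (simp add: E_def polar_deriv_def algebra_simps)
  have Qa: "Q a = lead_coeff P * \<phi> a ^ k"
  proof -
    have "Q a = (\<Sum>i\<in>{k}. coeff P i * \<phi> a ^ i * 0 ^ (m * (k - i)))"
      unfolding Q_def using m by (intro sum.mono_neutral_cong_right) (auto simp: power_0_left)
    then show ?thesis by (simp add: k_def)
  qed
  show ?thesis
  proof (rule ccontr)
    assume "\<not> ?thesis"
    then consider "m * k < m + 2" | "m + 2 < m * k" unfolding k_def by linarith
    then show False
    proof cases
      case 1
      have "E a + (a - a) ^ (m + 2 - m * k) * Q a = 0"
      proof (rule eq_0_at_centre(1)[where f = "\<lambda>z. E z + (z - a) ^ (m + 2 - m * k) * Q z" and r = r])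
        show "(\<lambda>z. E z + (z - a) ^ (m + 2 - m * k) * Q z) holomorphic_on ball a r" by (intro holomorphic_intros E Q)
        show "E z + (z - a) ^ (m + 2 - m * k) * Q z = 0" if z: "z \<in> ball a r - {a}" for z
        proof -
          have "(z - a) ^ (m + 2) = (z - a) ^ (m + 2 - m * k) * (z - a) ^ (m * k)"
            unfolding power_add[symmetric] using 1 by simp
          then show ?thesis using eq[OF z] unfolding QP[OF z, symmetric] by (simp only: mult.assoc)
        qed
      qed (use \<phi> in auto)
      then have "E a = 0" using 1 by (simp add: zero_power)
      moreover have "(of_nat (m * (m + 1)) :: complex) \<noteq> 0" using m by (simp only: of_nat_eq_0_iff) simp
      ultimately show False unfolding Ea using \<phi>(4) by simp
    next
      case 2
      have k0: "k \<noteq> 0" using 2 by (intro notI) simp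
      have "(a - a) ^ (m * k - (m + 2)) * E a + Q a = 0"
      proof (rule eq_0_at_centre(1)[where f = "\<lambda>z. (z - a) ^ (m * k - (m + 2)) * E z + Q z" and r = r])
        show "(\<lambda>z. (z - a) ^ (m * k - (m + 2)) * E z + Q z) holomorphic_on ball a r" by (intro holomorphic_intros E Q)
        show "(z - a) ^ (m * k - (m + 2)) * E z + Q z = 0" if z: "z \<in> ball a r - {a}" for z
        proof -
          have "(z - a) ^ (m * k) = (z - a) ^ (m * k - (m + 2)) * (z - a) ^ (m + 2)"
            unfolding power_add[symmetric] using 2 by (simp only: le_add_diff_inverse2 less_imp_le)
          then have "(z - a) ^ (m * k - (m + 2)) * E z + Q z = (z - a) ^ (m * k - (m + 2)) * (E z + (z - a) ^ (m + 2) * poly P (\<phi> z / (z - a) ^ m))"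
            unfolding QP[OF z, symmetric] by (simp only: distrib_left mult.assoc)
          then show ?thesis using eq[OF z] by simp
        qed
      qed (use \<phi> in auto)
      then have "Q a = 0" using 2 by (simp add: zero_power)
      then show False unfolding Qa using \<phi>(4) k0 by (auto simp: k_def)
    qed
  qed
qed

lemma pole_order_cases:
  assumes "a \<in> S"
  shows "(degree P = 2 \<and> zorder W a = -2) \<or> (degree P = 3 \<and> zorder W a = -1)"
proof -
  obtain r \<phi> m where \<phi>: "0 < r" "ball a r - {a} \<subseteq> - S" "\<phi> holomorphic_on ball a r" "\<phi> a \<noteq> 0" "0 < m"
    "zorder W a = - int m" "\<And>z. z \<in> ball a r - {a} \<Longrightarrow> W z = \<phi> z / (z - a) ^ m"
    using pole_form[OF assms] by blast
  have b: "m * degree P = m + 2" by (rule pole_order_balance[OF assms \<phi>(1-5,7)])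
  then have "m dvd m + 2" by (metis dvd_triv_left)
  then have "m dvd 2" by (simp only: dvd_add_triv_left_iff)
  then have "m \<le> 2" by (rule dvd_imp_le) simp
  then consider "m = 1" | "m = 2" using \<phi>(5) by linarith
  then show ?thesis using b \<phi>(6) by cases auto
qed

text \<open>The equation multiplied by \<open>(z - a)^(m + 2)\<close> extends to the centre \<open>a\<close>, where its value and its first derivative vanish;
\<open>Q\<close> is the extension of the term with \<open>P\<close>.\<close>

lemma first_two_coefficients:
  assumes a: "a \<in> S" and \<phi>: "0 < r" "ball a r - {a} \<subseteq> - S" "\<phi> holomorphic_on ball a r"
    and W: "\<And>z. z \<in> ball a r - {a} \<Longrightarrow> W z = \<phi> z / (z - a) ^ m"
    and Q: "\<And>z. z \<in> ball a r - {a} \<Longrightarrow> (z - a) ^ (m + 2) * poly P (\<phi> z / (z - a) ^ m) = Q z"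
      "Q holomorphic_on ball a r"
  shows "of_nat m * (of_nat m + 1) * \<phi> a + Q a = 0"
    and "of_nat m * (of_nat m - 1) * deriv \<phi> a - c * of_nat m * \<phi> a + deriv Q a = 0"
proof -
  define \<phi>1 where "\<phi>1 = polar_deriv a m \<phi>"
  define \<phi>2 where "\<phi>2 = polar_deriv a (m + 1) \<phi>1"
  have h1: "\<phi>1 holomorphic_on ball a r" unfolding \<phi>1_def by (rule holomorphic_polar_deriv[OF \<phi>(3)])
  have h2: "\<phi>2 holomorphic_on ball a r" unfolding \<phi>2_def by (rule holomorphic_polar_deriv[OF h1])
  have D: "(f has_field_derivative deriv f a) (at a)" if "f holomorphic_on ball a r" for f
    using holomorphic_derivI[OF that open_ball] \<phi>(1) by auto
  have D_polar: "deriv (polar_deriv a l f) a = (1 - of_nat l) * deriv f a" if "f holomorphic_on ball a r" for f l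
  proof (rule DERIV_imp_deriv)
    have "deriv f holomorphic_on ball a r" using that by (intro holomorphic_deriv) auto
    then show "(polar_deriv a l f has_field_derivative (1 - of_nat l) * deriv f a) (at a)"
      unfolding polar_deriv_def[abs_def]
      by (auto intro!: derivative_eq_intros D that simp: algebra_simps)
  qed
  define E where "E z = \<phi>2 z + c * \<phi>1 z * (z - a) + Q z" for z
  have E: "E holomorphic_on ball a r" unfolding E_def[abs_def] by (intro holomorphic_intros h1 h2 Q(2))
  have E0: "E z = 0" if z: "z \<in> ball a r - {a}" for z
    using polar_equation[OF a \<phi> W z] unfolding Q(1)[OF z] E_def \<phi>1_def \<phi>2_def .
  have v1: "\<phi>1 a = - of_nat m * \<phi> a" and v2: "\<phi>2 a = of_nat m * (of_nat m + 1) * \<phi> a"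
    by (simp_all add: \<phi>1_def \<phi>2_def polar_deriv_def algebra_simps)
  have "E a = 0" using eq_0_at_centre(1)[OF E \<phi>(1) E0] \<phi>(1) by simp
  then show "of_nat m * (of_nat m + 1) * \<phi> a + Q a = 0" unfolding E_def v2 by simp
  have d2: "deriv \<phi>2 a = of_nat m * (of_nat m - 1) * deriv \<phi> a"
    unfolding \<phi>2_def D_polar[OF h1] unfolding \<phi>1_def D_polar[OF \<phi>(3)] by (simp add: algebra_simps)
  have "(E has_field_derivative deriv \<phi>2 a + c * \<phi>1 a + deriv Q a) (at a)"
    unfolding E_def[abs_def] by (auto intro!: derivative_eq_intros D h1 h2 Q(2))
  moreover have "deriv E a = 0" by (rule eq_0_at_centre(2)[OF E \<phi>(1)]) (rule E0)
  ultimately have "deriv \<phi>2 a + c * \<phi>1 a + deriv Q a = 0" using DERIV_imp_deriv by fastforce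
  then show "of_nat m * (of_nat m - 1) * deriv \<phi> a - c * of_nat m * \<phi> a + deriv Q a = 0"
    unfolding d2 v1 by (simp add: algebra_simps)
qed

lemma double_pole_coefficients:
  assumes a: "a \<in> S" and P: "P = [:p0, 0, -6:]"
  obtains r \<phi> where "0 < r" "ball a r - {a} \<subseteq> - S" "\<phi> holomorphic_on ball a r"
    "\<And>z. z \<in> ball a r - {a} \<Longrightarrow> W z = \<phi> z / (z - a) ^ 2" "\<phi> a = 1" "deriv \<phi> a = - c / 5"
proof -
  obtain r \<phi> m where \<phi>: "0 < r" "ball a r - {a} \<subseteq> - S" "\<phi> holomorphic_on ball a r" "\<phi> a \<noteq> 0" "0 < m"
    "zorder W a = - int m" "\<And>z. z \<in> ball a r - {a} \<Longrightarrow> W z = \<phi> z / (z - a) ^ m"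
    using pole_form[OF a] by blast
  have m: "m = 2" using pole_order_balance[OF a \<phi>(1-5,7)] by (simp add: P)
  define Q where "Q z = p0 * (z - a) ^ 4 - 6 * \<phi> z ^ 2" for z
  have Q: "Q holomorphic_on ball a r" unfolding Q_def[abs_def] by (intro holomorphic_intros \<phi>(3))
  have QP: "(z - a) ^ (m + 2) * poly P (\<phi> z / (z - a) ^ m) = Q z" if z: "z \<in> ball a r - {a}" for z
  proof -
    have "t ^ (2 + 2) * poly [:p0, 0, -6:] (p / t ^ 2) = p0 * t ^ 4 - 6 * p ^ 2" if "t \<noteq> 0" for t p :: complex
      using that by (simp add: field_simps power2_eq_square power4_eq_xxxx)
    moreover have "z - a \<noteq> 0" using z by auto
    ultimately show ?thesis unfolding P m Q_def by blast
  qed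
  note eqs = first_two_coefficients[OF a \<phi>(1-3,7) QP Q, unfolded m]
  have "6 * \<phi> a * (1 - \<phi> a) = 0" using eqs(1) by (simp add: Q_def algebra_simps power2_eq_square)
  then have 1: "\<phi> a = 1" using \<phi>(4) by simp
  have "deriv Q a = - 12 * \<phi> a * deriv \<phi> a"
  proof (rule DERIV_imp_deriv)
    have "(\<phi> has_field_derivative deriv \<phi> a) (at a)" using holomorphic_derivI[OF \<phi>(3) open_ball] \<phi>(1) by auto
    then show "(Q has_field_derivative - 12 * \<phi> a * deriv \<phi> a) (at a)"
      unfolding Q_def[abs_def] by (auto intro!: derivative_eq_intros)
  qed
  then have lin: "deriv \<phi> a * 10 + c * 2 = 0" using eqs(2) 1 by simp algebra
  have "deriv \<phi> a = - c / 5 + (deriv \<phi> a * 10 + c * 2) / 10" by (simp add: field_simps)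
  then have "deriv \<phi> a = - c / 5" unfolding lin by simp
  then show ?thesis using that[OF \<phi>(1-3)] \<phi>(7) 1 unfolding m by blast
qed

text \<open>Here the leading coefficient is determined only up to sign, and the next one depends on
it. Solutions may have poles with both residues, and this causes the case distinction for cubic \<open>P\<close> below.\<close>

lemma simple_pole_coefficients:
  assumes a: "a \<in> S" and P: "P = [:p0, p1, 0, -2:]"
  obtains r \<phi> where "0 < r" "ball a r - {a} \<subseteq> - S" "\<phi> holomorphic_on ball a r"
    "\<And>z. z \<in> ball a r - {a} \<Longrightarrow> W z = \<phi> z / (z - a)" "\<phi> a ^ 2 = 1" "deriv \<phi> a = - c * \<phi> a / 6"
proof -
  obtain r \<phi> m where \<phi>: "0 < r" "ball a r - {a} \<subseteq> - S" "\<phi> holomorphic_on ball a r" "\<phi> a \<noteq> 0" "0 < m"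
    "zorder W a = - int m" "\<And>z. z \<in> ball a r - {a} \<Longrightarrow> W z = \<phi> z / (z - a) ^ m"
    using pole_form[OF a] by blast
  have m: "m = 1" using pole_order_balance[OF a \<phi>(1-5,7)] by (simp add: P)
  define Q where "Q z = p0 * (z - a) ^ 3 + p1 * \<phi> z * (z - a) ^ 2 - 2 * \<phi> z ^ 3" for z
  have Q: "Q holomorphic_on ball a r" unfolding Q_def[abs_def] by (intro holomorphic_intros \<phi>(3))
  have QP: "(z - a) ^ (m + 2) * poly P (\<phi> z / (z - a) ^ m) = Q z" if z: "z \<in> ball a r - {a}" for z
  proof -
    have "t ^ (1 + 2) * poly [:p0, p1, 0, -2:] (p / t ^ 1) = p0 * t ^ 3 + p1 * p * t ^ 2 - 2 * p ^ 3"
      if "t \<noteq> 0" for t p :: complex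
      using that by (simp add: field_simps power2_eq_square power3_eq_cube)
    moreover have "z - a \<noteq> 0" using z by auto
    ultimately show ?thesis unfolding P m Q_def by blast
  qed
  note eqs = first_two_coefficients[OF a \<phi>(1-3,7) QP Q, unfolded m]
  have "2 * \<phi> a * (1 - \<phi> a ^ 2) = 0"
    using eqs(1) by (simp add: Q_def algebra_simps power2_eq_square power3_eq_cube)
  then have 1: "\<phi> a ^ 2 = 1" using \<phi>(4) by simp
  have "deriv Q a = - 6 * \<phi> a ^ 2 * deriv \<phi> a"
  proof (rule DERIV_imp_deriv)
    have "(\<phi> has_field_derivative deriv \<phi> a) (at a)" using holomorphic_derivI[OF \<phi>(3) open_ball] \<phi>(1) by auto
    then show "(Q has_field_derivative - 6 * \<phi> a ^ 2 * deriv \<phi> a) (at a)"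
      unfolding Q_def[abs_def] by (auto intro!: derivative_eq_intros)
  qed
  then have "deriv \<phi> a * 6 + c * \<phi> a = 0" using eqs(2) 1 by (simp add: algebra_simps) algebra
  then have "deriv \<phi> a = - c * \<phi> a / 6" by (simp add: field_simps eq_neg_iff_add_eq_0)
  then show ?thesis using that[OF \<phi>(1-3)] \<phi>(7) 1 unfolding m by (simp only: power_one_right)
qed

end

section \<open>Spacing of poles\<close>

text \<open>Pointwise form of the statement that \<open>w'^2\<close> and \<open>w w''\<close> are close to \<open>m^2 w^(n+2)\<close> and \<open>m (m+1) w^(n+2)\<close> once \<open>|w|\<close>
is large; \<open>a\<close>, \<open>b\<close>, \<open>d\<close> stand for the values of \<open>w\<close>, \<open>w'\<close>, \<open>w''\<close>. The conclusions are estimates for the derivative and the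
size of \<open>G = - m w / w'\<close>. The constant \<open>10^7\<close> makes each error term at most \<open>N / 1000\<close>, where \<open>N = |w|^(n+2)\<close>.\<close>

lemma dominant_balance:
  fixes a b d :: complex and m n :: nat
  assumes n: "1 \<le> n" and m: "m = 1 \<or> m = 2" and D: "1 \<le> D" and L: "1 \<le> L"
    and big: "10000000 * D ^ 2 * L \<le> cmod a"
    and H1: "cmod (b ^ 2 - of_nat m ^ 2 * a ^ (n + 2)) \<le> D * (cmod a * cmod b + cmod a ^ 2) + L"
    and H2: "cmod (d - of_nat (m * (m + 1)) * a ^ (n + 1)) \<le> D * (cmod a + cmod b)"
  shows "b \<noteq> 0" "cmod (- of_nat m + of_nat m * a * d / b ^ 2 - 1) \<le> 1/4"
    "1/2 \<le> cmod (of_nat m * a / b) ^ 2 * cmod a ^ n" "cmod (of_nat m * a / b) ^ 2 * cmod a ^ n \<le> 2"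
proof -
  define x where "x = cmod a"
  define y where "y = cmod b"
  define N where "N = x ^ (n + 2)"
  have DD: "D \<le> D ^ 2" using D by (simp add: power2_eq_square)
  have "1 \<le> D ^ 2" using D by simp
  have "1 * L \<le> D ^ 2 * L" using \<open>1 \<le> D ^ 2\<close> L by (intro mult_right_mono) auto
  then have Lx: "10000000 * L \<le> x" using big by (simp add: x_def)
  have "D ^ 2 * 1 \<le> D ^ 2 * L" using L by (intro mult_left_mono) auto
  then have Dx: "10000000 * D ^ 2 \<le> x" using big by (simp add: x_def)
  have x1: "1 \<le> x" using Lx L by simp
  have x3: "x ^ 3 \<le> N" unfolding N_def using x1 n by (intro power_increasing) auto
  have "x ^ 1 \<le> N" unfolding N_def using x1 by (intro power_increasing) auto
  then have LN: "10000000 * L \<le> N" using Lx by simp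
  have "10000000 * D ^ 2 * x ^ 2 \<le> x * x ^ 2" using Dx by (intro mult_right_mono) auto
  then have D2N: "10000000 * (D ^ 2 * x ^ 2) \<le> N" using x3 by (simp add: power2_eq_square power3_eq_cube)
  have "D * x ^ 2 \<le> D ^ 2 * x ^ 2" using DD by (intro mult_right_mono) auto
  then have DN: "10000000 * (D * x ^ 2) \<le> N" using D2N by linarith
  have N1: "1 \<le> N" unfolding N_def using x1 by (rule one_le_power)
  have nN: "cmod (a ^ (n + 2)) = N" by (simp only: norm_power N_def x_def)
  have m2: "(real m) ^ 2 \<le> 4" "1 \<le> (real m) ^ 2" using m by auto
  have nmN: "cmod (of_nat m ^ 2 * a ^ (n + 2)) = (real m) ^ 2 * N"
    unfolding norm_mult nN by (simp add: norm_power)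
  have yy: "cmod (b ^ 2) = y ^ 2" by (simp add: y_def norm_power)
  have "y ^ 2 \<le> (real m) ^ 2 * N + (D * (x * y + x ^ 2) + L)"
    using H1 norm_triangle_ineq2[of "b ^ 2" "of_nat m ^ 2 * a ^ (n + 2)"]
    unfolding nmN yy x_def[symmetric] y_def[symmetric] by linarith
  moreover have "(real m) ^ 2 * N \<le> 4 * N" using m2 N1 by (intro mult_right_mono) auto
  \<comment> \<open>The mixed term is absorbed into the left-hand side, which gives a first bound for \<open>y\<close>; this bound then shows that the mixed term is small.\<close>
  moreover have "D * x * y \<le> y ^ 2 / 4 + D ^ 2 * x ^ 2"
    using zero_le_power2[of "y / 2 - D * x"] by (simp add: power2_eq_square algebra_simps)
  moreover have dist: "D * (x * y + x ^ 2) = D * x * y + D * x ^ 2" by (simp add: algebra_simps)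
  ultimately have y6: "y ^ 2 \<le> 6 * N" using D2N DN LN N1 by linarith
  have Dxy: "D * x * y \<le> N / 1000"
  proof (rule power2_le_imp_le)
    have "(D * x * y) ^ 2 = (D ^ 2 * x ^ 2) * y ^ 2" by (simp add: power_mult_distrib)
    also have "\<dots> \<le> (N / 10000000) * (6 * N)" using D2N y6 N1 by (intro mult_mono) auto
    also have "\<dots> \<le> (N / 1000) ^ 2" using N1 by (simp add: power2_eq_square)
    finally show "(D * x * y) ^ 2 \<le> (N / 1000) ^ 2" .
  qed (use N1 in auto)
  have e1: "cmod (b ^ 2 - of_nat m ^ 2 * a ^ (n + 2)) \<le> 3/1000 * N"
    using H1 Dxy DN LN N1 dist unfolding x_def[symmetric] y_def[symmetric] by linarith
  have e2: "cmod (a * d - of_nat (m * (m + 1)) * a ^ (n + 2)) \<le> 2/1000 * N"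
  proof -
    have "a * d - of_nat (m * (m + 1)) * a ^ (n + 2) = a * (d - of_nat (m * (m + 1)) * a ^ (n + 1))"
      by (simp add: algebra_simps)
    then have "cmod (a * d - of_nat (m * (m + 1)) * a ^ (n + 2)) = x * cmod (d - of_nat (m * (m + 1)) * a ^ (n + 1))"
      by (simp only: norm_mult x_def)
    also have "\<dots> \<le> x * (D * (x + y))" using H2 x1 unfolding x_def y_def by (intro mult_left_mono) auto
    also have "\<dots> = D * x ^ 2 + D * x * y" by (simp add: power2_eq_square algebra_simps)
    finally show ?thesis using Dxy DN N1 by linarith
  qed
  have up: "y ^ 2 \<le> (real m) ^ 2 * N + 3/1000 * N"
    using e1 norm_triangle_ineq2[of "b ^ 2" "of_nat m ^ 2 * a ^ (n + 2)"] unfolding nmN yy by linarith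
  have lo: "(real m) ^ 2 * N - 3/1000 * N \<le> y ^ 2"
    using e1 norm_triangle_ineq2[of "of_nat m ^ 2 * a ^ (n + 2)" "b ^ 2"] unfolding nmN yy norm_minus_commute[of "b ^ 2"] by linarith
  have mN: "N \<le> (real m) ^ 2 * N" using m2 N1 by simp
  have ypos: "997/1000 * N \<le> y ^ 2" using lo mN by linarith
  then have y2: "0 < y ^ 2" using N1 by linarith
  then show b: "b \<noteq> 0" by (auto simp: y_def)
  have eq: "- of_nat m + of_nat m * a * d / b ^ 2 - 1 =
     (of_nat m * (a * d - of_nat (m * (m + 1)) * a ^ (n + 2)) - of_nat (m + 1) * (b ^ 2 - of_nat m ^ 2 * a ^ (n + 2))) / b ^ 2"
  proof -
    have "of_nat m * (a * d - of_nat (m * (m + 1)) * a ^ (n + 2)) - of_nat (m + 1) * (b ^ 2 - of_nat m ^ 2 * a ^ (n + 2))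
      = of_nat m * a * d - of_nat (m + 1) * b ^ 2"
      by (simp add: algebra_simps power2_eq_square)
    then show ?thesis using b by (simp add: field_simps)
  qed
  have "cmod (of_nat m * (a * d - of_nat (m * (m + 1)) * a ^ (n + 2)) - of_nat (m + 1) * (b ^ 2 - of_nat m ^ 2 * a ^ (n + 2)))
     \<le> real m * cmod (a * d - of_nat (m * (m + 1)) * a ^ (n + 2)) + real (m + 1) * cmod (b ^ 2 - of_nat m ^ 2 * a ^ (n + 2))"
    by (rule order_trans[OF norm_triangle_ineq4]) (simp only: norm_mult norm_of_nat order_refl)
  also have "\<dots> \<le> 2 * (2/1000 * N) + 3 * (3/1000 * N)"
    using e1 e2 m by (intro add_mono mult_mono) auto
  also have "\<dots> \<le> 1/4 * (997/1000 * N)" using N1 by simp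
  also have "\<dots> \<le> 1/4 * y ^ 2" using ypos by simp
  finally show "cmod (- of_nat m + of_nat m * a * d / b ^ 2 - 1) \<le> 1/4"
    unfolding eq norm_divide yy using y2 by (simp add: field_simps)
  have G: "cmod (of_nat m * a / b) ^ 2 * cmod a ^ n = (real m) ^ 2 * N / y ^ 2"
    by (simp add: norm_mult norm_divide power_divide power_mult_distrib N_def x_def y_def power_add power2_eq_square mult.commute mult.left_commute)
  show "1/2 \<le> cmod (of_nat m * a / b) ^ 2 * cmod a ^ n"
  proof -
    have "y ^ 2 \<le> 2 * ((real m) ^ 2 * N)" using up mN N1 by linarith
    then show ?thesis unfolding G using y2 by (simp add: field_simps)
  qed
  show "cmod (of_nat m * a / b) ^ 2 * cmod a ^ n \<le> 2"
  proof -
    have "(real m) ^ 2 * N \<le> 2 * y ^ 2" using lo mN N1 by linarith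
    then show ?thesis unfolding G using y2 by (simp add: field_simps)
  qed
qed

text \<open>Each cell of a square grid of mesh \<open>s / 2\<close> contains at most one point.\<close>

lemma card_separated_le:
  fixes A :: "complex set"
  assumes s: "0 < s" and R: "0 \<le> R" and sub: "A \<subseteq> cball 0 R"
    and sep: "\<And>x y. x \<in> A \<Longrightarrow> y \<in> A \<Longrightarrow> cmod (x - y) < s \<Longrightarrow> x = y"
  shows "real (card A) \<le> (4 * R / s + 3) ^ 2"
proof -
  define N where "N = \<lceil>2 * R / s\<rceil>"
  define g where "g z = (\<lfloor>2 * Re z / s\<rfloor>, \<lfloor>2 * Im z / s\<rfloor>)" for z
  have inj: "inj_on g A"
  proof (rule inj_onI)
    fix x y assume xy: "x \<in> A" "y \<in> A" "g x = g y"
    have *: "\<bar>u - v\<bar> < s / 2" if "\<lfloor>2 * u / s\<rfloor> = \<lfloor>2 * v / s\<rfloor>" for u v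
    proof -
      have "2 * u / s < 2 * v / s + 1" "2 * v / s < 2 * u / s + 1" using that by linarith+
      then have "2 * u < 2 * v + s" "2 * v < 2 * u + s" using s by (simp_all add: field_simps)
      then show ?thesis by linarith
    qed
    have "\<bar>Re x - Re y\<bar> < s / 2" "\<bar>Im x - Im y\<bar> < s / 2" using xy(3) *[of "Re x" "Re y"] *[of "Im x" "Im y"] by (simp_all add: g_def)
    then have "cmod (x - y) < s" using cmod_le[of "x - y"] by simp
    then show "x = y" using sep xy by blast
  qed
  have N0: "0 \<le> N" proof -
    have "0 \<le> 2 * R / s" using R s by simp
    then show ?thesis unfolding N_def by linarith
  qed
  have "g ` A \<subseteq> {-N..N} \<times> {-N..N}"
  proof -
    have *: "\<lfloor>2 * u / s\<rfloor> \<in> {-N..N}" if "\<bar>u\<bar> \<le> R" for u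
    proof -
      have "2 * u / s \<le> 2 * R / s" using that s by (intro divide_right_mono) auto
      moreover have "2 * (- R) / s \<le> 2 * u / s" using that s by (intro divide_right_mono) auto
      ultimately have "2 * u / s \<le> 2 * R / s" "- (2 * R / s) \<le> 2 * u / s" by simp_all
      then show ?thesis unfolding N_def by (simp; linarith)
    qed
    have "\<bar>Re z\<bar> \<le> R" "\<bar>Im z\<bar> \<le> R" if "z \<in> A" for z
      using that sub abs_Re_le_cmod[of z] abs_Im_le_cmod[of z] by (auto intro: order_trans)
    then show ?thesis unfolding g_def using * by auto
  qed
  then have "card (g ` A) \<le> card ({-N..N} \<times> {-N..N})" by (intro card_mono) auto
  also have "\<dots> = nat (2 * N + 1) ^ 2" by (simp add: power2_eq_square)
  finally have "card A \<le> nat (2 * N + 1) ^ 2" using card_image[OF inj] by simp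
  then have "real (card A) \<le> real (nat (2 * N + 1)) ^ 2" by (simp flip: of_nat_power)
  also have "\<dots> \<le> (4 * R / s + 3) ^ 2"
  proof (rule power_mono)
    have "of_int N \<le> 2 * R / s + 1" unfolding N_def by linarith
    then show "real (nat (2 * N + 1)) \<le> 4 * R / s + 3" using N0 by simp
  qed auto
  finally show ?thesis .
qed

text \<open>The setting in which poles are located: on \<open>U\<close>, the function \<open>G = - m W / W'\<close> has derivative close to 1 and \<open>|G|^2\<close> is
comparable to \<open>|W|^(-n)\<close> wherever \<open>|W| \<ge> K\<close>. Near a pole \<open>a\<close> of order \<open>m = 2 / n\<close>, \<open>G\<close> is a local
coordinate that behaves like \<open>z - a\<close>.\<close>

locale large_values_region = analytic_off_poles +
  fixes m n :: nat and U :: "complex set" and K :: real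
  assumes n: "1 \<le> n" and K: "1 \<le> K"
    and U: "open U" "convex U" "bounded U"
    and W'_nonzero: "z \<in> U - S \<Longrightarrow> K \<le> cmod (W z) \<Longrightarrow> deriv W z \<noteq> 0"
    and slope: "z \<in> U - S \<Longrightarrow> K \<le> cmod (W z) \<Longrightarrow>
       cmod (- of_nat m + of_nat m * W z * deriv (deriv W) z / deriv W z ^ 2 - 1) \<le> 1/4"
    and size_lower: "z \<in> U - S \<Longrightarrow> K \<le> cmod (W z) \<Longrightarrow> 1/2 \<le> cmod (of_nat m * W z / deriv W z) ^ 2 * cmod (W z) ^ n"
    and size_upper: "z \<in> U - S \<Longrightarrow> K \<le> cmod (W z) \<Longrightarrow> cmod (of_nat m * W z / deriv W z) ^ 2 * cmod (W z) ^ n \<le> 2"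
begin

definition G :: "complex \<Rightarrow> complex" where
  "G z = (if z \<in> S then 0 else - of_nat m * W z / deriv W z)"

definition \<Omega> :: "complex set" where
  "\<Omega> = {z \<in> U. z \<in> S \<or> K < cmod (W z)}"

lemma norm_G_bounds:
  assumes "z \<in> \<Omega> - S"
  shows "1/2 \<le> cmod (G z) ^ 2 * cmod (W z) ^ n" "cmod (G z) ^ 2 * cmod (W z) ^ n \<le> 2"
  using assms size_lower[of z] size_upper[of z] by (auto simp: G_def \<Omega>_def norm_mult norm_divide)

lemma norm_at_top_pole:
  assumes "a \<in> S"
  shows "filterlim (\<lambda>z. cmod (W z)) at_top (at a)"
  using poles[OF assms] unfolding is_pole_def by (rule filterlim_at_infinity_imp_norm_at_top)

lemma eventually_in_region:
  assumes "a \<in> S" "a \<in> U"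
  shows "eventually (\<lambda>z. z \<in> \<Omega> - S) (at a)"
proof -
  have "eventually (\<lambda>z. K + 1 \<le> cmod (W z)) (at a)"
    using norm_at_top_pole[OF assms(1)] unfolding filterlim_at_top by blast
  moreover have "eventually (\<lambda>z. z \<in> U) (at a)"
    using U(1) assms(2) by (intro eventually_at_in_open')
  ultimately show ?thesis using eventually_not_pole[of a]
    by eventually_elim (auto simp: \<Omega>_def)
qed

lemma open_region: "open \<Omega>"
proof -
  have "\<exists>T. open T \<and> z \<in> T \<and> T \<subseteq> \<Omega>" if z: "z \<in> \<Omega>" for z
  proof (cases "z \<in> S")
    case True
    have "eventually (\<lambda>x. x \<in> \<Omega>) (nhds z)"
    proof -
      have "eventually (\<lambda>x. x \<noteq> z \<longrightarrow> x \<in> \<Omega> - S) (nhds z)"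
        using eventually_in_region[OF True] z by (simp add: \<Omega>_def eventually_at_filter)
      then show ?thesis by (rule eventually_mono) (use z in blast)
    qed
    then show ?thesis unfolding eventually_nhds by blast
  next
    case False
    have "open {x \<in> - S. cmod (W x) \<in> {K<..}}"
      by (rule open_norm_preimage) auto
    then have "open ({x \<in> - S. cmod (W x) \<in> {K<..}} \<inter> U)" using U(1) by blast
    then show ?thesis using False z by (intro exI[of _ "{x \<in> - S. cmod (W x) \<in> {K<..}} \<inter> U"]) (auto simp: \<Omega>_def)
  qed
  then show ?thesis by (subst open_subopen) blast
qed

lemma has_field_derivative_G:
  assumes "z \<in> \<Omega> - S"
  shows "(G has_field_derivative (- of_nat m + of_nat m * W z * deriv (deriv W) z / deriv W z ^ 2)) (at z)"
proof -
  have W': "deriv W z \<noteq> 0" using W'_nonzero assms by (auto simp: \<Omega>_def)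
  have nS: "z \<notin> S" using assms by auto
  have "((\<lambda>z. - of_nat m * W z / deriv W z) has_field_derivative
      (- of_nat m + of_nat m * W z * deriv (deriv W) z / deriv W z ^ 2)) (at z)"
    using W' by (auto intro!: derivative_eq_intros has_deriv[OF nS] has_deriv2[OF nS] simp: divide_simps power2_eq_square algebra_simps)
  then show ?thesis
    by (rule has_field_derivative_transform_within_open[OF _ open_compl]) (use nS in \<open>auto simp: G_def\<close>)
qed

lemma G_tendsto_pole:
  assumes "a \<in> S" "a \<in> U"
  shows "(G \<longlongrightarrow> 0) (at a)"
proof -
  have "((\<lambda>z. 2 / cmod (W z)) \<longlongrightarrow> 0) (at a)"
    by (rule tendsto_divide_0[OF tendsto_const filterlim_at_top_imp_at_infinity[OF norm_at_top_pole[OF assms(1)]]])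
  moreover have "eventually (\<lambda>z. norm (G z ^ 2) \<le> 2 / cmod (W z)) (at a)"
    using eventually_in_region[OF assms]
  proof eventually_elim
    case (elim z)
    have W1: "1 \<le> cmod (W z)" using elim K by (auto simp: \<Omega>_def)
    then have "cmod (W z) ^ 1 \<le> cmod (W z) ^ n" using n by (intro power_increasing) auto
    then have "cmod (G z) ^ 2 * cmod (W z) \<le> cmod (G z) ^ 2 * cmod (W z) ^ n" by (intro mult_left_mono) auto
    then have "cmod (G z) ^ 2 * cmod (W z) \<le> 2" using norm_G_bounds(2)[OF elim] by linarith
    moreover have "0 < cmod (W z)" using W1 by linarith
    ultimately show ?case by (simp only: norm_power pos_le_divide_eq)
  qed
  ultimately have "((\<lambda>z. G z ^ 2) \<longlongrightarrow> 0) (at a)" by (rule Lim_null_comparison[rotated])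
  then have "((\<lambda>z. sqrt (norm (G z ^ 2))) \<longlongrightarrow> sqrt (norm (0::complex))) (at a)"
    by (intro tendsto_intros)
  then have "((\<lambda>z. norm (G z)) \<longlongrightarrow> 0) (at a)" by (simp add: norm_power)
  then show ?thesis by (rule tendsto_norm_zero_cancel)
qed

lemma G_holomorphic: "G holomorphic_on \<Omega>"
proof (rule no_isolated_singularity'[where K = "S \<inter> \<Omega>"])
  have "G field_differentiable at z within \<Omega> - S" if "z \<in> \<Omega> - S" for z
    using has_field_derivative_at_within[OF has_field_derivative_G[OF that]] by (auto simp: field_differentiable_def)
  then have "G holomorphic_on \<Omega> - S" unfolding holomorphic_on_def by blast
  then show "G holomorphic_on \<Omega> - S \<inter> \<Omega>"
    by (rule holomorphic_on_subset) auto
  show "open \<Omega>" by (rule open_region)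
  have "finite (closure U \<inter> S)" using U(3) by (intro finite_poles) (simp add: compact_closure)
  then show "finite (S \<inter> \<Omega>)"
    by (rule rev_finite_subset) (use closure_subset[of U] in \<open>auto simp: \<Omega>_def\<close>)
  fix a assume a: "a \<in> S \<inter> \<Omega>"
  have "(G \<longlongrightarrow> 0) (at a)" using a by (intro G_tendsto_pole) (auto simp: \<Omega>_def)
  then have "(G \<longlongrightarrow> 0) (at a within \<Omega>)" by (rule tendsto_within_subset) auto
  then show "(G \<longlongrightarrow> G a) (at a within \<Omega>)" using a by (simp add: G_def)
qed

lemma norm_deriv_G:
  assumes "z \<in> \<Omega>"
  shows "cmod (deriv G z - 1) \<le> 1/4"
proof -
  have *: "cmod (deriv G z - 1) \<le> 1/4" if "z \<in> \<Omega> - S" for z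
    using slope[of z] that DERIV_imp_deriv[OF has_field_derivative_G[OF that]] by (auto simp: \<Omega>_def)
  show ?thesis
  proof (cases "z \<in> S")
    case True
    have "isCont (deriv G) z"
      using continuous_on_eq_continuous_at[OF open_region, of "deriv G"] assms
        holomorphic_on_imp_continuous_on[OF holomorphic_deriv[OF G_holomorphic open_region]] by simp
    then have "(deriv G \<longlongrightarrow> deriv G z) (at z)" by (simp add: isCont_def)
    then have "((\<lambda>x. cmod (deriv G x - 1)) \<longlongrightarrow> cmod (deriv G z - 1)) (at z)"
      by (intro tendsto_intros)
    moreover have "eventually (\<lambda>x. cmod (deriv G x - 1) \<le> 1/4) (at z)"
      by (rule eventually_mono[OF eventually_in_region[OF True]]) (use assms * in \<open>auto simp: \<Omega>_def\<close>)
    ultimately show ?thesis by (rule tendsto_upperbound) simp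
  qed (use * assms in auto)
qed

lemma G_increment:
  assumes "convex C" "C \<subseteq> \<Omega>" "x \<in> C" "y \<in> C"
  shows "cmod ((G x - x) - (G y - y)) \<le> 1/4 * cmod (x - y)" "cmod (G x - G y) \<le> 5/4 * cmod (x - y)"
proof -
  have "((\<lambda>z. G z - z) has_field_derivative (deriv G z - 1)) (at z within C)" if "z \<in> C" for z
    using assms(2) that
    by (auto intro!: derivative_eq_intros has_field_derivative_at_within[OF holomorphic_derivI[OF G_holomorphic open_region]])
  from field_differentiable_bound[OF assms(1) this norm_deriv_G assms(3,4)] assms(2)
  show 1: "cmod ((G x - x) - (G y - y)) \<le> 1/4 * cmod (x - y)" by blast
  have "cmod (G x - G y) \<le> cmod ((G x - x) - (G y - y)) + cmod (x - y)"
    using norm_triangle_ineq[of "(G x - x) - (G y - y)" "x - y"] by (simp add: algebra_simps)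
  then show "cmod (G x - G y) \<le> 5/4 * cmod (x - y)" using 1 by linarith
qed

text \<open>The region where \<open>W\<close> is large contains a disc around each of its points at which \<open>G\<close> is small. On the way along a radius \<open>G\<close> changes by
at most \<open>5/4\<close> of the distance, so it stays below \<open>\<sigma>\<close>, hence \<open>|W|\<close> stays above \<open>2 K\<close>; since leaving the region means
\<open>|W| \<le> K\<close>, there is no first exit point.\<close>

lemma ball_subset_region:
  assumes z0: "z0 \<in> \<Omega>" and sub: "ball z0 \<rho> \<subseteq> U" and \<sigma>: "cmod (G z0) + 5/4 * \<rho> \<le> \<sigma>"
    and K\<sigma>: "2 * \<sigma> ^ 2 * (2 * K) ^ n \<le> 1"
  shows "ball z0 \<rho> \<subseteq> \<Omega>"
proof (rule ccontr)
  assume "\<not> ball z0 \<rho> \<subseteq> \<Omega>"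
  then obtain z where z: "z \<in> ball z0 \<rho>" "z \<notin> \<Omega>" by blast
  define g where "g t = z0 + of_real t * (z - z0)" for t :: real
  define Bd where "Bd = {t \<in> {0..1}. g t \<in> - \<Omega>}"
  have contg: "continuous_on A g" for A unfolding g_def by (intro continuous_intros)
  have gball: "g t \<in> ball z0 \<rho>" if "t \<in> {0..1}" for t
  proof -
    have "dist z0 (g t) = t * dist z0 z" using that by (simp add: g_def dist_norm norm_mult norm_minus_commute)
    also have "\<dots> \<le> 1 * dist z0 z" using that by (intro mult_right_mono) auto
    finally show ?thesis using z(1) by simp
  qed
  have "compact Bd" unfolding Bd_def
    using continuous_closed_preimage[OF contg[of "{0..1}"], of "- \<Omega>"] open_region
    by (intro compact_eq_bounded_closed[THEN iffD2] conjI bounded_subset[OF bounded_closed_interval[of 0 1]])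
       (auto simp: vimage_def Int_def conj_commute)
  moreover have "1 \<in> Bd" using z(2) by (simp add: Bd_def g_def)
  ultimately obtain t1 where t1: "t1 \<in> Bd" "\<And>t. t \<in> Bd \<Longrightarrow> t1 \<le> t"
    using compact_attains_inf[of Bd] by blast
  have t1r: "t1 \<in> {0..1}" and t1\<Omega>: "g t1 \<notin> \<Omega>" using t1(1) by (auto simp: Bd_def)
  have "t1 \<noteq> 0" using t1\<Omega> z0 by (auto simp: g_def)
  then have t1pos: "0 < t1" using t1r by auto
  have before: "2 * K \<le> cmod (W (g t))" if t: "0 \<le> t" "t < t1" "g t \<notin> S" for t
  proof -
    have in\<Omega>: "g s \<in> \<Omega>" if "0 \<le> s" "s \<le> t" for s
      using t1(2)[of s] that t t1r by (force simp: Bd_def)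
    have "closed_segment z0 (g t) \<subseteq> \<Omega>"
    proof
      fix x assume "x \<in> closed_segment z0 (g t)"
      then obtain u where u: "0 \<le> u" "u \<le> 1" "x = (1 - u) *\<^sub>R z0 + u *\<^sub>R g t" by (auto simp: in_segment)
      have "x = g (u * t)" unfolding u(3) g_def by (simp add: scaleR_conv_of_real algebra_simps)
      moreover have "u * t \<le> 1 * t" using u t by (intro mult_right_mono) auto
      ultimately show "x \<in> \<Omega>" using in\<Omega>[of "u * t"] u t by simp
    qed
    then have "cmod (G (g t) - G z0) \<le> 5/4 * cmod (g t - z0)"
      by (intro G_increment(2)[of "closed_segment z0 (g t)"]) auto
    moreover have "cmod (g t - z0) \<le> \<rho>" using gball[of t] t t1r by (simp add: dist_norm norm_minus_commute)
    ultimately have G\<sigma>: "cmod (G (g t)) \<le> \<sigma>" using \<sigma> norm_triangle_ineq2[of "G (g t)" "G z0"] by linarith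
    have "1/2 \<le> cmod (G (g t)) ^ 2 * cmod (W (g t)) ^ n"
      using in\<Omega>[of t] t by (intro norm_G_bounds) auto
    also have "\<dots> \<le> \<sigma> ^ 2 * cmod (W (g t)) ^ n" using G\<sigma> by (intro mult_right_mono power_mono) auto
    finally have "2 * \<sigma> ^ 2 * (2 * K) ^ n \<le> 2 * \<sigma> ^ 2 * cmod (W (g t)) ^ n" and "\<sigma> \<noteq> 0"
      using K\<sigma> n by auto
    then have "(2 * K) ^ n \<le> cmod (W (g t)) ^ n" by simp
    then show ?thesis by (rule power_mono_iff[THEN iffD1, rotated 3]) (use n K in auto)
  qed
  have t1U: "g t1 \<in> U" using gball[OF t1r] sub by blast
  then have nS: "g t1 \<notin> S" and le: "cmod (W (g t1)) \<le> K" using t1\<Omega> by (auto simp: \<Omega>_def)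
  have open': "open {x \<in> - S. cmod (W x) \<in> {..<2*K}}"
    by (rule open_norm_preimage) auto
  have "(g \<longlongrightarrow> g t1) (at t1)" using contg[of UNIV] by (simp add: continuous_on_eq_continuous_at isCont_def)
  moreover have "g t1 \<in> {x \<in> - S. cmod (W x) \<in> {..<2*K}}" using nS le K by auto
  ultimately have "eventually (\<lambda>t. g t \<in> {x \<in> - S. cmod (W x) \<in> {..<2*K}}) (at t1)"
    by (intro topological_tendstoD[OF _ open'])
  then have "eventually (\<lambda>t. g t \<in> {x \<in> - S. cmod (W x) \<in> {..<2*K}}) (at_left t1)"
    by (simp only: eventually_at_split)
  moreover have "eventually (\<lambda>t. 0 < t \<and> t < t1) (at_left t1)"
    by (rule eventually_mono[OF eventually_at_left_real[OF t1pos]]) auto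
  ultimately have "eventually (\<lambda>t. False) (at_left t1)"
  proof eventually_elim
    case (elim t)
    then have "2 * K \<le> cmod (W (g t))" by (intro before) auto
    then show False using elim by auto
  qed
  then show False by simp
qed

lemma G_expanding:
  assumes "convex C" "C \<subseteq> \<Omega>" "x \<in> C" "y \<in> C" "G x = G y"
  shows "x = y"
  using G_increment(1)[OF assms(1-4)] assms(5) norm_minus_commute[of y x] by simp

lemma poles_separated:
  assumes a: "a \<in> S" "a \<in> U" "ball a \<rho> \<subseteq> U" and \<sigma>: "5/4 * \<rho> \<le> \<sigma>" "2 * \<sigma> ^ 2 * (2 * K) ^ n \<le> 1"
    and b: "b \<in> S" "cmod (a - b) < \<rho>"
  shows "b = a"
proof -
  have sub: "ball a \<rho> \<subseteq> \<Omega>"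
    by (rule ball_subset_region[OF _ a(3) _ \<sigma>(2)]) (use a \<sigma> in \<open>auto simp: \<Omega>_def G_def\<close>)
  have "0 < \<rho>" using b(2) norm_ge_zero le_less_trans by blast
  show ?thesis
    by (rule G_expanding[OF convex_ball sub]) (use a b \<open>0 < \<rho>\<close> in \<open>auto simp: G_def dist_norm\<close>)
qed

text \<open>The map \<open>x \<mapsto> x - G x\<close> is a contraction of a small disc around \<open>z0\<close>; its fixed point is a zero of \<open>G\<close>, and within the region only
poles are zeros of \<open>G\<close>.\<close>

lemma large_value_near_pole:
  assumes z0: "z0 \<in> \<Omega>" "z0 \<notin> S" and sub: "ball z0 (\<sigma>/2) \<subseteq> U"
    and \<sigma>: "cmod (G z0) \<le> \<sigma>/8" "2 * \<sigma> ^ 2 * (2 * K) ^ n \<le> 1"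
  obtains b where "b \<in> S" "cmod (z0 - b) \<le> 2 * cmod (G z0)"
proof -
  have "0 < cmod (G z0) ^ 2 * cmod (W z0) ^ n" using norm_G_bounds(1)[of z0] z0 by auto
  then have Gpos: "0 < cmod (G z0)" by (auto simp: zero_less_mult_iff)
  have region: "ball z0 (\<sigma>/2) \<subseteq> \<Omega>"
    by (rule ball_subset_region[OF z0(1) sub _ \<sigma>(2)]) (use \<sigma>(1) Gpos in linarith)
  define B where "B = cball z0 (2 * cmod (G z0))"
  have B\<Omega>: "B \<subseteq> \<Omega>"
  proof
    fix x assume "x \<in> B"
    then have "dist z0 x \<le> 2 * cmod (G z0)" by (simp add: B_def)
    also have "\<dots> < \<sigma>/2" using \<sigma>(1) Gpos by linarith
    finally have "x \<in> ball z0 (\<sigma>/2)" by simp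
    then show "x \<in> \<Omega>" using region by blast
  qed
  have inc: "cmod ((G x - x) - (G y - y)) \<le> 1/4 * cmod (x - y)" if "x \<in> B" "y \<in> B" for x y
    using G_increment(1)[of B, OF _ B\<Omega> that] by (simp add: B_def)
  have z0B: "z0 \<in> B" by (simp add: B_def)
  have "\<exists>!x\<in>B. x - G x = x"
  proof (rule Banach_fix[of B "1/4" "\<lambda>x. x - G x"])
    show "complete B" unfolding B_def by (simp add: complete_eq_closed)
    show "B \<noteq> {}" using z0B by auto
    show "(\<lambda>x. x - G x) ` B \<subseteq> B"
    proof safe
      fix x assume x: "x \<in> B"
      have "cmod (x - G x - z0) \<le> cmod ((G x - x) - (G z0 - z0)) + cmod (G z0)"
        using norm_triangle_ineq4[of "- ((G x - x) - (G z0 - z0))" "G z0"] by (simp add: algebra_simps norm_minus_commute)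
      also have "\<dots> \<le> 1/4 * cmod (x - z0) + cmod (G z0)" using inc[OF x z0B] by simp
      also have "\<dots> \<le> 2 * cmod (G z0)" 
      proof -
        have "cmod (x - z0) \<le> 2 * cmod (G z0)" using x by (simp add: B_def dist_norm norm_minus_commute)
        then show ?thesis using Gpos by linarith
      qed
      finally show "x - G x \<in> B" by (simp add: B_def dist_norm norm_minus_commute)
    qed
    show "dist (x - G x) (y - G y) \<le> 1/4 * dist x y" if "x \<in> B" "y \<in> B" for x y
      using inc[OF that] by (simp add: dist_norm norm_minus_commute algebra_simps)
  qed auto
  then obtain b where b: "b \<in> B" "G b = 0" by auto
  have "b \<in> S"
  proof (rule ccontr)
    assume "b \<notin> S"
    then have "1/2 \<le> cmod (G b) ^ 2 * cmod (W b) ^ n" using b B\<Omega> by (intro norm_G_bounds) auto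
    then show False using b by simp
  qed
  then show ?thesis using b by (intro that) (auto simp: B_def dist_norm)
qed

end

text \<open>With \<open>\<sigma> = 1 / (4 K)\<close> the poles are \<open>\<sigma>/2\<close>-separated, and \<open>|G| \<le> \<sigma>/8\<close> holds as soon as \<open>|W|\<close> exceeds a multiple of
\<open>K^2\<close>.\<close>

lemma (in large_values_region) pole_data_on_disc:
  assumes U_eq: "U = ball 0 (R + 1)" and n2: "n \<le> 2" and R: "1 \<le> R"
  shows "real (card {a. cmod a \<le> R \<and> a \<in> S}) \<le> 2048 * K ^ 2 * R ^ 2"
    and "z \<notin> S \<Longrightarrow> cmod z \<le> R \<Longrightarrow> cmod (W z) \<le> 2048 * K ^ 2 \<or>
       (\<exists>b\<in>S. cmod (z - b) \<le> 1 \<and> cmod (W z) * cmod (z - b) ^ 2 \<le> 2048 * K ^ 2)"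
proof -
  define \<sigma> where "\<sigma> = 1 / (4 * K)"
  have \<sigma>: "0 < \<sigma>" "\<sigma> \<le> 1" using K by (auto simp: \<sigma>_def field_simps)
  have K\<sigma>: "2 * \<sigma> ^ 2 * (2 * K) ^ n \<le> 1"
  proof -
    have "(2 * K) ^ n \<le> (2 * K) ^ 2" using K n2 by (intro power_increasing) auto
    then have "2 * \<sigma> ^ 2 * (2 * K) ^ n \<le> 2 * \<sigma> ^ 2 * (2 * K) ^ 2" by (intro mult_left_mono) auto
    also have "\<dots> \<le> 1" using K by (simp add: \<sigma>_def power2_eq_square)
    finally show ?thesis .
  qed
  have sub: "ball a (\<sigma>/2) \<subseteq> U" if "cmod a \<le> R" for a
  proof
    fix x assume "x \<in> ball a (\<sigma>/2)"
    then have "cmod (a - x) < 1" using \<sigma> by (simp add: dist_norm)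
    then show "x \<in> U" unfolding U_eq using that norm_triangle_ineq4[of a "a - x"] by simp
  qed
  have inU: "a \<in> U" if "cmod a \<le> R" for a using that by (simp add: U_eq)
  have "real (card {a. cmod a \<le> R \<and> a \<in> S}) \<le> (4 * R / (\<sigma>/2) + 3) ^ 2"
  proof (rule card_separated_le)
    fix x y assume "x \<in> {a. cmod a \<le> R \<and> a \<in> S}" "y \<in> {a. cmod a \<le> R \<and> a \<in> S}" "cmod (x - y) < \<sigma>/2"
    then show "x = y"
      using poles_separated[of x "\<sigma>/2" \<sigma> y] sub[of x] inU[of x] \<sigma> K\<sigma> by auto
  qed (use \<sigma> R in auto)
  also have "\<dots> \<le> (35 * (K * R)) ^ 2"
  proof (rule power_mono)
    have "1 * 1 \<le> K * R" using K R by (intro mult_mono) auto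
    moreover have "4 * R / (\<sigma>/2) = 32 * (K * R)" using K by (simp add: \<sigma>_def)
    ultimately show "4 * R / (\<sigma>/2) + 3 \<le> 35 * (K * R)" by linarith
  qed (use R \<sigma> in auto)
  also have "\<dots> \<le> 2048 * K ^ 2 * R ^ 2" by (simp add: power_mult_distrib)
  finally show "real (card {a. cmod a \<le> R \<and> a \<in> S}) \<le> 2048 * K ^ 2 * R ^ 2" .
  show "cmod (W z) \<le> 2048 * K ^ 2 \<or>
       (\<exists>b\<in>S. cmod (z - b) \<le> 1 \<and> cmod (W z) * cmod (z - b) ^ 2 \<le> 2048 * K ^ 2)"
    if z: "z \<notin> S" "cmod z \<le> R"
  proof (cases "cmod (W z) \<le> 2048 * K ^ 2")
    case False
    have K2: "K \<le> K ^ 2" "1 \<le> K ^ 2" using K by (simp_all add: self_le_power)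
    then have big: "K < cmod (W z)" "1 \<le> cmod (W z)" using False by linarith+
    have z\<Omega>: "z \<in> \<Omega>" using inU[OF z(2)] big by (simp add: \<Omega>_def)
    have upper: "cmod (G z) ^ 2 * cmod (W z) ^ n \<le> 2" using norm_G_bounds(2)[of z] z\<Omega> z(1) by simp
    have "cmod (W z) ^ 1 \<le> cmod (W z) ^ n" using n big by (intro power_increasing) auto
    then have "cmod (G z) ^ 2 * cmod (W z) \<le> cmod (G z) ^ 2 * cmod (W z) ^ n" by (intro mult_left_mono) auto
    then have GW: "cmod (G z) ^ 2 * cmod (W z) \<le> 2" using upper by linarith
    have "cmod (G z) ^ 2 * (2048 * K ^ 2) \<le> cmod (G z) ^ 2 * cmod (W z)" using False by (intro mult_left_mono) auto
    then have "cmod (G z) ^ 2 * (2048 * K ^ 2) \<le> 2" using GW by linarith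
    then have "cmod (G z) ^ 2 \<le> (\<sigma>/8) ^ 2" using K by (simp add: \<sigma>_def field_simps power2_eq_square)
    then have G\<sigma>: "cmod (G z) \<le> \<sigma>/8" by (rule power2_le_imp_le) (use \<sigma> in auto)
    obtain b where b: "b \<in> S" "cmod (z - b) \<le> 2 * cmod (G z)"
      using large_value_near_pole[OF z\<Omega> z(1) sub[OF z(2)] G\<sigma> K\<sigma>] by blast
    have "cmod (z - b) \<le> 1" using b(2) G\<sigma> \<sigma> by linarith
    moreover have "cmod (W z) * cmod (z - b) ^ 2 \<le> 2048 * K ^ 2"
    proof -
      have "cmod (z - b) ^ 2 \<le> (2 * cmod (G z)) ^ 2" using b(2) by (intro power_mono) auto
      then have "cmod (W z) * cmod (z - b) ^ 2 \<le> cmod (W z) * (4 * cmod (G z) ^ 2)"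
        by (intro mult_left_mono) (auto simp: power_mult_distrib)
      also have "\<dots> \<le> 8" using GW by (simp add: mult.commute mult.left_commute)
      also have "\<dots> \<le> 2048 * K ^ 2" using K2 by linarith
      finally show ?thesis .
    qed
    ultimately show ?thesis using b(1) by blast
  qed simp
qed

text \<open>On the disc of radius \<open>R + 1\<close> the inhomogeneity is at most exponential in \<open>R\<close>; so is the threshold \<open>K\<close> above
which \<open>W\<close> counts as large, and the data of \<open>pole_data_on_disc\<close> are polynomial in \<open>K\<close> and \<open>R\<close>.\<close>

lemma (in analytic_off_poles) exponentially_tame_if_dominant_balance:
  fixes D A \<mu> :: real and m n :: nat
  assumes mn: "(m = 1 \<and> n = 2) \<or> (m = 2 \<and> n = 1)" and D: "1 \<le> D" and A: "1 \<le> A" and \<mu>: "0 \<le> \<mu>"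
    and H1: "\<And>z. z \<notin> S \<Longrightarrow> 1 \<le> cmod (W z) \<Longrightarrow>
       cmod (deriv W z ^ 2 - of_nat m ^ 2 * W z ^ (n + 2))
         \<le> D * (cmod (W z) * cmod (deriv W z) + cmod (W z) ^ 2) + A * exp (\<mu> * cmod z)"
    and H2: "\<And>z. z \<notin> S \<Longrightarrow> 1 \<le> cmod (W z) \<Longrightarrow>
       cmod (deriv (deriv W) z - of_nat (m * (m + 1)) * W z ^ (n + 1)) \<le> D * (cmod (W z) + cmod (deriv W z))"
    and ord: "\<And>a. a \<in> S \<Longrightarrow> -2 \<le> zorder W a"
  shows "exponentially_tame W"
proof -
  define Q where "Q = 2048 * (10000000 * D ^ 2 * A) ^ 2"
  define C where "C = ln Q + 4 * \<mu> + 2"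
  have Q: "1 \<le> Q"
  proof -
    have "1 * 1 \<le> D ^ 2 * A" using D A by (intro mult_mono) auto
    then have "1 \<le> (10000000 * (D ^ 2 * A)) ^ 2" by (intro one_le_power) linarith
    then show ?thesis unfolding Q_def by (simp add: mult.assoc)
  qed
  have C: "0 \<le> C" unfolding C_def using Q \<mu> by simp
  have main: "real (card {a. cmod a \<le> R \<and> a \<in> S}) \<le> exp (C * R) \<and>
     (\<forall>z. z \<notin> S \<longrightarrow> cmod z \<le> R \<longrightarrow> cmod (W z) \<le> exp (C * R) \<or>
       (\<exists>b\<in>S. cmod (z - b) \<le> 1 \<and> cmod (W z) * cmod (z - b) ^ 2 \<le> exp (C * R)))" if R: "1 \<le> R" for R
  proof -
    define L where "L = A * exp (\<mu> * (R + 1))"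
    define K where "K = 10000000 * D ^ 2 * L"
    have "1 \<le> exp (\<mu> * (R + 1))" using \<mu> R by simp
    then have L: "1 \<le> L" unfolding L_def using A mult_mono[of 1 A 1 "exp (\<mu> * (R + 1))"] by simp
    have "1 * 1 \<le> D ^ 2 * L" using D L by (intro mult_mono) auto
    then have K: "1 \<le> K" unfolding K_def by linarith
    have n1: "1 \<le> n" and m12: "m = 1 \<or> m = 2" using mn by auto
    have H1': "cmod (deriv W z ^ 2 - of_nat m ^ 2 * W z ^ (n + 2))
         \<le> D * (cmod (W z) * cmod (deriv W z) + cmod (W z) ^ 2) + L" and nS: "z \<notin> S" and W1: "1 \<le> cmod (W z)"
      if z: "z \<in> ball 0 (R + 1) - S" "K \<le> cmod (W z)" for z
    proof -
      show nS: "z \<notin> S" and W1: "1 \<le> cmod (W z)" using z K by auto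
      have "A * exp (\<mu> * cmod z) \<le> L" unfolding L_def using z \<mu> A by (intro mult_left_mono) (auto intro: mult_left_mono)
      then show "cmod (deriv W z ^ 2 - of_nat m ^ 2 * W z ^ (n + 2))
         \<le> D * (cmod (W z) * cmod (deriv W z) + cmod (W z) ^ 2) + L"
        using H1[OF nS W1] by linarith
    qed
    note balance = dominant_balance[OF n1 m12 D L _ H1' H2[OF nS W1], folded K_def]
    interpret large_values_region W S m n "ball 0 (R + 1)" K
      by (unfold_locales; (fact n1 | fact K | (rule open_ball convex_ball bounded_ball) | (rule balance; assumption)))
    have n2: "n \<le> 2" using mn by auto
    have exps: "2048 * K ^ 2 * R ^ 2 \<le> exp (C * R)"
    proof -
      have "2048 * K ^ 2 = Q * exp (2 * (\<mu> * (R + 1)))"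
        unfolding K_def L_def Q_def exp_double by (simp add: power_mult_distrib)
      moreover have "Q \<le> exp (ln Q * R)" using Q R by (rule le_exp_ln_mult)
      moreover have "exp (2 * (\<mu> * (R + 1))) \<le> exp (4 * \<mu> * R)"
      proof -
        have "\<mu> * 1 \<le> \<mu> * R" using \<mu> R by (intro mult_left_mono) auto
        then show ?thesis by (simp add: algebra_simps)
      qed
      moreover have "R ^ 2 \<le> exp (2 * R)"
      proof -
        have "R \<le> exp R" using exp_ge_add_one_self[of R] by linarith
        then have "R ^ 2 \<le> exp R ^ 2" using R by (intro power_mono) auto
        then show ?thesis by (simp add: exp_double)
      qed
      ultimately have "2048 * K ^ 2 * R ^ 2 \<le> exp (ln Q * R) * exp (4 * \<mu> * R) * exp (2 * R)"
        using Q R by (simp only:) (intro mult_mono; simp)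
      also have "\<dots> = exp (C * R)" by (simp add: C_def algebra_simps flip: exp_add)
      finally show ?thesis .
    qed
    have "1 \<le> R ^ 2" using R by simp
    then have "2048 * K ^ 2 * 1 \<le> 2048 * K ^ 2 * R ^ 2" by (intro mult_left_mono) auto
    then have K2: "2048 * K ^ 2 \<le> exp (C * R)" using exps by linarith
    show ?thesis
    proof (intro conjI allI impI)
      show "real (card {a. cmod a \<le> R \<and> a \<in> S}) \<le> exp (C * R)"
        using pole_data_on_disc(1)[OF refl n2 R] exps by linarith
      fix z assume "z \<notin> S" "cmod z \<le> R"
      from pole_data_on_disc(2)[OF refl n2 R this]
      show "cmod (W z) \<le> exp (C * R) \<or> (\<exists>b\<in>S. cmod (z - b) \<le> 1 \<and> cmod (W z) * cmod (z - b) ^ 2 \<le> exp (C * R))"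
        using K2 by (meson order_trans)
    qed
  qed
  have an: "W analytic_on {z} \<Longrightarrow> z \<notin> S" for z using poles analytic_at_imp_no_pole by blast
  show ?thesis
    unfolding exponentially_tame_def is_pole_iff using ord C main an by blast
qed

section \<open>Energies that grow exponentially\<close>

definition exp_bounded :: "(real \<Rightarrow> real) \<Rightarrow> bool" where
  "exp_bounded f \<longleftrightarrow> (\<exists>A \<mu>. 0 \<le> A \<and> 0 \<le> \<mu> \<and> (\<forall>r\<ge>0. \<bar>f r\<bar> \<le> A * exp (\<mu> * r)))"

lemma exp_boundedI: "0 \<le> A \<Longrightarrow> 0 \<le> \<mu> \<Longrightarrow> (\<And>r. 0 \<le> r \<Longrightarrow> \<bar>f r\<bar> \<le> A * exp (\<mu> * r)) \<Longrightarrow> exp_bounded f"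
  unfolding exp_bounded_def by blast

lemma exp_bounded_const: "exp_bounded (\<lambda>_. k)"
  by (rule exp_boundedI[of "\<bar>k\<bar>" 0]) auto

lemma exp_bounded_id: "exp_bounded (\<lambda>r. r)"
proof (rule exp_boundedI[of 1 1])
  fix r :: real assume "0 \<le> r"
  moreover have "r \<le> exp r" using exp_ge_add_one_self[of r] by linarith
  ultimately show "\<bar>r\<bar> \<le> 1 * exp (1 * r)" by simp
qed auto

lemma exp_bounded_exp: "exp_bounded (\<lambda>r. exp (k * r))"
  by (rule exp_boundedI[of 1 "\<bar>k\<bar>"]) (auto intro: mult_right_mono)

lemma exp_bounded_add:
  assumes "exp_bounded f" "exp_bounded g" shows "exp_bounded (\<lambda>r. f r + g r)"
proof -
  obtain A \<mu> where f: "0 \<le> A" "0 \<le> \<mu>" "\<And>r. 0 \<le> r \<Longrightarrow> \<bar>f r\<bar> \<le> A * exp (\<mu> * r)"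
    using assms(1) unfolding exp_bounded_def by blast
  obtain B \<nu> where g: "0 \<le> B" "0 \<le> \<nu>" "\<And>r. 0 \<le> r \<Longrightarrow> \<bar>g r\<bar> \<le> B * exp (\<nu> * r)"
    using assms(2) unfolding exp_bounded_def by blast
  show ?thesis
  proof (rule exp_boundedI[of "A + B" "\<mu> + \<nu>"])
    fix r :: real assume r: "0 \<le> r"
    have "A * exp (\<mu> * r) \<le> A * exp ((\<mu> + \<nu>) * r)" "B * exp (\<nu> * r) \<le> B * exp ((\<mu> + \<nu>) * r)"
      using f(1,2) g(1,2) r by (auto intro!: mult_left_mono mult_right_mono)
    then show "\<bar>f r + g r\<bar> \<le> (A + B) * exp ((\<mu> + \<nu>) * r)"
      using f(3)[OF r] g(3)[OF r] unfolding distrib_right by linarith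
  qed (use f g in auto)
qed

lemma exp_bounded_mult:
  assumes "exp_bounded f" "exp_bounded g" shows "exp_bounded (\<lambda>r. f r * g r)"
proof -
  obtain A \<mu> where f: "0 \<le> A" "0 \<le> \<mu>" "\<And>r. 0 \<le> r \<Longrightarrow> \<bar>f r\<bar> \<le> A * exp (\<mu> * r)"
    using assms(1) unfolding exp_bounded_def by blast
  obtain B \<nu> where g: "0 \<le> B" "0 \<le> \<nu>" "\<And>r. 0 \<le> r \<Longrightarrow> \<bar>g r\<bar> \<le> B * exp (\<nu> * r)"
    using assms(2) unfolding exp_bounded_def by blast
  show ?thesis
  proof (rule exp_boundedI[of "A * B" "\<mu> + \<nu>"])
    fix r :: real assume r: "0 \<le> r"
    have "\<bar>f r\<bar> * \<bar>g r\<bar> \<le> (A * exp (\<mu> * r)) * (B * exp (\<nu> * r))"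
      using f g r by (intro mult_mono) auto
    then show "\<bar>f r * g r\<bar> \<le> (A * B) * exp ((\<mu> + \<nu>) * r)"
      by (simp add: abs_mult algebra_simps exp_add)
  qed (use f g in auto)
qed

lemma exp_bounded_shift:
  assumes "exp_bounded f" shows "exp_bounded (\<lambda>r. f (r + 1))"
proof -
  obtain A \<mu> where f: "0 \<le> A" "0 \<le> \<mu>" "\<And>r. 0 \<le> r \<Longrightarrow> \<bar>f r\<bar> \<le> A * exp (\<mu> * r)"
    using assms(1) unfolding exp_bounded_def by blast
  show ?thesis
  proof (rule exp_boundedI[of "A * exp \<mu>" \<mu>])
    fix r :: real assume "0 \<le> r"
    then show "\<bar>f (r + 1)\<bar> \<le> A * exp \<mu> * exp (\<mu> * r)"
      using f(3)[of "r + 1"] by (simp add: algebra_simps exp_add)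
  qed (use f in auto)
qed

lemma exp_bounded_mono:
  assumes "exp_bounded g" "\<And>r. 0 \<le> r \<Longrightarrow> \<bar>f r\<bar> \<le> g r" shows "exp_bounded f"
  using assms unfolding exp_bounded_def by (meson abs_ge_self order_trans)

lemmas exp_bounded_intros = exp_bounded_const exp_bounded_id exp_bounded_exp exp_bounded_add exp_bounded_mult

lemma lower_order_terms_le:
  fixes x y b0 b1 b2 b3 :: complex
  assumes "1 \<le> cmod x"
  shows "cmod (b0 * x * y + b1 * x ^ 2 + b2 * y + b3 * x)
     \<le> (cmod b0 + cmod b1 + cmod b2 + cmod b3) * (cmod x * cmod y + cmod x ^ 2)"
proof -
  let ?s = "cmod x * cmod y + cmod x ^ 2"
  have xy: "1 * cmod y \<le> cmod x * cmod y" using assms by (intro mult_right_mono) auto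
  have xx: "1 * cmod x \<le> cmod x * cmod x" using assms by (intro mult_right_mono) auto
  have "cmod (b0 * x * y + b1 * x ^ 2 + b2 * y + b3 * x)
     \<le> cmod (b0 * x * y) + cmod (b1 * x ^ 2) + cmod (b2 * y) + cmod (b3 * x)"
    by (intro norm_triangle_le add_mono order_refl)
  also have "\<dots> = cmod b0 * (cmod x * cmod y) + cmod b1 * cmod x ^ 2 + cmod b2 * cmod y + cmod b3 * cmod x"
    by (simp add: norm_mult norm_power)
  also have "\<dots> \<le> cmod b0 * ?s + cmod b1 * ?s + cmod b2 * ?s + cmod b3 * ?s"
    using xy xx by (intro add_mono mult_left_mono) (auto simp: power2_eq_square intro: add_increasing add_increasing2)
  finally show ?thesis by (simp add: algebra_simps)
qed

context analytic_off_poles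
begin

text \<open>The equation can be solved on the complement of the poles, which is connected: \<open>exp(\<kappa> z) V\<close> differs by a constant
from an entire primitive of \<open>exp(\<kappa> z) q\<close>. Hence \<open>V\<close> has no poles, and its growth is controlled by that of \<open>q\<close>.\<close>

lemma linear_first_order_extension:
  assumes V: "\<And>z. z \<notin> S \<Longrightarrow> (V has_field_derivative - \<kappa> * V z + q z) (at z)"
    and q: "q holomorphic_on UNIV"
  obtains v C where "v holomorphic_on UNIV" "\<And>z. z \<notin> S \<Longrightarrow> V z = v z" "0 \<le> C"
    "\<And>r M z. cmod z \<le> r \<Longrightarrow> 0 \<le> M \<Longrightarrow> (\<And>x. cmod x \<le> r \<Longrightarrow> cmod (q x) \<le> M) \<Longrightarrow>
       cmod (v z) \<le> exp (cmod \<kappa> * r) * (C + r * (exp (cmod \<kappa> * r) * M))"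
proof -
  have "(\<lambda>z. exp (\<kappa> * z) * q z) holomorphic_on UNIV" by (intro holomorphic_intros q)
  then obtain F where "\<And>z. z \<in> UNIV \<Longrightarrow> (F has_field_derivative exp (\<kappa> * z) * q z) (at z within UNIV)"
    using holomorphic_convex_primitive'[OF convex_UNIV open_UNIV, of "\<lambda>z. exp (\<kappa> * z) * q z"] by blast
  then have F: "(F has_field_derivative exp (\<kappa> * z) * q z) (at z within A)" for z A
    by (simp add: has_field_derivative_at_within)
  have const: "\<exists>k. \<forall>z\<in>- S. exp (\<kappa> * z) * V z - F z = k"
  proof -
    have "((\<lambda>z. exp (\<kappa> * z) * V z - F z) has_derivative (\<lambda>_. 0)) (at z)" if "z \<in> - S" for z
    proof -
      have "((\<lambda>z. exp (\<kappa> * z) * V z - F z) has_field_derivative 0) (at z)"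
        using that by (auto intro!: derivative_eq_intros V F simp: algebra_simps)
      moreover have "(*) (0::complex) = (\<lambda>_. 0)" by auto
      ultimately show ?thesis by (simp add: has_field_derivative_def)
    qed
    then have eq: "exp (\<kappa> * x) * V x - F x = exp (\<kappa> * y) * V y - F y" if "x \<in> - S" "y \<in> - S" for x y
      using has_derivative_zero_unique_connected[OF open_compl connected_compl _ that] by blast
    show ?thesis
    proof (cases "- S = {}")
      case False
      then obtain y where "y \<in> - S" by blast
      then show ?thesis using eq by blast
    qed blast
  qed
  then obtain k where k: "\<And>z. z \<notin> S \<Longrightarrow> exp (\<kappa> * z) * V z - F z = k" by blast
  define v where "v z = exp (- (\<kappa> * z)) * (k + F z)" for z
  show ?thesis
  proof (rule that[of v "cmod (k + F 0)"])
    have "F holomorphic_on UNIV" using F unfolding holomorphic_on_def field_differentiable_def by blast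
    then show "v holomorphic_on UNIV" unfolding v_def[abs_def] by (intro holomorphic_intros)
    show "V z = v z" if "z \<notin> S" for z
    proof -
      have "k + F z = exp (\<kappa> * z) * V z" using k[OF that] by (simp add: algebra_simps)
      then have "v z = (exp (- (\<kappa> * z)) * exp (\<kappa> * z)) * V z" by (simp add: v_def)
      then show ?thesis by (simp flip: exp_add)
    qed
    fix r M z assume z: "cmod z \<le> r" and M: "0 \<le> M" "\<And>x. cmod x \<le> r \<Longrightarrow> cmod (q x) \<le> M"
    have r: "0 \<le> r" using z norm_ge_zero order_trans by blast
    have e: "cmod (exp w) \<le> exp (cmod \<kappa> * r)" if "cmod w \<le> cmod \<kappa> * r" for w
      using that norm_exp[of w] by (meson exp_le_cancel_iff order_trans)
    have \<kappa>x: "cmod (\<kappa> * x) \<le> cmod \<kappa> * r" if "cmod x \<le> r" for x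
      using that by (simp add: norm_mult mult_left_mono)
    have "cmod (F z - F 0) \<le> (exp (cmod \<kappa> * r) * M) * cmod (z - 0)"
    proof (rule field_differentiable_bound[where S = "cball 0 r" and f' = "\<lambda>x. exp (\<kappa> * x) * q x"])
      fix x :: complex assume "x \<in> cball 0 r"
      then show "cmod (exp (\<kappa> * x) * q x) \<le> exp (cmod \<kappa> * r) * M"
        unfolding norm_mult[of "exp (\<kappa> * x)"] by (intro mult_mono e \<kappa>x M) auto
    qed (use F z r in auto)
    also have "\<dots> \<le> r * (exp (cmod \<kappa> * r) * M)" 
      unfolding mult.commute[of r] using z M(1) by (intro mult_left_mono) auto
    finally have "cmod (k + F z) \<le> cmod (k + F 0) + r * (exp (cmod \<kappa> * r) * M)"
      using norm_triangle_ineq[of "k + F 0" "F z - F 0"] by simp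
    then show "cmod (v z) \<le> exp (cmod \<kappa> * r) * (cmod (k + F 0) + r * (exp (cmod \<kappa> * r) * M))"
      unfolding v_def norm_mult using \<kappa>x[OF z] by (intro mult_mono e) auto
  qed simp
qed

text \<open>Common end of the quadratic and the cubic case: \<open>v\<close> is the energy, and the terms with \<open>b0, \<dots>, b3\<close> are its corrections of lower
weight, where \<open>W\<close> has weight \<open>m\<close> and \<open>W'\<close> has weight \<open>m + 1\<close>.\<close>

lemma exponentially_tame_if_energy_bounded:
  assumes mn: "(m = 1 \<and> n = 2) \<or> (m = 2 \<and> n = 1)"
    and ode: "\<And>z. z \<notin> S \<Longrightarrow> deriv (deriv W) z = of_nat (m * (m + 1)) * W z ^ (n + 1) + d0 * deriv W z + d1 * W z + d2"
    and energy: "\<And>z. z \<notin> S \<Longrightarrow> deriv W z ^ 2 - of_nat m ^ 2 * W z ^ (n + 2)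
        = v z - (b0 * W z * deriv W z + b1 * W z ^ 2 + b2 * deriv W z + b3 * W z)"
    and bound: "exp_bounded B" "\<And>z. z \<notin> S \<Longrightarrow> cmod (v z) \<le> B (cmod z)"
    and ord: "\<And>a. a \<in> S \<Longrightarrow> -2 \<le> zorder W a"
  shows "exponentially_tame W"
proof -
  obtain A \<mu> where A: "0 \<le> A" "0 \<le> \<mu>" "\<And>r. 0 \<le> r \<Longrightarrow> \<bar>B r\<bar> \<le> A * exp (\<mu> * r)"
    using bound(1) unfolding exp_bounded_def by blast
  define D where "D = 1 + (cmod b0 + cmod b1 + cmod b2 + cmod b3) + (cmod d0 + cmod d1 + cmod d2)"
  show ?thesis
  proof (rule exponentially_tame_if_dominant_balance[OF mn, of D "A + 1" \<mu>])
    fix z assume z: "z \<notin> S" "1 \<le> cmod (W z)"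
    have "cmod (v z) \<le> A * exp (\<mu> * cmod z)"
      using bound(2)[OF z(1)] A(3)[of "cmod z"] by (meson abs_ge_self norm_ge_zero order_trans)
    also have "\<dots> \<le> (A + 1) * exp (\<mu> * cmod z)" by (intro mult_right_mono) auto
    finally have v: "cmod (v z) \<le> (A + 1) * exp (\<mu> * cmod z)" .
    have "(cmod b0 + cmod b1 + cmod b2 + cmod b3) * (cmod (W z) * cmod (deriv W z) + cmod (W z) ^ 2)
      \<le> D * (cmod (W z) * cmod (deriv W z) + cmod (W z) ^ 2)"
      unfolding D_def by (intro mult_right_mono) auto
    then show "cmod (deriv W z ^ 2 - of_nat m ^ 2 * W z ^ (n + 2))
         \<le> D * (cmod (W z) * cmod (deriv W z) + cmod (W z) ^ 2) + (A + 1) * exp (\<mu> * cmod z)"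
      unfolding energy[OF z(1)]
      using v lower_order_terms_le[OF z(2), of b0 "deriv W z" b1 b2 b3]
        norm_triangle_ineq4[of "v z" "b0 * W z * deriv W z + b1 * W z ^ 2 + b2 * deriv W z + b3 * W z"]
      by linarith
    have "deriv (deriv W) z - of_nat (m * (m + 1)) * W z ^ (n + 1) = d0 * deriv W z + d1 * W z + d2"
      unfolding ode[OF z(1)] by (simp only: add.assoc add_diff_cancel_left')
    then have "cmod (deriv (deriv W) z - of_nat (m * (m + 1)) * W z ^ (n + 1))
       \<le> cmod (d0 * deriv W z) + cmod (d1 * W z) + cmod d2"
      by (simp only:) (intro norm_triangle_le add_mono order_refl)
    also have "\<dots> \<le> cmod d0 * (cmod (W z) + cmod (deriv W z)) + cmod d1 * (cmod (W z) + cmod (deriv W z))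
       + cmod d2 * (cmod (W z) + cmod (deriv W z))"
    proof (intro add_mono)
      have "1 \<le> cmod (W z) + cmod (deriv W z)" using z(2) by (simp add: add_increasing2)
      then show "cmod d2 \<le> cmod d2 * (cmod (W z) + cmod (deriv W z))"
        using mult_left_mono[of 1 _ "cmod d2"] by simp
    qed (auto simp: norm_mult intro: mult_left_mono)
    also have "\<dots> = (cmod d0 + cmod d1 + cmod d2) * (cmod (W z) + cmod (deriv W z))" by (simp add: algebra_simps)
    also have "\<dots> \<le> D * (cmod (W z) + cmod (deriv W z))"
      unfolding D_def by (intro mult_right_mono) auto
    finally show "cmod (deriv (deriv W) z - of_nat (m * (m + 1)) * W z ^ (n + 1)) \<le> D * (cmod (W z) + cmod (deriv W z))" .
  qed (use A ord in \<open>auto simp: D_def\<close>)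
qed

end

text \<open>The coefficients of \<open>V\<close> are chosen successively such that \<open>V' + (6/5) c V\<close> has no terms in \<open>W'^2\<close>, \<open>W^3\<close>, \<open>W W'\<close>,
\<open>W^2\<close> and \<open>W'\<close>. What remains is \<open>B W\<close> plus a constant, and the residue condition at a pole gives \<open>c B = 0\<close>. The
abbreviation \<open>e = c / 5\<close> keeps the coefficients integral.\<close>

lemma (in autonomous_solution) exponentially_tame_quadratic:
  assumes P: "P = [:p0, 0, -6:]" and ne: "S \<noteq> {}"
  shows "exponentially_tame W"
proof -
  define e where "e = c / 5"
  have c: "c = 5 * e" by (simp add: e_def)
  have W'': "deriv (deriv W) z = 6 * W z ^ 2 - 5 * e * deriv W z - p0" if "z \<notin> S" for z
  proof -
    have "deriv (deriv W) z = 6 * W z ^ 2 - 5 * e * deriv W z - p0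
       + (deriv (deriv W) z + c * deriv W z + poly P (W z))"
      by (simp add: P c algebra_simps power2_eq_square)
    then show ?thesis using ode[OF that] by simp
  qed
  define V where "V z = deriv W z ^ 2 - 4 * W z ^ 3 + 4 * e * W z * deriv W z - 2 * e ^ 2 * W z ^ 2
      + 2 * e ^ 3 * deriv W z + (2 * p0 - 2 * e ^ 4) * W z" for z
  define B where "B = e * (8 * p0 - 12 * e ^ 4)"
  have V: "(V has_field_derivative - (6 * e) * V z + (B * W z - 2 * e ^ 3 * p0)) (at z)" if "z \<notin> S" for z
  proof -
    have "(V has_field_derivative 2 * deriv W z * deriv (deriv W) z - 12 * W z ^ 2 * deriv W z
       + 4 * e * (deriv W z * deriv W z + W z * deriv (deriv W) z) - 4 * e ^ 2 * W z * deriv W z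
       + 2 * e ^ 3 * deriv (deriv W) z + (2 * p0 - 2 * e ^ 4) * deriv W z) (at z)"
      (is "(_ has_field_derivative ?D) _")
      unfolding V_def[abs_def]
      by (auto intro!: derivative_eq_intros has_deriv[OF that] has_deriv2[OF that] simp: algebra_simps power2_eq_square)
    also have "?D = - (6 * e) * V z + (B * W z - 2 * e ^ 3 * p0)"
      unfolding V_def B_def W''[OF that] by algebra
    finally show ?thesis .
  qed
  have B0: "B = 0"
  proof -
    obtain a where a: "a \<in> S" using ne by blast
    obtain r \<phi> where \<phi>: "0 < r" "ball a r - {a} \<subseteq> - S" "\<phi> holomorphic_on ball a r"
      "\<And>z. z \<in> ball a r - {a} \<Longrightarrow> W z = \<phi> z / (z - a) ^ 2" "\<phi> a = 1" "deriv \<phi> a = - c / 5"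
      using double_pole_coefficients[OF a P] by blast
    define \<psi> where "\<psi> z = B * \<phi> z - 2 * e ^ 3 * p0 * (z - a) ^ 2" for z
    have "deriv \<psi> a + (6 * e) * \<psi> a = 0"
    proof (rule no_logarithmic_term[OF _ \<phi>(1)])
      show "\<psi> holomorphic_on ball a r" unfolding \<psi>_def[abs_def] by (intro holomorphic_intros \<phi>(3))
      fix z assume z: "z \<in> ball a r - {a}"
      then have "z - a \<noteq> 0" by auto
      then have "B * W z - 2 * e ^ 3 * p0 = \<psi> z / (z - a) ^ 2"
        unfolding \<phi>(4)[OF z] \<psi>_def by (simp add: diff_divide_distrib)
      then show "(V has_field_derivative - (6 * e) * V z + \<psi> z / (z - a) ^ 2) (at z)"
        using V[of z] z \<phi>(2) by auto
    qed
    moreover have "deriv \<psi> a = - B * e"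
    proof (rule DERIV_imp_deriv)
      have "(\<phi> has_field_derivative - e) (at a)"
        using holomorphic_derivI[OF \<phi>(3) open_ball, of a] \<phi>(1,6) by (simp add: c)
      then show "(\<psi> has_field_derivative - B * e) (at a)"
        unfolding \<psi>_def[abs_def] by (auto intro!: derivative_eq_intros)
    qed
    moreover have "\<psi> a = B" by (simp add: \<psi>_def \<phi>(5))
    ultimately have "5 * e * B = 0" by (simp add: algebra_simps)
    then show ?thesis by (auto simp: B_def)
  qed
  obtain v C where v: "v holomorphic_on UNIV" "\<And>z. z \<notin> S \<Longrightarrow> V z = v z" "0 \<le> C"
    "\<And>r M z. cmod z \<le> r \<Longrightarrow> 0 \<le> M \<Longrightarrow> (\<And>x. cmod x \<le> r \<Longrightarrow> cmod ((- 2 * e ^ 3 * p0)) \<le> M) \<Longrightarrow>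
       cmod (v z) \<le> exp (cmod (6 * e) * r) * (C + r * (exp (cmod (6 * e) * r) * M))"
    using linear_first_order_extension[of V "6 * e" "\<lambda>_. - 2 * e ^ 3 * p0"] V unfolding B0 by auto
  define M where "M = cmod (- 2 * e ^ 3 * p0)"
  show ?thesis
  proof (rule exponentially_tame_if_energy_bounded[where m = 2 and n = 1 and v = v
        and ?d0.0 = "- 5 * e" and ?d1.0 = 0 and ?d2.0 = "- p0" and ?b0.0 = "4 * e" and ?b1.0 = "- 2 * e ^ 2"
        and ?b2.0 = "2 * e ^ 3" and ?b3.0 = "2 * p0 - 2 * e ^ 4"])
    show "exp_bounded (\<lambda>r. exp (cmod (6 * e) * r) * (C + r * (exp (cmod (6 * e) * r) * M)))"
      by (intro exp_bounded_intros)
    show "cmod (v z) \<le> exp (cmod (6 * e) * cmod z) * (C + cmod z * (exp (cmod (6 * e) * cmod z) * M))" for z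
      by (rule v(4)) (auto simp: M_def)
    show "deriv (deriv W) z = of_nat (2 * (2 + 1)) * W z ^ (1 + 1) + - 5 * e * deriv W z + 0 * W z + - p0" if "z \<notin> S" for z
      unfolding W''[OF that] by (simp add: power2_eq_square)
    show "deriv W z ^ 2 - of_nat 2 ^ 2 * W z ^ (1 + 2) = v z - (4 * e * W z * deriv W z + - 2 * e ^ 2 * W z ^ 2 +
            2 * e ^ 3 * deriv W z + (2 * p0 - 2 * e ^ 4) * W z)" if "z \<notin> S" for z
      unfolding v(2)[OF that, symmetric] V_def by (simp add: power3_eq_cube)
    show "-2 \<le> zorder W a" if "a \<in> S" for a using pole_order_cases[OF that] by auto
  qed simp
qed

lemma divide_double_zero:
  fixes N :: "complex \<Rightarrow> complex"
  assumes N: "N holomorphic_on ball a r" and r: "0 < r" and 0: "N a = 0" "deriv N a = 0"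
  obtains k where "k holomorphic_on ball a r" "\<And>z. z \<in> ball a r - {a} \<Longrightarrow> N z / (z - a) ^ 2 = k z"
proof -
  have int: "a \<in> interior (ball a r)" using r by simp
  define g where "g z = (if z = a then deriv N a else (N z - N a) / (z - a))" for z
  have g: "g holomorphic_on ball a r" unfolding g_def[abs_def] by (rule pole_lemma[OF N int])
  define k where "k z = (if z = a then deriv g a else (g z - g a) / (z - a))" for z
  have k: "k holomorphic_on ball a r" unfolding k_def[abs_def] by (rule pole_lemma[OF g int])
  show ?thesis
    by (rule that[OF k]) (auto simp: k_def g_def 0 power2_eq_square)
qed

text \<open>Removable singularities at all points of \<open>S\<close> at once.\<close>

lemma (in analytic_off_poles) entire_extension:
  assumes h: "h holomorphic_on - S"
    and ext: "\<And>a. a \<in> S \<Longrightarrow> \<exists>r k. 0 < r \<and> k holomorphic_on ball a r \<and> (\<forall>z\<in>ball a r - {a}. h z = k z)"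
  obtains g where "g holomorphic_on UNIV" "\<And>z. z \<notin> S \<Longrightarrow> g z = h z"
proof
  define g where "g z = (if z \<in> S then Lim (at z) h else h z)" for z
  show "g z = h z" if "z \<notin> S" for z using that by (simp add: g_def)
  have "g field_differentiable at z" for z
  proof (cases "z \<in> S")
    case False
    have "h field_differentiable at z" using h open_compl False holomorphic_on_imp_differentiable_at by auto
    then obtain D where "(h has_field_derivative D) (at z)" by (auto simp: field_differentiable_def)
    then have "(g has_field_derivative D) (at z)"
      by (rule has_field_derivative_transform_within_open[OF _ open_compl]) (use False in \<open>auto simp: g_def\<close>)
    then show ?thesis by (auto simp: field_differentiable_def)
  next
    case True
    obtain r k where r: "0 < r" and k: "k holomorphic_on ball z r" and hk: "\<And>x. x \<in> ball z r - {z} \<Longrightarrow> h x = k x"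
      using ext[OF True] by blast
    obtain s where s: "0 < s" "ball z s - {z} \<subseteq> - S" by (rule punctured_ball_avoiding_poles)
    have kd: "k field_differentiable at z" by (rule holomorphic_on_imp_differentiable_at[OF k open_ball]) (use r in simp)
    then have "(k \<longlongrightarrow> k z) (at z)" using field_differentiable_imp_continuous_at[OF kd] by (simp add: isCont_def)
    moreover have "eventually (\<lambda>x. k x = h x) (at z)"
      by (rule eventually_mono[OF eventually_at_in_open[of "ball z r" z]]) (use r hk in auto)
    ultimately have "(h \<longlongrightarrow> k z) (at z)" by (rule Lim_transform_eventually)
    then have "g z = k z" using True by (simp add: g_def tendsto_Lim)
    then have eq: "k x = g x" if "x \<in> ball z (min r s)" for x
      using that hk[of x] s(2) by (cases "x = z") (auto simp: g_def)
    obtain D where "(k has_field_derivative D) (at z)" using kd by (auto simp: field_differentiable_def)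
    then have "(g has_field_derivative D) (at z)"
      by (rule has_field_derivative_transform_within_open[OF _ open_ball[of z "min r s"]]) (use r s eq in auto)
    then show ?thesis by (auto simp: field_differentiable_def)
  qed
  then show "g holomorphic_on UNIV" by (simp add: holomorphic_on_def)
qed

lemma (in analytic_off_poles) entire_eq_0:
  assumes f: "f holomorphic_on UNIV" and 0: "\<And>z. z \<notin> S \<Longrightarrow> f z = 0"
  shows "f z = 0"
proof (cases "z \<in> S")
  case True
  obtain s where s: "0 < s" "ball z s - {z} \<subseteq> - S" by (rule punctured_ball_avoiding_poles)
  show ?thesis
    by (rule eq_0_at_centre(1)[of f z s]) (use s 0 f in \<open>auto intro: holomorphic_on_subset\<close>)
qed (rule 0)

text \<open>If \<open>v\<close> is at most linear in \<open>h\<close>, the left-hand side of the algebraic relation has size \<open>|h|^3\<close> while the right-hand side is quadratic in \<open>h\<close>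
and \<open>h'\<close>; so \<open>M(r)^3 \<le> const * M(r + \<delta>)^2 / \<delta>^2\<close> at maximum points, unless \<open>M(r)\<close> is below a threshold of
exponential growth.\<close>

lemma entire_pair_growth:
  fixes h v :: "complex \<Rightarrow> complex" and e p \<epsilon> a :: complex
  assumes h: "h holomorphic_on UNIV" and \<epsilon>: "cmod \<epsilon> = 1"
    and eq: "\<And>z. (2 * \<epsilon> * h z - a) * (h z ^ 2 - v z) = (deriv h z + 2 * e * h z + p) ^ 2"
    and \<Lambda>: "exp_bounded \<Lambda>" "\<And>r. 0 \<le> r \<Longrightarrow> 0 \<le> \<Lambda> r" "\<And>r s. 0 \<le> r \<Longrightarrow> r \<le> s \<Longrightarrow> \<Lambda> r \<le> \<Lambda> s"
    and v: "\<And>r z. cmod z \<le> r \<Longrightarrow> cmod (v z) \<le> \<Lambda> r * (1 + max_modulus h r)"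
  shows "exp_bounded (max_modulus h)"
proof -
  define E where "E = 1 + 2 * cmod e + cmod p"
  define D where "D = 2 * E ^ 2"
  have E: "1 \<le> E" by (simp add: E_def)
  then have "1 \<le> E ^ 2" by simp
  then have D: "1 \<le> D" unfolding D_def by linarith
  \<comment> \<open>Above this threshold the term with \<open>v\<close> is at most half of \<open>|h|^3\<close>.\<close>
  define K where "K r = 1 + cmod a + 12 * \<Lambda> (r + 1)" for r
  have main: "max_modulus h r0 \<le> K r0 + 16 ^ 3 * D" if r0: "0 \<le> r0" for r0
  proof -
    have K0: "0 \<le> K r0" using \<Lambda>(2)[of "r0 + 1"] r0 by (simp add: K_def)
    have "max_modulus h r0 \<le> max (K r0) (16 ^ 3 * D)"
    proof (rule superlinear_growth_bounded[OF max_modulus_mono[OF h] D r0])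
      fix r \<delta> :: real
      assume r: "r0 \<le> r" "r \<le> r0 + 1" and \<delta>: "0 < \<delta>" "\<delta> \<le> 1" and KM: "K r0 \<le> max_modulus h r"
      have rpos: "0 \<le> r" using r r0 by linarith
      obtain x where x: "cmod x \<le> r" "max_modulus h r = cmod (h x)"
        using max_modulus_attained[OF h rpos] by blast
      define y where "y = cmod (h x)"
      define M where "M = max_modulus h (r + \<delta>)"
      define \<Lambda>1 where "\<Lambda>1 = \<Lambda> (r0 + 1)"
      have \<Lambda>1: "0 \<le> \<Lambda>1" "\<Lambda> r \<le> \<Lambda>1" unfolding \<Lambda>1_def using r0 rpos r \<Lambda>(2,3) by auto
      have y: "1 \<le> y" "cmod a \<le> y" "12 * \<Lambda>1 \<le> y"
        using KM \<Lambda>1 norm_ge_zero[of a] unfolding x(2) y_def[symmetric] K_def \<Lambda>1_def[symmetric] by linarith+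
      have yM: "y \<le> M" unfolding y_def x(2)[symmetric] M_def using rpos \<delta> by (intro max_modulus_mono[OF h]) auto
      have h2: "cmod (2 * \<epsilon> * h x) = 2 * y" using \<epsilon> by (simp add: norm_mult y_def)
      have Hlo: "y \<le> cmod (2 * \<epsilon> * h x - a)" using norm_triangle_ineq2[of "2 * \<epsilon> * h x" a] y(2) unfolding h2 by linarith
      have Hup: "cmod (2 * \<epsilon> * h x - a) \<le> 3 * y" using norm_triangle_ineq4[of "2 * \<epsilon> * h x" a] y(2) unfolding h2 by linarith
      have vx: "cmod (v x) \<le> 2 * \<Lambda>1 * y"
      proof -
        have "cmod (v x) \<le> \<Lambda> r * (1 + y)" using v[OF x(1)] unfolding x(2) y_def .
        also have "\<dots> \<le> \<Lambda>1 * (2 * y)" using \<Lambda>1 y by (intro mult_mono) auto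
        finally show ?thesis by simp
      qed
      have dh: "cmod (deriv h x) \<le> M / \<delta>" unfolding M_def by (rule norm_deriv_le_max_modulus(1)[OF h x(1) \<delta>(1)])
      have "y \<le> M / \<delta>"
      proof -
        have "M * \<delta> \<le> M * 1" using \<delta> y yM by (intro mult_left_mono) auto
        then have "M \<le> M / \<delta>" using \<delta> by (simp add: field_simps)
        then show ?thesis using yM by linarith
      qed
      then have My: "0 \<le> M / \<delta>" "y \<le> M / \<delta>" "1 \<le> M / \<delta>" using y by linarith+
      have G: "cmod (deriv h x + 2 * e * h x + p) \<le> E * (M / \<delta>)"
      proof -
        have "cmod (deriv h x + 2 * e * h x + p) \<le> cmod (deriv h x) + cmod (2 * e * h x) + cmod p"
          by (intro norm_triangle_le add_mono order_refl)
        also have "\<dots> \<le> M / \<delta> + 2 * cmod e * (M / \<delta>) + cmod p * (M / \<delta>)"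
        proof (intro add_mono dh)
          show "cmod (2 * e * h x) \<le> 2 * cmod e * (M / \<delta>)"
            using My(2) by (simp only: norm_mult y_def[symmetric] norm_numeral) (intro mult_left_mono; simp)
          show "cmod p \<le> cmod p * (M / \<delta>)" using mult_left_mono[OF My(3), of "cmod p"] by simp
        qed
        also have "\<dots> = E * (M / \<delta>)" by (simp add: E_def algebra_simps)
        finally show ?thesis .
      qed
      have "y * y ^ 2 \<le> cmod (2 * \<epsilon> * h x - a) * y ^ 2" using Hlo by (intro mult_right_mono) auto
      also have "\<dots> = cmod ((2 * \<epsilon> * h x - a) * (h x ^ 2 - v x) + (2 * \<epsilon> * h x - a) * v x)"
        by (simp add: algebra_simps norm_mult norm_power y_def flip: norm_mult norm_power)
      also have "\<dots> \<le> cmod ((2 * \<epsilon> * h x - a) * (h x ^ 2 - v x)) + cmod ((2 * \<epsilon> * h x - a) * v x)"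
        by (rule norm_triangle_ineq)
      also have "\<dots> \<le> (E * (M / \<delta>)) ^ 2 + (3 * y) * (2 * \<Lambda>1 * y)"
        unfolding eq norm_mult[of _ "v x"] norm_power using G Hup vx y \<Lambda>1 by (intro add_mono mult_mono power_mono) auto
      also have "(3 * y) * (2 * \<Lambda>1 * y) = y * y * (12 * \<Lambda>1) / 2" by simp
      also have "y * y * (12 * \<Lambda>1) / 2 \<le> y * y * y / 2" using y by (intro divide_right_mono mult_left_mono) auto
      finally have "y ^ 3 \<le> 2 * (E * (M / \<delta>)) ^ 2" by (simp add: power2_eq_square power3_eq_cube)
      also have "\<dots> = D * M ^ 2 / \<delta> ^ 2" by (simp add: D_def power_mult_distrib power_divide)
      finally have "y ^ 3 * \<delta> ^ 2 \<le> D * M ^ 2" using \<delta> by (simp add: pos_le_divide_eq)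
      moreover have "y ^ 3 * \<delta> ^ 4 \<le> y ^ 3 * \<delta> ^ 2"
        using \<delta> y by (intro mult_left_mono power_decreasing) auto
      ultimately show "max_modulus h r ^ 3 * \<delta> ^ 4 \<le> D * max_modulus h (r + \<delta>) ^ 2"
        unfolding x(2) y_def M_def by linarith
    qed
    then show ?thesis using K0 D by (simp add: max_def split: if_splits)
  qed
  have "exp_bounded (\<lambda>r. K r + 16 ^ 3 * D)"
    unfolding K_def by (intro exp_bounded_intros exp_bounded_shift \<Lambda>(1))
  then show ?thesis
    by (rule exp_bounded_mono) (use main max_modulus_nonneg[OF h] in \<open>auto simp: abs_of_nonneg\<close>)
qed

text \<open>As in the quadratic case, \<open>V\<close> is chosen such that \<open>V' + (4/3) c V\<close> has no terms of high weight; with \<open>e = c / 3\<close> the rest is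
\<open>e (\<alpha> W^2 + 6 p0 W)\<close>. The residue condition at a pole with residue \<open>x\<close> is \<open>e (e \<alpha> + 2 p0 x) = 0\<close>, and \<open>x = 1\<close> or
\<open>x = -1\<close>. So either the rest vanishes, or all residues are equal to the same \<open>\<epsilon>\<close>. In the second case \<open>V + e \<alpha> \<epsilon> W\<close> and
\<open>h = W' + \<epsilon> W^2 + e W\<close> are both entire, and with \<open>H = 2 \<epsilon> h - \<alpha>/2\<close> one has \<open>h' + 2 e h + p0 = W H\<close> and
\<open>V + e \<alpha> \<epsilon> W = h^2 - W^2 H\<close>. Eliminating \<open>W\<close> gives the relation that \<open>entire_pair_growth\<close> needs.\<close>

lemma (in autonomous_solution) exponentially_tame_cubic:
  assumes P: "P = [:p0, p1, 0, -2:]" and ne: "S \<noteq> {}"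
  shows "exponentially_tame W"
proof -
  define e where "e = c / 3"
  have c: "c = 3 * e" by (simp add: e_def)
  have W'': "deriv (deriv W) z = 2 * W z ^ 3 - 3 * e * deriv W z - p1 * W z - p0" if "z \<notin> S" for z
  proof -
    have "deriv (deriv W) z = 2 * W z ^ 3 - 3 * e * deriv W z - p1 * W z - p0
       + (deriv (deriv W) z + c * deriv W z + poly P (W z))"
      by (simp add: P c algebra_simps power3_eq_cube)
    then show ?thesis using ode[OF that] by simp
  qed
  define \<alpha> where "\<alpha> = 2 * (p1 - 2 * e ^ 2)"
  define V where "V z = deriv W z ^ 2 - W z ^ 4 + 2 * e * W z * deriv W z + (p1 - e ^ 2) * W z ^ 2
      + 2 * p0 * W z" for z
  have V: "(V has_field_derivative - (4 * e) * V z + e * (\<alpha> * W z ^ 2 + 6 * p0 * W z)) (at z)" if "z \<notin> S" for z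
  proof -
    have "(V has_field_derivative 2 * deriv W z * deriv (deriv W) z - 4 * W z ^ 3 * deriv W z
       + 2 * e * (deriv W z * deriv W z + W z * deriv (deriv W) z) + 2 * (p1 - e ^ 2) * W z * deriv W z
       + 2 * p0 * deriv W z) (at z)"
      (is "(_ has_field_derivative ?D) _")
      unfolding V_def[abs_def]
      by (auto intro!: derivative_eq_intros has_deriv[OF that] has_deriv2[OF that]
          simp: algebra_simps power2_eq_square power3_eq_cube)
    also have "?D = - (4 * e) * V z + e * (\<alpha> * W z ^ 2 + 6 * p0 * W z)"
      unfolding V_def \<alpha>_def W''[OF that] by algebra
    finally show ?thesis .
  qed
  have tame: "exponentially_tame W"
    if "exp_bounded B" "\<And>z. z \<notin> S \<Longrightarrow> cmod (V z + b * W z) \<le> B (cmod z)" for B b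
  proof (rule exponentially_tame_if_energy_bounded[where m = 1 and n = 2 and v = "\<lambda>z. V z + b * W z" and B = B
        and ?d0.0 = "- 3 * e" and ?d1.0 = "- p1" and ?d2.0 = "- p0" and ?b0.0 = "2 * e" and ?b1.0 = "p1 - e ^ 2"
        and ?b2.0 = 0 and ?b3.0 = "2 * p0 + b"])
    show "deriv (deriv W) z = of_nat (1 * (1 + 1)) * W z ^ (2 + 1) + - 3 * e * deriv W z + - p1 * W z + - p0" if "z \<notin> S" for z
      unfolding W''[OF that] by simp
    show "deriv W z ^ 2 - of_nat 1 ^ 2 * W z ^ (2 + 2) = V z + b * W z - (2 * e * W z * deriv W z + (p1 - e ^ 2) * W z ^ 2 +
            0 * deriv W z + (2 * p0 + b) * W z)" if "z \<notin> S" for z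
      unfolding V_def by (simp add: algebra_simps)
    show "-2 \<le> zorder W a" if "a \<in> S" for a using pole_order_cases[OF that] by auto
  qed (use that in auto)
  have resonance: "e * (e * \<alpha> + 2 * p0 * \<phi> a) = 0"
    if \<phi>: "0 < r" "ball a r - {a} \<subseteq> - S" "\<phi> holomorphic_on ball a r"
      "\<And>z. z \<in> ball a r - {a} \<Longrightarrow> W z = \<phi> z / (z - a)" "\<phi> a ^ 2 = 1" "deriv \<phi> a = - c * \<phi> a / 6" for a r \<phi>
  proof -
    define \<psi> where "\<psi> z = e * (\<alpha> * \<phi> z ^ 2 + 6 * p0 * \<phi> z * (z - a))" for z
    have "deriv \<psi> a + (4 * e) * \<psi> a = 0"
    proof (rule no_logarithmic_term[OF _ \<phi>(1)])
      show "\<psi> holomorphic_on ball a r" unfolding \<psi>_def[abs_def] by (intro holomorphic_intros \<phi>(3))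
      fix z assume z: "z \<in> ball a r - {a}"
      then have "z - a \<noteq> 0" by auto
      moreover have "e * (\<alpha> * (p / t) ^ 2 + 6 * p0 * (p / t)) = e * (\<alpha> * p ^ 2 + 6 * p0 * p * t) / t ^ 2"
        if "t \<noteq> 0" for p t :: complex
        using that by (simp add: field_simps power2_eq_square)
      ultimately have "e * (\<alpha> * W z ^ 2 + 6 * p0 * W z) = \<psi> z / (z - a) ^ 2"
        unfolding \<phi>(4)[OF z] \<psi>_def by blast
      then show "(V has_field_derivative - (4 * e) * V z + \<psi> z / (z - a) ^ 2) (at z)"
        using V[of z] z \<phi>(2) by auto
    qed
    moreover have "deriv \<psi> a = e * (2 * \<alpha> * \<phi> a * deriv \<phi> a + 6 * p0 * \<phi> a)"
    proof (rule DERIV_imp_deriv)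
      have "(\<phi> has_field_derivative deriv \<phi> a) (at a)"
        using holomorphic_derivI[OF \<phi>(3) open_ball, of a] \<phi>(1) by simp
      then show "(\<psi> has_field_derivative e * (2 * \<alpha> * \<phi> a * deriv \<phi> a + 6 * p0 * \<phi> a)) (at a)"
        unfolding \<psi>_def[abs_def] by (auto intro!: derivative_eq_intros)
    qed
    moreover have "2 * \<alpha> * \<phi> a * deriv \<phi> a = - (\<alpha> * e)"
    proof -
      have "2 * \<alpha> * \<phi> a * deriv \<phi> a = - (\<alpha> * e) * \<phi> a ^ 2" unfolding \<phi>(6) c by (simp add: power2_eq_square)
      then show ?thesis by (simp add: \<phi>(5))
    qed
    moreover have "\<psi> a = e * \<alpha>" by (simp add: \<psi>_def \<phi>(5))
    ultimately have "e * (- (\<alpha> * e) + 6 * p0 * \<phi> a) + 4 * e * (e * \<alpha>) = 0" by simp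
    then have "3 * (e * (e * \<alpha> + 2 * p0 * \<phi> a)) = 0" by (simp add: algebra_simps)
    then show ?thesis by simp
  qed
  show ?thesis
  proof (cases "e = 0 \<or> (\<alpha> = 0 \<and> p0 = 0)")
    case True
    then have V0: "(V has_field_derivative - (4 * e) * V z + 0) (at z)" if "z \<notin> S" for z using V[OF that] by auto
    show ?thesis
    proof (rule linear_first_order_extension[where V = V and \<kappa> = "4 * e" and q = "\<lambda>_. 0"])
      fix v C assume v: "v holomorphic_on UNIV" "\<And>z. z \<notin> S \<Longrightarrow> V z = v z" "0 \<le> C"
        "\<And>r M z. cmod z \<le> r \<Longrightarrow> 0 \<le> M \<Longrightarrow> (\<And>x. cmod x \<le> r \<Longrightarrow> cmod (0::complex) \<le> M) \<Longrightarrow>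
           cmod (v z) \<le> exp (cmod (4 * e) * r) * (C + r * (exp (cmod (4 * e) * r) * M))"
      show ?thesis
      proof (rule tame[where b = 0])
        show "exp_bounded (\<lambda>r. exp (cmod (4 * e) * r) * (C + r * (exp (cmod (4 * e) * r) * 0)))"
          by (intro exp_bounded_intros)
        show "cmod (V z + 0 * W z) \<le> exp (cmod (4 * e) * cmod z) * (C + cmod z * (exp (cmod (4 * e) * cmod z) * 0))"
          if "z \<notin> S" for z
          using v(4)[of z "cmod z" 0] v(2)[OF that] by simp
      qed
    qed (use V0 in auto)
  next
    case False
    then have e0: "e \<noteq> 0" by blast
    define \<epsilon> where "\<epsilon> = - (e * \<alpha>) / (2 * p0)"
    have res: "p0 \<noteq> 0 \<and> x = \<epsilon>" if "e * (e * \<alpha> + 2 * p0 * x) = 0" for x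
    proof -
      have *: "e * \<alpha> + 2 * p0 * x = 0" using that e0 by simp
      then have "p0 \<noteq> 0" using False e0 by auto
      moreover have "2 * p0 * x = - (e * \<alpha>)" using * by (simp add: add_eq_0_iff2 add.commute)
      ultimately show ?thesis unfolding \<epsilon>_def by (simp add: field_simps)
    qed
    obtain a0 where a0: "a0 \<in> S" using ne by blast
    have \<epsilon>2: "\<epsilon> ^ 2 = 1" and p00: "p0 \<noteq> 0"
      using simple_pole_coefficients[OF a0 P] resonance res by metis+
    have "2 * p0 * \<epsilon> = - (e * \<alpha>)" unfolding \<epsilon>_def using p00 by simp
    then have p0: "2 * p0 = - (e * \<alpha> * \<epsilon>)" using \<epsilon>2 by algebra
    define h0 where "h0 z = deriv W z + \<epsilon> * W z ^ 2 + e * W z" for z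
    have h0_hol: "h0 holomorphic_on - S" unfolding h0_def[abs_def] by (intro holomorphic_intros holo holo_deriv)
    have "\<exists>r k. 0 < r \<and> k holomorphic_on ball a r \<and> (\<forall>z\<in>ball a r - {a}. h0 z = k z)" if a: "a \<in> S" for a
    proof -
      obtain r \<phi> where \<phi>: "0 < r" "ball a r - {a} \<subseteq> - S" "\<phi> holomorphic_on ball a r"
        "\<And>z. z \<in> ball a r - {a} \<Longrightarrow> W z = \<phi> z / (z - a)" "\<phi> a ^ 2 = 1" "deriv \<phi> a = - c * \<phi> a / 6"
        using simple_pole_coefficients[OF a P] by blast
      have "e * (e * \<alpha> + 2 * p0 * \<phi> a) = 0" by (rule resonance[OF \<phi>(1-3) _ \<phi>(5,6)]) (rule \<phi>(4))
      then have \<phi>a: "\<phi> a = \<epsilon>" using res by blast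
      \<comment> \<open>The numerator of \<open>h0\<close> over \<open>(z - a)^2\<close>; it has a double zero at \<open>a\<close> because the residue is \<open>\<epsilon>\<close>.\<close>
      define N where "N z = deriv \<phi> z * (z - a) - \<phi> z + \<epsilon> * \<phi> z ^ 2 + e * \<phi> z * (z - a)" for z
      have hd: "deriv \<phi> holomorphic_on ball a r" using \<phi>(3) by (intro holomorphic_deriv) auto
      have N: "N holomorphic_on ball a r" unfolding N_def[abs_def] by (intro holomorphic_intros \<phi>(3) hd)
      have Na: "N a = 0" using \<epsilon>2 by (simp add: N_def \<phi>a power2_eq_square)
      have "deriv N a = 2 * \<epsilon> * \<phi> a * deriv \<phi> a + e * \<phi> a"
      proof (rule DERIV_imp_deriv)
        have "(\<phi> has_field_derivative deriv \<phi> a) (at a)" "(deriv \<phi> has_field_derivative deriv (deriv \<phi>) a) (at a)"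
          using holomorphic_derivI[OF \<phi>(3) open_ball, of a] holomorphic_derivI[OF hd open_ball, of a] \<phi>(1) by simp_all
        then show "(N has_field_derivative 2 * \<epsilon> * \<phi> a * deriv \<phi> a + e * \<phi> a) (at a)"
          unfolding N_def[abs_def] by (auto intro!: derivative_eq_intros)
      qed
      also have "\<dots> = 2 * \<epsilon> ^ 2 * (- (3 * e) * \<epsilon> / 6) + e * \<epsilon>" unfolding \<phi>(6) \<phi>a c by (simp add: power2_eq_square)
      also have "\<dots> = 0" by (simp add: \<epsilon>2)
      finally have N'a: "deriv N a = 0" .
      obtain k where k: "k holomorphic_on ball a r" "\<And>z. z \<in> ball a r - {a} \<Longrightarrow> N z / (z - a) ^ 2 = k z"
        using divide_double_zero[OF N \<phi>(1) Na N'a] by blast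
      have "h0 z = k z" if z: "z \<in> ball a r - {a}" for z
      proof -
        have za: "z - a \<noteq> 0" using z by auto
        have "deriv W z = polar_deriv a 1 \<phi> z / (z - a) ^ (1 + 1)"
          by (rule deriv_polar[OF \<phi>(3) _ z]) (use \<phi>(4) in auto)
        then have d: "deriv W z = (deriv \<phi> z * (z - a) - \<phi> z) / (z - a) ^ 2" by (simp add: polar_deriv_def power2_eq_square)
        have "(d * t - p) / t ^ 2 + \<epsilon> * (p / t) ^ 2 + e * (p / t) = (d * t - p + \<epsilon> * p ^ 2 + e * p * t) / t ^ 2"
          if "t \<noteq> 0" for d p t :: complex
          using that by (simp add: field_simps power2_eq_square)
        from this[OF za] have "h0 z = N z / (z - a) ^ 2" unfolding h0_def d \<phi>(4)[OF z] N_def .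
        then show ?thesis using k(2)[OF z] by simp
      qed
      then show ?thesis using \<phi>(1) k(1) by blast
    qed
    then obtain h where h: "h holomorphic_on UNIV" "\<And>z. z \<notin> S \<Longrightarrow> h z = h0 z"
      using entire_extension[OF h0_hol] by blast
    define b where "b = e * \<alpha> * \<epsilon>"
    have V2: "((\<lambda>z. V z + b * W z) has_field_derivative - (4 * e) * (V z + b * W z) + b * h z) (at z)" if z: "z \<notin> S" for z
    proof -
      have "((\<lambda>z. V z + b * W z) has_field_derivative
          (- (4 * e) * V z + e * (\<alpha> * W z ^ 2 + 6 * p0 * W z)) + b * deriv W z) (at z)"
          (is "(_ has_field_derivative ?D) _")
        by (intro DERIV_add DERIV_cmult V has_deriv z)
      also have "?D = - (4 * e) * (V z + b * W z) + b * h z"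
        unfolding h(2)[OF z] h0_def b_def using \<epsilon>2 p0 by algebra
      finally show ?thesis .
    qed
    have bh: "(\<lambda>z. b * h z) holomorphic_on UNIV" by (intro holomorphic_intros h)
    show ?thesis
    proof (rule linear_first_order_extension[where V = "\<lambda>z. V z + b * W z" and \<kappa> = "4 * e" and q = "\<lambda>z. b * h z"])
      fix v C assume v: "v holomorphic_on UNIV" "\<And>z. z \<notin> S \<Longrightarrow> V z + b * W z = v z" "0 \<le> C"
        "\<And>r M z. cmod z \<le> r \<Longrightarrow> 0 \<le> M \<Longrightarrow> (\<And>x. cmod x \<le> r \<Longrightarrow> cmod (b * h x) \<le> M) \<Longrightarrow>
           cmod (v z) \<le> exp (cmod (4 * e) * r) * (C + r * (exp (cmod (4 * e) * r) * M))"
      define \<Lambda> where "\<Lambda> r = exp (cmod (4 * e) * r) * (C + r * (exp (cmod (4 * e) * r) * cmod b))" for r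
      have \<Lambda>: "exp_bounded \<Lambda>" unfolding \<Lambda>_def[abs_def] by (intro exp_bounded_intros)
      have \<Lambda>0: "0 \<le> \<Lambda> r" if "0 \<le> r" for r
        unfolding \<Lambda>_def using that v(3) by (intro mult_nonneg_nonneg add_nonneg_nonneg) auto
      have \<Lambda>mono: "\<Lambda> r \<le> \<Lambda> s" if "0 \<le> r" "r \<le> s" for r s
        unfolding \<Lambda>_def using that v(3)
        by (intro mult_mono add_mono order_refl mult_nonneg_nonneg add_nonneg_nonneg) (auto intro: mult_left_mono)
      have v\<Lambda>: "cmod (v z) \<le> \<Lambda> r * (1 + max_modulus h r)" if z: "cmod z \<le> r" for r z
      proof -
        have r: "0 \<le> r" using z norm_ge_zero order_trans by blast
        have M: "0 \<le> max_modulus h r" by (rule max_modulus_nonneg[OF h(1) r])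
        let ?x = "exp (cmod (4 * e) * r)"
        have "cmod (v z) \<le> ?x * (C + r * (?x * (cmod b * max_modulus h r)))"
          using M by (intro v(4)[OF z]) (auto simp: norm_mult intro!: mult_left_mono norm_le_max_modulus[OF h(1)])
        also have "\<dots> \<le> ?x * (C * (1 + max_modulus h r) + r * (?x * (cmod b * (1 + max_modulus h r))))"
          using M r v(3) by (intro mult_left_mono add_mono) (auto simp: mult_le_cancel_left1)
        also have "\<dots> = \<Lambda> r * (1 + max_modulus h r)" by (simp add: \<Lambda>_def algebra_simps)
        finally show ?thesis .
      qed
      have identity: "(2 * \<epsilon> * h z - \<alpha> / 2) * (h z ^ 2 - v z) = (deriv h z + 2 * e * h z + p0) ^ 2" for z
      proof -
        define f where "f z = (2 * \<epsilon> * h z - \<alpha> / 2) * (h z ^ 2 - v z) - (deriv h z + 2 * e * h z + p0) ^ 2" for z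
        have "f z = 0"
        proof (rule entire_eq_0[of f])
          have "deriv h holomorphic_on UNIV" by (intro holomorphic_deriv h(1)) auto
          then show "f holomorphic_on UNIV" unfolding f_def[abs_def] by (intro holomorphic_intros h(1) v(1) open_UNIV)
          fix z assume z: "z \<notin> S"
          have "(h0 has_field_derivative deriv (deriv W) z + \<epsilon> * (2 * W z * deriv W z) + e * deriv W z) (at z)"
            unfolding h0_def[abs_def] by (auto intro!: derivative_eq_intros has_deriv[OF z] has_deriv2[OF z])
          then have "(h has_field_derivative deriv (deriv W) z + \<epsilon> * (2 * W z * deriv W z) + e * deriv W z) (at z)"
            by (rule has_field_derivative_transform_within_open[OF _ open_compl]) (use z h(2) in auto)
          then have dh: "deriv h z = deriv (deriv W) z + \<epsilon> * (2 * W z * deriv W z) + e * deriv W z"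
            by (rule DERIV_imp_deriv)
          have \<alpha>2: "\<alpha> / 2 = p1 - 2 * e ^ 2" by (simp add: \<alpha>_def)
          have 1: "deriv h z + 2 * e * h z + p0 = W z * (2 * \<epsilon> * h z - \<alpha> / 2)"
            unfolding dh h(2)[OF z] h0_def W''[OF z] \<alpha>2 using \<epsilon>2 by algebra
          have "b = - 2 * p0" unfolding b_def p0[symmetric] using p0 by simp
          then have vz: "v z = V z - 2 * p0 * W z" unfolding v(2)[OF z, symmetric] by simp
          have 2: "h z ^ 2 - v z = W z ^ 2 * (2 * \<epsilon> * h z - \<alpha> / 2)"
            unfolding vz V_def h(2)[OF z] h0_def \<alpha>2 using \<epsilon>2 by algebra
          show "f z = 0" unfolding f_def 1 2 by (simp add: power2_eq_square)
        qed
        then show ?thesis by (simp add: f_def)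
      qed
      have \<epsilon>1: "cmod \<epsilon> = 1"
      proof -
        have "cmod \<epsilon> ^ 2 = 1 ^ 2" using \<epsilon>2 by (metis norm_one norm_power power_one)
        then show ?thesis by (rule power2_eq_imp_eq) auto
      qed
      have Mh: "exp_bounded (max_modulus h)"
        by (rule entire_pair_growth[OF h(1) \<epsilon>1 identity \<Lambda> \<Lambda>0 \<Lambda>mono v\<Lambda>])
      show ?thesis
      proof (rule tame[where b = b])
        show "exp_bounded (\<lambda>r. \<Lambda> r * (1 + max_modulus h r))" by (intro exp_bounded_intros \<Lambda> Mh)
        show "cmod (V z + b * W z) \<le> \<Lambda> (cmod z) * (1 + max_modulus h (cmod z))" if "z \<notin> S" for z
          unfolding v(2)[OF that] by (rule v\<Lambda>) simp
      qed
    qed (use V2 bh in auto)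
  qed
qed

section \<open>All solutions\<close>

text \<open>With \<open>\<alpha> = 1\<close> and \<open>\<beta> = 0\<close> this compares two functions that differ only in the values at their singularities.\<close>

lemma exponentially_tame_affine:
  assumes tame: "exponentially_tame u"
    and pole: "\<And>a. is_pole w a \<longleftrightarrow> is_pole u a" and ord: "\<And>a. is_pole w a \<Longrightarrow> -2 \<le> zorder w a"
    and val: "\<And>z. w analytic_on {z} \<Longrightarrow> u analytic_on {z}"
      "\<And>z. w analytic_on {z} \<Longrightarrow> w z = \<alpha> * u z + \<beta>"
  shows "exponentially_tame w"
proof -
  obtain C where C: "0 \<le> C"
    and card: "\<And>R. 1 \<le> R \<Longrightarrow> real (card {a. cmod a \<le> R \<and> is_pole u a}) \<le> exp (C * R)"
    and near: "\<And>R z. 1 \<le> R \<Longrightarrow> cmod z \<le> R \<Longrightarrow> u analytic_on {z} \<Longrightarrow> cmod (u z) \<le> exp (C * R) \<or>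
           (\<exists>a. is_pole u a \<and> cmod (z - a) \<le> 1 \<and> cmod (u z) * cmod (z - a) ^ 2 \<le> exp (C * R))"
    using tame unfolding exponentially_tame_def by blast
  define Q where "Q = 1 + cmod \<alpha> + cmod \<beta>"
  have Q: "1 \<le> Q" by (simp add: Q_def)
  have lnQ: "0 \<le> ln Q" using Q by simp
  have big: "exp (C * R) \<le> exp ((C + ln Q) * R)" "Q * exp (C * R) \<le> exp ((C + ln Q) * R)" if R: "1 \<le> R" for R
  proof -
    have "Q \<le> exp (ln Q * R)" using Q R by (rule le_exp_ln_mult)
    then have "Q * exp (C * R) \<le> exp (ln Q * R) * exp (C * R)" by (intro mult_right_mono) auto
    also have "\<dots> = exp ((C + ln Q) * R)" by (simp add: algebra_simps flip: exp_add)
    finally show 1: "Q * exp (C * R) \<le> exp ((C + ln Q) * R)" .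
    have "1 * exp (C * R) \<le> Q * exp (C * R)" using Q by (intro mult_right_mono) auto
    then show "exp (C * R) \<le> exp ((C + ln Q) * R)" using 1 by linarith
  qed
  show ?thesis
    unfolding exponentially_tame_def
  proof (intro conjI allI impI exI[of _ "C + ln Q"] ord)
    show "0 \<le> C + ln Q" using C lnQ by simp
    fix R :: real assume R: "1 \<le> R"
    show "real (card {a. cmod a \<le> R \<and> is_pole w a}) \<le> exp ((C + ln Q) * R)"
      unfolding pole using card[OF R] big(1)[OF R] by linarith
    fix z assume z: "cmod z \<le> R" "w analytic_on {z}"
    have w: "cmod (w z) \<le> cmod \<alpha> * cmod (u z) + cmod \<beta>"
      unfolding val(2)[OF z(2)] by (metis norm_mult norm_triangle_ineq)
    have e1: "1 \<le> exp (C * R)" using C R by simp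
    have step: "cmod \<alpha> * y + cmod \<beta> \<le> exp ((C + ln Q) * R)" if "y \<le> exp (C * R)" for y
    proof -
      have "cmod \<alpha> * y + cmod \<beta> * 1 \<le> cmod \<alpha> * exp (C * R) + cmod \<beta> * exp (C * R)"
        using that e1 by (intro add_mono mult_left_mono) auto
      also have "\<dots> \<le> Q * exp (C * R)" by (simp add: Q_def algebra_simps)
      also note big(2)[OF R]
      finally show ?thesis by simp
    qed
    consider "cmod (u z) \<le> exp (C * R)" |
      a where "is_pole u a" "cmod (z - a) \<le> 1" "cmod (u z) * cmod (z - a) ^ 2 \<le> exp (C * R)"
      using near[OF R z(1) val(1)[OF z(2)]] by blast
    then show "cmod (w z) \<le> exp ((C + ln Q) * R) \<or>
       (\<exists>a. is_pole w a \<and> cmod (z - a) \<le> 1 \<and> cmod (w z) * cmod (z - a) ^ 2 \<le> exp ((C + ln Q) * R))"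
    proof cases
      case 1
      then show ?thesis using w step[OF 1] by linarith
    next
      case 2
      have sq: "cmod (z - a) ^ 2 \<le> 1" using 2(2) by (intro power_le_one) auto
      have "cmod (w z) * cmod (z - a) ^ 2 \<le> (cmod \<alpha> * cmod (u z) + cmod \<beta>) * cmod (z - a) ^ 2"
        using w by (intro mult_right_mono) auto
      also have "\<dots> = cmod \<alpha> * (cmod (u z) * cmod (z - a) ^ 2) + cmod \<beta> * cmod (z - a) ^ 2"
        by (simp add: algebra_simps)
      also have "\<dots> \<le> cmod \<alpha> * (cmod (u z) * cmod (z - a) ^ 2) + cmod \<beta> * 1"
        using sq by (intro add_left_mono mult_left_mono) auto
      also have "\<dots> \<le> exp ((C + ln Q) * R)" using step[OF 2(3)] by simp
      finally show ?thesis using 2(1,2) pole by blast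
    qed
  qed
qed

lemma exponentially_tame_entire:
  assumes nopole: "\<And>a. \<not> is_pole w a" and A: "0 \<le> L" and bound: "\<And>z. cmod (w z) \<le> A * exp (L * cmod z)"
  shows "exponentially_tame w"
proof -
  define Q where "Q = 1 + \<bar>A\<bar>"
  have Q: "1 \<le> Q" "A \<le> Q" by (auto simp: Q_def)
  have lnQ: "0 \<le> ln Q" using Q by simp
  show ?thesis
    unfolding exponentially_tame_def
  proof (intro conjI allI impI exI[of _ "L + ln Q"])
    show "0 \<le> L + ln Q" using A lnQ by simp
    show "-2 \<le> zorder w a" if "is_pole w a" for a using that nopole by blast
    fix R :: real assume R: "1 \<le> R"
    show "real (card {a. cmod a \<le> R \<and> is_pole w a}) \<le> exp ((L + ln Q) * R)"
      using nopole by simp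
    fix z assume z: "cmod z \<le> R"
    have "cmod (w z) \<le> Q * exp (L * cmod z)"
      using bound[of z] mult_right_mono[OF Q(2) exp_ge_zero[of "L * cmod z"]] by linarith
    also have "\<dots> \<le> exp (ln Q * R) * exp (L * R)"
    proof (rule mult_mono)
      show "Q \<le> exp (ln Q * R)" using Q(1) R by (rule le_exp_ln_mult)
      show "exp (L * cmod z) \<le> exp (L * R)" using A z by (simp add: mult_left_mono)
    qed auto
    also have "\<dots> = exp ((L + ln Q) * R)" by (simp add: algebra_simps flip: exp_add)
    finally show "cmod (w z) \<le> exp ((L + ln Q) * R) \<or>
       (\<exists>a. is_pole w a \<and> cmod (z - a) \<le> 1 \<and> cmod (w z) * cmod (z - a) ^ 2 \<le> exp ((L + ln Q) * R))" by blast
  qed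
qed

context autonomous_solution
begin

text \<open>Affine changes of the unknown preserve the class of equations; with \<open>\<alpha>\<close> the leading coefficient is
normalised, with \<open>\<beta>\<close> the second one is removed.\<close>

lemma affine_change:
  assumes \<alpha>: "\<alpha> \<noteq> 0"
  shows "autonomous_solution (\<lambda>z. (W z - \<beta>) / \<alpha>) S c (smult (1 / \<alpha>) (pcompose P [:\<beta>, \<alpha>:]))"
proof unfold_locales
  let ?u = "\<lambda>z. (W z - \<beta>) / \<alpha>"
  show "S sparse_in UNIV" by (rule sparse)
  show "?u analytic_on {z}" if "z \<notin> S" for z
    by (intro analytic_intros analytic[OF that]) (use \<alpha> in auto)
  show "is_pole ?u a" if "a \<in> S" for a
  proof -
    have "filterlim W at_infinity (at a)" using poles[OF that] by (simp add: is_pole_def)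
    from tendsto_add_filterlim_at_infinity'[OF this tendsto_const[of "- \<beta>"]]
    have "filterlim (\<lambda>z. W z - \<beta>) at_infinity (at a)" by simp
    from tendsto_mult_filterlim_at_infinity[OF tendsto_const[of "1 / \<alpha>"] _ this]
    show ?thesis using \<alpha> by (simp add: is_pole_def)
  qed
  fix z assume z: "z \<notin> S"
  have 1: "deriv ?u x = deriv W x / \<alpha>" if "x \<notin> S" for x
    by (rule DERIV_imp_deriv) (use \<alpha> in \<open>auto intro!: derivative_eq_intros has_deriv[OF that]\<close>)
  have "(deriv ?u has_field_derivative deriv (deriv W) z / \<alpha>) (at z)"
  proof (rule has_field_derivative_transform_within_open[OF _ open_compl])
    show "((\<lambda>x. deriv W x / \<alpha>) has_field_derivative deriv (deriv W) z / \<alpha>) (at z)"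
      using \<alpha> by (auto intro!: derivative_eq_intros has_deriv2[OF z])
  qed (use z 1 in auto)
  then have 2: "deriv (deriv ?u) z = deriv (deriv W) z / \<alpha>" by (rule DERIV_imp_deriv)
  have "poly (smult (1 / \<alpha>) (pcompose P [:\<beta>, \<alpha>:])) (?u z) = poly P (W z) / \<alpha>"
    using \<alpha> by (simp add: poly_pcompose)
  then have "deriv (deriv ?u) z + c * deriv ?u z + poly (smult (1 / \<alpha>) (pcompose P [:\<beta>, \<alpha>:])) (?u z)
     = (deriv (deriv W) z + c * deriv W z + poly P (W z)) / \<alpha>"
    unfolding 1[OF z] 2 by (simp add: add_divide_distrib)
  then show "deriv (deriv ?u) z + c * deriv ?u z + poly (smult (1 / \<alpha>) (pcompose P [:\<beta>, \<alpha>:])) (?u z) = 0"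
    using ode[OF z] by simp
qed

lemma exponentially_tame_if_normal_form:
  assumes \<alpha>: "\<alpha> \<noteq> 0" and u: "exponentially_tame (\<lambda>z. (W z - \<beta>) / \<alpha>)"
  shows "exponentially_tame W"
proof -
  interpret u: autonomous_solution "\<lambda>z. (W z - \<beta>) / \<alpha>" S c "smult (1 / \<alpha>) (pcompose P [:\<beta>, \<alpha>:])"
    by (rule affine_change[OF \<alpha>])
  show ?thesis
  proof (rule exponentially_tame_affine[OF u])
    show "is_pole W a = is_pole (\<lambda>z. (W z - \<beta>) / \<alpha>) a" for a
      by (simp only: is_pole_iff u.is_pole_iff)
    show "-2 \<le> zorder W a" if "is_pole W a" for a using pole_order_cases[of a] that is_pole_iff by auto
    show "(\<lambda>z. (W z - \<beta>) / \<alpha>) analytic_on {z}" if "W analytic_on {z}" for z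
      using that \<alpha> by (intro analytic_intros) auto
    show "W z = \<alpha> * ((W z - \<beta>) / \<alpha>) + \<beta>" for z using \<alpha> by simp
  qed
qed

theorem exponentially_tame: "exponentially_tame W"
proof (cases "S = {}")
  case True
  have f: "W holomorphic_on UNIV" using holo True by simp
  have eq: "deriv (deriv W) z + c * deriv W z + poly P (W z) = 0" for z using ode True by simp
  have np: "\<not> is_pole W a" for a using is_pole_iff True by simp
  show ?thesis
  proof (cases "2 \<le> degree P")
    case True
    obtain B where "1 \<le> B" "\<And>z. cmod (W z) \<le> B" using entire_solution_bounded[OF f True eq] by blast
    then show ?thesis by (intro exponentially_tame_entire[of W 0 B] np) auto
  next
    case False
    then have "degree P \<le> 1" by simp
    then obtain A L where "0 \<le> A" "0 \<le> L" "\<And>z. cmod (W z) \<le> A * exp (L * cmod z)"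
      using linear_entire_solution_growth[OF f _ eq] by blast
    then show ?thesis by (intro exponentially_tame_entire[of W L A] np) auto
  qed
next
  case False
  then obtain a where "a \<in> S" by blast
  from pole_order_cases[OF this] consider "degree P = 2" | "degree P = 3" by blast
  then show ?thesis
  proof cases
    case 1
    define q where "q = coeff P 2"
    have q: "q \<noteq> 0" using 1 by (metis leading_coeff_0_iff degree_0 q_def zero_neq_numeral)
    have P: "P = [:coeff P 0, coeff P 1, q:]"
      unfolding q_def using 1
      by (intro poly_eqI) (auto simp: coeff_pCons coeff_eq_0 numeral_2_eq_2 split: nat.split)
    define \<alpha> where "\<alpha> = - 6 / q"
    define \<beta> where "\<beta> = - coeff P 1 / (2 * q)"
    have \<alpha>: "\<alpha> \<noteq> 0" using q by (simp add: \<alpha>_def)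
    interpret u: autonomous_solution "\<lambda>z. (W z - \<beta>) / \<alpha>" S c "smult (1 / \<alpha>) (pcompose P [:\<beta>, \<alpha>:])"
      by (rule affine_change[OF \<alpha>])
    have "smult (1 / \<alpha>) (pcompose P [:\<beta>, \<alpha>:]) = [:poly P \<beta> / \<alpha>, 0, -6:]"
    proof -
      have "smult (1 / \<alpha>) (pcompose [:p0, p1, q:] [:\<beta>, \<alpha>:])
         = [:poly [:p0, p1, q:] \<beta> / \<alpha>, p1 + 2 * q * \<beta>, q * \<alpha>:]" for p0 p1
        using \<alpha> by (simp add: pcompose_pCons field_simps)
      from this[of "coeff P 0" "coeff P 1"] show ?thesis
        unfolding P[symmetric] using q by (simp add: \<alpha>_def \<beta>_def)
    qed
    from u.exponentially_tame_quadratic[OF this False] show ?thesis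
      by (rule exponentially_tame_if_normal_form[OF \<alpha>])
  next
    case 2
    define q where "q = coeff P 3"
    have q: "q \<noteq> 0" using 2 by (metis leading_coeff_0_iff degree_0 q_def zero_neq_numeral)
    have P: "P = [:coeff P 0, coeff P 1, coeff P 2, q:]"
      unfolding q_def using 2
      by (intro poly_eqI) (auto simp: coeff_pCons coeff_eq_0 numeral_2_eq_2 numeral_3_eq_3 split: nat.split)
    define \<alpha> where "\<alpha> = csqrt (- 2 / q)"
    define \<beta> where "\<beta> = - coeff P 2 / (3 * q)"
    have \<alpha>: "\<alpha> \<noteq> 0" using q by (simp add: \<alpha>_def)
    have \<alpha>2: "q * \<alpha> ^ 2 = - 2" using q by (simp add: \<alpha>_def)
    interpret u: autonomous_solution "\<lambda>z. (W z - \<beta>) / \<alpha>" S c "smult (1 / \<alpha>) (pcompose P [:\<beta>, \<alpha>:])"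
      by (rule affine_change[OF \<alpha>])
    have "smult (1 / \<alpha>) (pcompose P [:\<beta>, \<alpha>:]) = [:poly P \<beta> / \<alpha>, poly (pderiv P) \<beta>, 0, -2:]"
    proof -
      have "smult (1 / \<alpha>) (pcompose [:p0, p1, p2, q:] [:\<beta>, \<alpha>:])
         = [:poly [:p0, p1, p2, q:] \<beta> / \<alpha>, poly (pderiv [:p0, p1, p2, q:]) \<beta>, (p2 + 3 * q * \<beta>) * \<alpha>, q * \<alpha> ^ 2:]" for p0 p1 p2
        using \<alpha> by (simp add: pcompose_pCons pderiv_pCons field_simps power2_eq_square)
      from this[of "coeff P 0" "coeff P 1" "coeff P 2"] show ?thesis
        unfolding P[symmetric] \<alpha>2 using q by (simp add: \<beta>_def)
    qed
    from u.exponentially_tame_cubic[OF this False] show ?thesis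
      by (rule exponentially_tame_if_normal_form[OF \<alpha>])
  qed
qed

end

text \<open>Filling in the removable singularities extends the equation to all points that are not poles, by continuity.\<close>

lemma autonomous_solution_remove_sings:
  assumes "meromorphic_solution c P w"
  shows "autonomous_solution (remove_sings w) {z. is_pole w z} c P"
proof unfold_locales
  have mero: "w meromorphic_on UNIV"
    and ode: "\<And>z. w analytic_on {z} \<Longrightarrow> deriv (deriv w) z + c * deriv w z + poly P (w z) = 0"
    using assms by (auto simp: meromorphic_solution_def)
  let ?W = "remove_sings w"
  have nice: "?W nicely_meromorphic_on UNIV" by (rule remove_sings_nicely_meromorphic[OF mero])
  have ev: "eventually (\<lambda>x. ?W x = w x) (at z)" for z
    by (rule eventually_remove_sings_eq_at)
       (use mero in \<open>auto intro: meromorphic_on_isolated_singularity meromorphic_on_subset\<close>)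
  have pole: "is_pole ?W z \<longleftrightarrow> is_pole w z" for z by (rule is_pole_cong[OF ev refl])
  show "{z. is_pole w z} sparse_in UNIV"
    using meromorphic_on_imp_not_pole_cosparse[OF mero] by (simp add: eventually_cosparse)
  show an: "?W analytic_on {z}" if "z \<notin> {z. is_pole w z}" for z
    using nicely_meromorphic_on_imp_analytic_at[OF nice] that pole by auto
  show "is_pole ?W a" if "a \<in> {z. is_pole w z}" for a using that pole by simp
  fix z assume z: "z \<notin> {z. is_pole w z}"
  define E where "E x = deriv (deriv ?W) x + c * deriv ?W x + poly P (?W x)" for x
  have "?W analytic_on {z}" by (rule an[OF z])
  then obtain r where r: "0 < r" "?W holomorphic_on ball z r" by (auto simp: analytic_on_def)
  have "deriv ?W holomorphic_on ball z r" "deriv (deriv ?W) holomorphic_on ball z r"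
    using r(2) by (auto intro!: holomorphic_deriv)
  moreover have "(\<lambda>x. poly P (?W x)) holomorphic_on ball z r"
    unfolding poly_altdef by (intro holomorphic_intros r)
  ultimately have "E holomorphic_on ball z r"
    unfolding E_def[abs_def] by (intro holomorphic_on_add holomorphic_on_mult holomorphic_on_const)
  then have "isCont E z" using r(1)
    by (intro field_differentiable_imp_continuous_at holomorphic_on_imp_differentiable_at[OF _ open_ball]) auto
  then have "(E \<longlongrightarrow> E z) (at z)" by (simp add: isCont_def)
  moreover have "eventually (\<lambda>x. E x = 0) (at z)"
  proof -
    have "eventually (\<lambda>x. w analytic_on {x}) (at z)"
      using meromorphic_on_imp_analytic_cosparse[OF mero] by (simp add: eventually_cosparse_open_eq)
    then show ?thesis
    proof (rule eventually_mono)
      fix x assume x: "w analytic_on {x}"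
      have evx: "eventually (\<lambda>y. ?W y = w y) (nhds x)" by (rule eventually_remove_sings_eq_nhds[OF x])
      have "(deriv ^^ 2) ?W x = (deriv ^^ 2) w x" by (rule higher_deriv_cong_ev[OF evx refl])
      then have "deriv (deriv ?W) x = deriv (deriv w) x" by (simp add: numeral_2_eq_2)
      moreover have "deriv ?W x = deriv w x" by (rule deriv_cong_ev[OF evx refl])
      moreover have "?W x = w x" using evx by (rule eventually_nhds_x_imp_x)
      ultimately show "E x = 0" using ode[OF x] by (simp add: E_def)
    qed
  qed
  then have "(E \<longlongrightarrow> 0) (at z)" by (rule tendsto_eventually)
  ultimately have "E z = 0" by (rule tendsto_unique[OF trivial_limit_at])
  then show "deriv (deriv ?W) z + c * deriv ?W z + poly P (?W z) = 0" by (simp add: E_def)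
qed

theorem theorem3p4:
  fixes c :: complex and P :: "complex poly" and k :: nat and w :: "complex \<Rightarrow> complex"
  assumes "degree P = k"
    and "meromorphic_solution c P w"
  shows "\<exists>a b \<gamma> :: real. a > 0 \<and> b > 0 \<and> \<gamma> > 0 \<and>
           (\<forall>r\<ge>0. nevanlinna_T r w < a * exp (b * r powr \<gamma>))"
proof -
  interpret autonomous_solution "remove_sings w" "{z. is_pole w z}" c P
    by (rule autonomous_solution_remove_sings[OF assms(2)])
  have mero: "w meromorphic_on UNIV" using assms(2) by (simp add: meromorphic_solution_def)
  have ev: "eventually (\<lambda>x. w x = remove_sings w x) (at z)" for z
    using eventually_remove_sings_eq_at[of w z] mero
    by (auto intro: meromorphic_on_isolated_singularity meromorphic_on_subset simp: eq_commute)
  have "exponentially_tame w"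
  proof (rule exponentially_tame_affine[OF exponentially_tame, of w 1 0])
    show pole: "is_pole w a = is_pole (remove_sings w) a" for a by (rule is_pole_cong[OF ev refl])
    show "-2 \<le> zorder w a" if "is_pole w a" for a
      using pole_order_cases[of a] that zorder_cong[OF ev refl, of a] by auto
    fix z assume z: "w analytic_on {z}"
    have "\<not> is_pole w z" using z analytic_at_imp_no_pole by blast
    then show "remove_sings w analytic_on {z}" using analytic[of z] by simp
    show "w z = 1 * remove_sings w z + 0" using remove_sings_at_analytic[OF z] by simp
  qed
  then show ?thesis by (rule nevanlinna_T_exponential_bound[OF mero])
qed

end
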